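(* Let $d\in\{2,3\}$, $p\in(1,\infty)$, $s\in(-1,1)$ and $\alpha=\frac{d-1}{p}-s$. The scaled single layer operator $\widetilde{\mathbb S}_\alpha=\mathcal M_\alpha\widetilde S_\Gamma\mathcal M_\alpha^{-1}$ admits the exact factorisation $$\widetilde{\mathbb S}_\alpha=D^\alpha\,\widetilde{\mathbb S}_{\mathrm{Toep}}\,D^{1-\alpha},$$ where $\widetilde{\mathbb S}_{\mathrm{Toep}}$ is the block-Toeplitz operator with block entries $(\widetilde{\mathbb S}_{\mathrm{Toep}})_{j,k}=\tilde S_{j-k}$, $j,k\ge0$, and $\tilde S_m:W^{s,p}_0(\Gamma_0)\to W^{s,p}_0(\Gamma_0)$, $m\in\mathbb Z$, is defined by $$(\tilde S_m\psi)(\tilde x)=P_{0,0}\Bigl(\int_{\Gamma_0}G(\eta_m(\tilde x),\tilde y)\psi(\tilde y)\,d\sigma_0(\tilde y)\Bigr).$$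
   Context: Geometry. Let $r\in(0,1)$, and let $\Omega_0\subset\mathbb R^d$ be a bounded connected domain with $C^\infty$ boundary $\Gamma_0=\partial\Omega_0$ and $0\notin\overline{\Omega_0}$. Put $\Omega_j=r^j\Omega_0$ and assume $\overline{\Omega_j}\cap\overline{\Omega_k}=\emptyset$ for $j\neq k$ ($j,k\ge0$). Put $\Gamma_j=r^j\Gamma_0$ and $\Gamma=\bigcup_{j\ge0}\Gamma_j$, with surface measure $\sigma$ ($\sigma_0$ on $\Gamma_0$). For $m\in\mathbb Z$ let $\eta_m(x)=r^mx$. Fundamental solution. $G(x,y)=\frac1{2\pi}\log|x-y|$ if $d=2$ and $G(x,y)=-\frac1{4\pi}|x-y|^{-1}$ if $d=3$. Function spaces. For $\Sigma=\Gamma$ or $\Sigma=\Gamma_j$: $W^{0,p}(\Sigma)=L^p(\Sigma)$; for $s\in(0,1)$, $\|\varphi\|_{W^{s,p}(\Sigma)}^p=\|\varphi\|_{L^p(\Sigma)}^p+\int_\Sigma\int_\Sigma\frac{|\varphi(x)-\varphi(y)|^p}{|x-y|^{d-1+sp}}d\sigma(x)d\sigma(y)$; for $s\in(-1,0)$, $W^{s,p}(\Sigma)$ is the dual of $W^{-s,p'}(\Sigma)$ for the $L^2$ pairing, $1/p+1/p'=1$. $W^{s,p}_0(\Gamma)$ is the subspace of $\varphi$ with $\int_{\Gamma_j}\varphi\,d\sigma=0$ for all $j$; $W^{s,p}_0(\Gamma_j)$ is the subspace of $W^{s,p}(\Gamma_j)$ with zero integral over $\Gamma_j$ (integrals are duality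 pairings with indicator functions when $s<0$). $\ell^p(\mathbb N,X)$ denotes $X$-valued $p$-summable sequences indexed by $j\ge0$. Operators. $S_\Gamma\varphi(x)=\sum_{j\ge0}\int_{\Gamma_j}G(x,y)\varphi(y)\,d\sigma(y)$ (by duality/continuous extension when $s<0$). $P_{0,j}\varphi_j=\varphi_j-\frac1{|\Gamma_j|}\int_{\Gamma_j}\varphi_j\,d\sigma$ on each $\Gamma_j$; $P_0$ acts as $P_{0,j}$ on each component; $\widetilde S_\Gamma=P_0S_\Gamma P_0$, considered on $W^{s,p}_0(\Gamma)$. Rescaling. For $\beta\in\mathbb R$, $D^\beta$ is the diagonal operator $(D^\beta u)_j=r^{j\beta}u_j$ on sequences. $\mathcal M_\alpha:W^{s,p}_0(\Gamma)\to\ell^p(\mathbb N,W^{s,p}_0(\Gamma_0))$ is the isomorphism $(\mathcal M_\alpha\varphi)_j=r^{j\alpha}\,\varphi|_{\Gamma_j}\circ\eta_j$ (restriction and pullback by duality when $s<0$). Operators on the sequence space are identified with their block matrices, the $(j,k)$ block sending $\psi$ to the $j$-th component of the image of the sequence with $\psi$ in position $k$ and zeros elsewhere; the factorisation is an identity of block matrices, i.e. $(\widetilde{\mathbb S}_\alpha)_{j,k}=r^{j\alpha}\tilde S_{j-k}r^{k(1-\alpha)}$. *)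

theory Defs
  imports "HOL-Analysis.Analysis"
begin

section \<open>Hausdorff measure and surface measure\<close>

definition hausdorff_pre :: "nat \<Rightarrow> real \<Rightarrow> 'a::metric_space set \<Rightarrow> ennreal" where
  "hausdorff_pre n \<delta> A =
     (INF U \<in> {U :: nat \<Rightarrow> 'a set. A \<subseteq> (\<Union>i. U i) \<and> (\<forall>i. bounded (U i) \<and> diameter (U i) \<le> \<delta>)}.
        \<Sum>i. ennreal (unit_ball_vol (real n) * (diameter (U i) / 2) ^ n))"

definition hausdorff_outer :: "nat \<Rightarrow> 'a::metric_space set \<Rightarrow> ennreal" where
  "hausdorff_outer n A = (SUP \<delta> \<in> {0<..}. hausdorff_pre n \<delta> A)"

(* The outer measure is a metric outer measure, hence countably additive on the Borel sets. *)
definition hausdorff_measure :: "nat \<Rightarrow> 'a::metric_space measure" where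
  "hausdorff_measure n = measure_of UNIV (sets borel) (hausdorff_outer n)"

(* With the normalisation by unit_ball_vol, the (d-1)-dimensional Hausdorff measure is the
   usual surface measure on smooth hypersurfaces. *)
definition surface :: "'a::euclidean_space set \<Rightarrow> 'a measure" where
  "surface \<Sigma> = restrict_space (hausdorff_measure (DIM('a) - 1)) \<Sigma>"


section \<open>Domains with smooth boundary\<close>

primrec Ck :: "nat \<Rightarrow> ('a::euclidean_space \<Rightarrow> real) \<Rightarrow> bool" where
  "Ck 0 f \<longleftrightarrow> continuous_on UNIV f"
| "Ck (Suc k) f \<longleftrightarrow> (\<exists>f'. (\<forall>x. (f has_derivative f' x) (at x)) \<and> (\<forall>v. Ck k (\<lambda>x. f' x v)))"

definition smooth :: "('a::euclidean_space \<Rightarrow> real) \<Rightarrow> bool" where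
  "smooth f \<longleftrightarrow> (\<forall>k. Ck k f)"

(* Near each boundary point, the set lies on one side of the graph of a smooth function over a
   hyperplane with unit normal e; g is only evaluated on that hyperplane. *)
definition smooth_boundary :: "'a::euclidean_space set \<Rightarrow> bool" where
  "smooth_boundary \<Omega> \<longleftrightarrow>
     (\<forall>x \<in> frontier \<Omega>. \<exists>\<rho>>0. \<exists>e g. norm e = 1 \<and> smooth g \<and>
        \<Omega> \<inter> ball x \<rho> = {y \<in> ball x \<rho>. g (y - (y \<bullet> e) *\<^sub>R e) < y \<bullet> e})"


section \<open>Scaled copies of the boundary\<close>

definition eta :: "real \<Rightarrow> int \<Rightarrow> 'a::euclidean_space \<Rightarrow> 'a" where
  "eta r m x = (r powi m) *\<^sub>R x"

definition Gam :: "real \<Rightarrow> 'a::euclidean_space set \<Rightarrow> nat \<Rightarrow> 'a set" where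
  "Gam r \<Omega> j = eta r (int j) ` frontier \<Omega>"

definition Gam_all :: "real \<Rightarrow> 'a::euclidean_space set \<Rightarrow> 'a set" where
  "Gam_all r \<Omega> = (\<Union>j. Gam r \<Omega> j)"


section \<open>Sobolev-Slobodeckij spaces\<close>

(* For s \<ge> 0 an element is represented by a function 'a \<Rightarrow> real, with equality almost everywhere
   on \<Sigma>. For s < 0 an element is represented by a functional ('a \<Rightarrow> real) \<Rightarrow> real, with equality
   on the predual W_fun (-s) (p/(p-1)) \<Sigma>. *)

definition sob_energy :: "real \<Rightarrow> real \<Rightarrow> 'a::euclidean_space set \<Rightarrow> ('a \<Rightarrow> real) \<Rightarrow> ennreal" where
  "sob_energy s p \<Sigma> f =
     (\<integral>\<^sup>+x. ennreal (\<bar>f x\<bar> powr p) \<partial>surface \<Sigma>) +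
     (if s = 0 then 0 else
       (\<integral>\<^sup>+x. (\<integral>\<^sup>+y. ennreal (\<bar>f x - f y\<bar> powr p / norm (x - y) powr (real DIM('a) - 1 + s * p))
          \<partial>surface \<Sigma>) \<partial>surface \<Sigma>))"

definition sob_norm :: "real \<Rightarrow> real \<Rightarrow> 'a::euclidean_space set \<Rightarrow> ('a \<Rightarrow> real) \<Rightarrow> real" where
  "sob_norm s p \<Sigma> f = enn2real (sob_energy s p \<Sigma> f) powr (1 / p)"

definition W_fun :: "real \<Rightarrow> real \<Rightarrow> 'a::euclidean_space set \<Rightarrow> ('a \<Rightarrow> real) set" where
  "W_fun s p \<Sigma> = {f \<in> borel_measurable (surface \<Sigma>). sob_energy s p \<Sigma> f < \<infinity>}"

definition W_dual :: "real \<Rightarrow> real \<Rightarrow> 'a::euclidean_space set \<Rightarrow> (('a \<Rightarrow> real) \<Rightarrow> real) set" where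
  "W_dual s p \<Sigma> =
     (let q = p / (p - 1); V = W_fun (-s) q \<Sigma> in
      {F. (\<forall>v\<in>V. \<forall>w\<in>V. F (\<lambda>x. v x + w x) = F v + F w) \<and>
          (\<forall>c. \<forall>v\<in>V. F (\<lambda>x. c * v x) = c * F v) \<and>
          (\<exists>C. \<forall>v\<in>V. \<bar>F v\<bar> \<le> C * sob_norm (-s) q \<Sigma> v)})"

(* Zero mean on a single surface. *)
definition W0_fun :: "real \<Rightarrow> real \<Rightarrow> 'a::euclidean_space set \<Rightarrow> ('a \<Rightarrow> real) set" where
  "W0_fun s p \<Sigma> = {f \<in> W_fun s p \<Sigma>. (\<integral>x. f x \<partial>surface \<Sigma>) = 0}"

definition W0_dual :: "real \<Rightarrow> real \<Rightarrow> 'a::euclidean_space set \<Rightarrow> (('a \<Rightarrow> real) \<Rightarrow> real) set" where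
  "W0_dual s p \<Sigma> = {F \<in> W_dual s p \<Sigma>. F (indicator \<Sigma>) = 0}"

(* Zero mean on every component of the union of all scaled surfaces. *)
definition W0_fun_all ::
  "real \<Rightarrow> real \<Rightarrow> real \<Rightarrow> 'a::euclidean_space set \<Rightarrow> ('a \<Rightarrow> real) set" where
  "W0_fun_all s p r \<Omega> =
     {f \<in> W_fun s p (Gam_all r \<Omega>). \<forall>j. (\<integral>x. f x \<partial>surface (Gam r \<Omega> j)) = 0}"

definition W0_dual_all ::
  "real \<Rightarrow> real \<Rightarrow> real \<Rightarrow> 'a::euclidean_space set \<Rightarrow> (('a \<Rightarrow> real) \<Rightarrow> real) set" where
  "W0_dual_all s p r \<Omega> =
     {F \<in> W_dual s p (Gam_all r \<Omega>). \<forall>j. F (indicator (Gam r \<Omega> j)) = 0}"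


section \<open>The projected single layer operator\<close>

(* Intended for dimension 2 and 3 only. *)
definition fund_sol :: "'a::euclidean_space \<Rightarrow> 'a \<Rightarrow> real" where
  "fund_sol x y = (if DIM('a) = 2 then ln (norm (x - y)) / (2 * pi)
                   else - 1 / (4 * pi * norm (x - y)))"

definition P0_comp :: "'a::euclidean_space set \<Rightarrow> ('a \<Rightarrow> real) \<Rightarrow> 'a \<Rightarrow> real" where
  "P0_comp \<Sigma> u x = u x - (\<integral>y. u y \<partial>surface \<Sigma>) / measure (surface \<Sigma>) \<Sigma>"

(* The components are disjoint, so at most one summand is nonzero. *)
definition P0 :: "real \<Rightarrow> 'a::euclidean_space set \<Rightarrow> ('a \<Rightarrow> real) \<Rightarrow> 'a \<Rightarrow> real" where
  "P0 r \<Omega> u x = (\<Sum>j. indicator (Gam r \<Omega> j) x * P0_comp (Gam r \<Omega> j) u x)"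

definition SL :: "real \<Rightarrow> 'a::euclidean_space set \<Rightarrow> ('a \<Rightarrow> real) \<Rightarrow> 'a \<Rightarrow> real" where
  "SL r \<Omega> \<phi> x = (\<Sum>j. \<integral>y. fund_sol x y * \<phi> y \<partial>surface (Gam r \<Omega> j))"

(* Extension of an L2-symmetric operator to functionals. Both P0 and SL are symmetric. *)
definition by_duality ::
  "(('a \<Rightarrow> real) \<Rightarrow> ('a \<Rightarrow> real)) \<Rightarrow> (('a \<Rightarrow> real) \<Rightarrow> real) \<Rightarrow> ('a \<Rightarrow> real) \<Rightarrow> real" where
  "by_duality T F = (\<lambda>v. F (T v))"

definition SL_proj_fun ::
  "real \<Rightarrow> real \<Rightarrow> real \<Rightarrow> 'a::euclidean_space set \<Rightarrow> ('a \<Rightarrow> real) \<Rightarrow> 'a \<Rightarrow> real" where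
  "SL_proj_fun s p r \<Omega> = (\<lambda>\<phi> \<in> W0_fun_all s p r \<Omega>. P0 r \<Omega> (SL r \<Omega> (P0 r \<Omega> \<phi>)))"

definition SL_proj_dual ::
  "real \<Rightarrow> real \<Rightarrow> real \<Rightarrow> 'a::euclidean_space set \<Rightarrow> (('a \<Rightarrow> real) \<Rightarrow> real) \<Rightarrow> ('a \<Rightarrow> real) \<Rightarrow> real" where
  "SL_proj_dual s p r \<Omega> = (\<lambda>F \<in> W0_dual_all s p r \<Omega>.
     by_duality (P0 r \<Omega>) (by_duality (SL r \<Omega>) (by_duality (P0 r \<Omega>) F)))"


section \<open>Rescaling to sequences\<close>

definition resc_fun :: "real \<Rightarrow> real \<Rightarrow> ('a::euclidean_space \<Rightarrow> real) \<Rightarrow> nat \<Rightarrow> 'a \<Rightarrow> real" where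
  "resc_fun r \<alpha> \<phi> j x = r powr (real j * \<alpha>) * \<phi> (eta r (int j) x)"

definition resc_inv_fun ::
  "real \<Rightarrow> 'a::euclidean_space set \<Rightarrow> real \<Rightarrow> (nat \<Rightarrow> 'a \<Rightarrow> real) \<Rightarrow> 'a \<Rightarrow> real" where
  "resc_inv_fun r \<Omega> \<alpha> u x =
     (\<Sum>j. indicator (Gam r \<Omega> j) x * (r powr (- (real j * \<alpha>)) * u j (eta r (- int j) x)))"

(* The factor r powr (- j (d-1)) is the Jacobian of the change of variables x \<mapsto> r^j x in the
   pairing: the integral of (\<phi> o eta_j) w over Gamma_0 is r^(-j(d-1)) times the integral of
   \<phi> (w o eta_{-j}) over Gamma_j. *)
definition resc_dual ::
  "real \<Rightarrow> 'a::euclidean_space set \<Rightarrow> real \<Rightarrow> (('a \<Rightarrow> real) \<Rightarrow> real) \<Rightarrow> nat \<Rightarrow> ('a \<Rightarrow> real) \<Rightarrow> real" where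
  "resc_dual r \<Omega> \<alpha> F j w =
     r powr (real j * \<alpha>) * (r powr (- (real j * (real DIM('a) - 1))) *
       F (\<lambda>x. indicator (Gam r \<Omega> j) x * w (eta r (- int j) x)))"

definition resc_inv_dual ::
  "real \<Rightarrow> real \<Rightarrow> (nat \<Rightarrow> ('a::euclidean_space \<Rightarrow> real) \<Rightarrow> real) \<Rightarrow> ('a \<Rightarrow> real) \<Rightarrow> real" where
  "resc_inv_dual r \<alpha> u v =
     (\<Sum>j. r powr (- (real j * \<alpha>)) * (r powr (real j * (real DIM('a) - 1)) *
       u j (\<lambda>x. v (eta r (int j) x))))"

lemma eta_cancel: "r > 0 \<Longrightarrow> eta r (- m) (eta r m x) = x" "r > 0 \<Longrightarrow> eta r m (eta r (- m) x) = x"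
  by (simp_all add: eta_def power_int_minus)

lemma eta_mem_Gam:
  assumes "\<And>j k. j \<noteq> k \<Longrightarrow> Gam r \<Omega> j \<inter> Gam r \<Omega> k = {}" and "x \<in> frontier \<Omega>"
  shows "eta r (int j) x \<in> Gam r \<Omega> i \<longleftrightarrow> i = j"
proof -
  have "eta r (int j) x \<in> Gam r \<Omega> j" using assms(2) by (auto simp: Gam_def)
  then show ?thesis using assms(1)[of i j] by blast
qed

lemma suminf_one:
  fixes f :: "nat \<Rightarrow> real"
  assumes "\<And>i. i \<noteq> k \<Longrightarrow> f i = 0"
  shows "(\<Sum>i. f i) = f k"
  using suminf_finite[of "{k}" f] assms by simp

lemma resc_fun_inv:
  assumes "r > 0" and "\<And>j k. j \<noteq> k \<Longrightarrow> Gam r \<Omega> j \<inter> Gam r \<Omega> k = {}" and "x \<in> frontier \<Omega>"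
  shows "resc_fun r \<alpha> (resc_inv_fun r \<Omega> \<alpha> u) j x = u j x"
proof -
  have "resc_inv_fun r \<Omega> \<alpha> u (eta r (int j) x) = r powr (- (real j * \<alpha>)) * u j x"
    unfolding resc_inv_fun_def
    by (subst suminf_one[of j])
      (auto simp: eta_mem_Gam[OF assms(2,3)] eta_cancel[OF assms(1)])
  then show ?thesis
    using assms(1) by (simp add: resc_fun_def powr_minus)
qed

lemma resc_inv_fun_resc:
  assumes "r > 0" and "\<And>j k. j \<noteq> k \<Longrightarrow> Gam r \<Omega> j \<inter> Gam r \<Omega> k = {}" and "x \<in> Gam_all r \<Omega>"
  shows "resc_inv_fun r \<Omega> \<alpha> (resc_fun r \<alpha> \<phi>) x = \<phi> x"
proof -
  obtain j y where y: "y \<in> frontier \<Omega>" "x = eta r (int j) y"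
    using assms(3) by (auto simp: Gam_all_def Gam_def)
  have "resc_inv_fun r \<Omega> \<alpha> (resc_fun r \<alpha> \<phi>) x
      = r powr (- (real j * \<alpha>)) * resc_fun r \<alpha> \<phi> j y"
    unfolding resc_inv_fun_def y(2)
    by (subst suminf_one[of j])
      (auto simp: eta_mem_Gam[OF assms(2) y(1)] eta_cancel[OF assms(1)])
  then show ?thesis
    using assms(1) y(2) by (simp add: resc_fun_def powr_minus)
qed

lemma resc_dual_inv:
  fixes u :: "nat \<Rightarrow> ('a::euclidean_space \<Rightarrow> real) \<Rightarrow> real"
  assumes "r > 0" and "\<And>j k. j \<noteq> k \<Longrightarrow> Gam r \<Omega> j \<inter> Gam r \<Omega> k = {}"
    and "\<And>i v w. (\<And>x. x \<in> frontier \<Omega> \<Longrightarrow> v x = w x) \<Longrightarrow> u i v = u i w"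
    and "\<And>i. u i (\<lambda>_. 0) = 0"
  shows "resc_dual r \<Omega> \<alpha> (resc_inv_dual r \<alpha> u) j w = u j w"
proof -
  let ?E = "\<lambda>x. indicator (Gam r \<Omega> j) x * w (eta r (- int j) x)"
  have "u i (\<lambda>x. ?E (eta r (int i) x)) = u i (\<lambda>x. if i = j then w x else 0)" for i
    by (intro assms(3)) (auto simp: eta_mem_Gam[OF assms(2)] eta_cancel[OF assms(1)])
  then have "resc_inv_dual r \<alpha> u ?E
      = r powr (- (real j * \<alpha>)) * (r powr (real j * (real DIM('a) - 1)) * u j w)"
    unfolding resc_inv_dual_def by (subst suminf_one[of j]) (auto simp: assms(4))
  moreover have "a * (inverse b * (inverse a * (b * c))) = c" if "a \<noteq> 0" "b \<noteq> 0" for a b c :: real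
    using that by (simp add: field_simps)
  ultimately show ?thesis
    using assms(1) by (simp only: resc_dual_def powr_minus) simp
qed

definition scaled_SL_fun ::
  "real \<Rightarrow> real \<Rightarrow> real \<Rightarrow> 'a::euclidean_space set \<Rightarrow> real \<Rightarrow> (nat \<Rightarrow> 'a \<Rightarrow> real) \<Rightarrow> nat \<Rightarrow> 'a \<Rightarrow> real" where
  "scaled_SL_fun s p r \<Omega> \<alpha> u = resc_fun r \<alpha> (SL_proj_fun s p r \<Omega> (resc_inv_fun r \<Omega> \<alpha> u))"

definition scaled_SL_dual ::
  "real \<Rightarrow> real \<Rightarrow> real \<Rightarrow> 'a::euclidean_space set \<Rightarrow> real \<Rightarrow>
     (nat \<Rightarrow> ('a \<Rightarrow> real) \<Rightarrow> real) \<Rightarrow> nat \<Rightarrow> ('a \<Rightarrow> real) \<Rightarrow> real" where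
  "scaled_SL_dual s p r \<Omega> \<alpha> u = resc_dual r \<Omega> \<alpha> (SL_proj_dual s p r \<Omega> (resc_inv_dual r \<alpha> u))"


section \<open>Block operators on sequences\<close>

(* Here 'b is 'a for functions and 'a \<Rightarrow> real for functionals. *)

definition diag_op :: "real \<Rightarrow> real \<Rightarrow> (nat \<Rightarrow> 'b \<Rightarrow> real) \<Rightarrow> nat \<Rightarrow> 'b \<Rightarrow> real" where
  "diag_op r \<beta> u j x = r powr (real j * \<beta>) * u j x"

definition toeplitz_op ::
  "(int \<Rightarrow> ('b \<Rightarrow> real) \<Rightarrow> ('b \<Rightarrow> real)) \<Rightarrow> (nat \<Rightarrow> 'b \<Rightarrow> real) \<Rightarrow> nat \<Rightarrow> 'b \<Rightarrow> real" where
  "toeplitz_op A u j x = (\<Sum>k. A (int j - int k) (u k) x)"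

definition single_seq :: "nat \<Rightarrow> ('b \<Rightarrow> real) \<Rightarrow> nat \<Rightarrow> 'b \<Rightarrow> real" where
  "single_seq k \<psi> i x = (if i = k then \<psi> x else 0)"

definition block ::
  "((nat \<Rightarrow> 'b \<Rightarrow> real) \<Rightarrow> nat \<Rightarrow> 'b \<Rightarrow> real) \<Rightarrow> nat \<Rightarrow> nat \<Rightarrow> ('b \<Rightarrow> real) \<Rightarrow> 'b \<Rightarrow> real" where
  "block T j k \<psi> = T (single_seq k \<psi>) j"

lemma block_toeplitz_op:
  assumes "\<And>m. A m (\<lambda>_. 0) = (\<lambda>_. 0)"
  shows "block (toeplitz_op A) j k \<psi> = A (int j - int k) \<psi>"
proof
  fix x
  have "(\<lambda>i. A (int j - int i) (single_seq k \<psi> i) x) = (\<lambda>i. if i = k then A (int j - int i) \<psi> x else 0)"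
  proof
    fix i
    show "A (int j - int i) (single_seq k \<psi> i) x = (if i = k then A (int j - int i) \<psi> x else 0)"
    proof (cases "i = k")
      case True
      then have "single_seq k \<psi> i = \<psi>" by (auto simp: single_seq_def)
      with True show ?thesis by simp
    next
      case False
      then have "single_seq k \<psi> i = (\<lambda>_. 0)" by (auto simp: single_seq_def)
      with False show ?thesis by (simp add: assms)
    qed
  qed
  then show "block (toeplitz_op A) j k \<psi> x = A (int j - int k) \<psi> x"
    using sums_unique[OF sums_single[of k "\<lambda>i. A (int j - int i) \<psi> x"]]
    by (simp add: block_def toeplitz_op_def)
qed

definition S_tilde_fun ::
  "real \<Rightarrow> real \<Rightarrow> real \<Rightarrow> 'a::euclidean_space set \<Rightarrow> int \<Rightarrow> ('a \<Rightarrow> real) \<Rightarrow> 'a \<Rightarrow> real" where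
  "S_tilde_fun s p r \<Omega> m = (\<lambda>\<psi> \<in> W0_fun s p (frontier \<Omega>).
     P0_comp (frontier \<Omega>) (\<lambda>x. \<integral>y. fund_sol (eta r m x) y * \<psi> y \<partial>surface (frontier \<Omega>)))"

(* The kernel G(eta_m x, y) is not symmetric in (x,y), so the transpose is written out: the inner
   function is the transpose, applied to the test function w, of
   \<psi> \<mapsto> P0_comp (\<lambda>x. integral of G(eta_m x, y) \<psi>(y)). *)
definition S_tilde_dual ::
  "real \<Rightarrow> real \<Rightarrow> real \<Rightarrow> 'a::euclidean_space set \<Rightarrow> int \<Rightarrow>
     (('a \<Rightarrow> real) \<Rightarrow> real) \<Rightarrow> ('a \<Rightarrow> real) \<Rightarrow> real" where
  "S_tilde_dual s p r \<Omega> m = (\<lambda>\<psi> \<in> W0_dual s p (frontier \<Omega>).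
     \<lambda>w. \<psi> (\<lambda>y. \<integral>x. fund_sol (eta r m x) y * P0_comp (frontier \<Omega>) w x \<partial>surface (frontier \<Omega>)))"

end

theory Submission
  imports Defs
begin

text \<open>The factorisation is a change of variables: the fundamental solution is homogeneous of degree
  \<open>2 - d\<close>, up to an additive constant in dimension two that is annihilated by mean-zero densities,
  and surface measure scales with \<open>r ^ (d - 1)\<close>. The substance is that the blocks act on the
  Sobolev spaces. Here it suffices that the surface is upper Ahlfors regular: a kernel bounded by
  \<open>\<bar>x - y\<bar> powr (- a)\<close> with \<open>a < d - 1\<close> and Hoelder continuous of order \<open>\<theta> > s\<close> with the same
  singularity maps \<open>L\<^sup>p\<close> to \<open>W\<^sup>s\<^sup>,\<^sup>p\<close>. For \<open>s < 0\<close> the same estimate is applied to the transposed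
  kernel. Countable additivity of the Hausdorff measure is never used: if the outer measure were not
  additive on the Borel sets, \<open>hausdorff_measure\<close> would be the zero measure, which is dominated by
  the outer measure and scales in the same way.\<close>

section \<open>Riesz potentials on upper regular measures\<close>

text \<open>The weights come from counting powers of \<open>r ^ k\<close> in column
  \<open>k\<close>: surface measure gives \<open>d - 1\<close>, homogeneity of the kernel takes away
  \<open>d - 2\<close>, and undoing the rescaling contributes \<open>- \<alpha>\<close>, which
  leaves \<open>1 - \<alpha>\<close>. Mapping properties enter the identity itself:
  \<open>SL_proj_fun\<close>, \<open>S_tilde_fun\<close> and their dual versions are restricted to
  zero-mean spaces and \<open>undefined\<close> elsewhere, so data on one component must be shown to
  lie in the space on the whole union. Although the components accumulate at the origin, each one
  keeps a positive distance from all the others together, which makes this possible. The other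
  obstacle is that potentials are Bochner integrals, which converge only almost everywhere and
  default to \<open>0\<close> elsewhere. Estimates are therefore arranged so that divergence makes
  the right side infinite, and scaling identities so that both sides default together. Additivity of
  the transposed potential is claimed almost everywhere only; a bounded functional does not notice
  the null set.\<close>

lemma young_optimise:
  fixes X i B p :: real
  assumes "1 < p" "0 < B" "0 \<le> i" "0 \<le> X"
    and le: "\<And>t. 0 < t \<Longrightarrow> X \<le> t * B + t powr (1 - p) * i"
  shows "X powr p \<le> 2 powr p * B powr (p - 1) * i"
proof (cases "i = 0")
  case True
  have "X = 0"
  proof (rule ccontr)
    assume "X \<noteq> 0"
    \<comment> \<open>With \<open>i = 0\<close> the hypothesis at this \<open>t\<close> reads
      \<open>X \<le> X / 2\<close>.\<close>
    then have "X \<le> X / (2 * B) * B"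
      using le[of "X / (2 * B)"] assms True by simp
    then show False using assms \<open>X \<noteq> 0\<close> by (simp add: field_simps)
  qed
  then show ?thesis using True by simp
next
  case False
  then have i: "i > 0" using assms by simp
  \<comment> \<open>At this \<open>t\<close> the two terms of the bound are equal, which costs the
    factor \<open>2\<close> inside the power.\<close>
  define t where "t = (i / B) powr (1 / p)"
  have t: "t > 0" using i assms by (simp add: t_def)
  have tp: "t powr p = i / B" using assms i by (simp add: t_def powr_powr)
  have "t powr (1 - p) * i = t * B"
    using t tp assms i by (simp add: powr_diff field_simps)
  then have "X \<le> 2 * (t * B)" using le[OF t] by linarith
  then have "X powr p \<le> (2 * (t * B)) powr p"
    using assms by (intro powr_mono2) auto
  also have "\<dots> = 2 powr p * (i / B * B powr p)"
    using t assms by (simp add: powr_mult tp)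
  also have "\<dots> = 2 powr p * B powr (p - 1) * i"
    using assms by (simp add: powr_diff)
  finally show ?thesis .
qed

text \<open>The factor \<open>2 powr p\<close> compared with Jensen's inequality is lost by splitting
  \<open>\<bar>f\<bar> \<le> t + t powr (1 - p) * \<bar>f\<bar> powr p\<close> and optimising in \<open>t\<close>.\<close>

lemma weighted_integral_powr_bound:
  fixes w f h :: "'b \<Rightarrow> real"
  assumes p: "1 < p" and B: "0 < B"
    and [measurable]: "w \<in> borel_measurable M" "f \<in> borel_measurable M" "h \<in> borel_measurable M"
    and w: "\<And>y. y \<in> space M \<Longrightarrow> 0 \<le> w y"
    and mass: "(\<integral>\<^sup>+y. ennreal (w y) \<partial>M) \<le> ennreal B"
    and h: "AE y in M. \<bar>h y\<bar> \<le> w y * \<bar>f y\<bar>"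
  shows "(\<integral>\<^sup>+y. ennreal (w y * \<bar>f y\<bar> powr p) \<partial>M) < \<infinity> \<Longrightarrow> integrable M h"
    and "ennreal (\<bar>\<integral>y. h y \<partial>M\<bar> powr p) \<le>
      ennreal (2 powr p * B powr (p - 1)) * (\<integral>\<^sup>+y. ennreal (w y * \<bar>f y\<bar> powr p) \<partial>M)"
proof -
  let ?I = "\<integral>\<^sup>+y. ennreal (w y * \<bar>f y\<bar> powr p) \<partial>M"
  have split: "z \<le> t + t powr (1 - p) * z powr p" if "0 < t" "0 \<le> z" for t z :: real
  proof (cases "z \<le> t")
    case False
    then have "z powr (1 - p) \<le> t powr (1 - p)"
      using that p by (intro powr_mono2') auto
    then have "z powr p * z powr (1 - p) \<le> z powr p * t powr (1 - p)"
      by (intro mult_left_mono) auto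
    moreover have "z powr p * z powr (1 - p) = z"
      using False that by (simp flip: powr_add)
    ultimately show ?thesis using that by (simp add: mult.commute)
  qed (use that in \<open>simp add: add_increasing2\<close>)
  have bound: "(\<integral>\<^sup>+y. ennreal \<bar>h y\<bar> \<partial>M) \<le> ennreal (t * B) + ennreal (t powr (1 - p)) * ?I"
    if t: "0 < t" for t
  proof -
    have "(\<integral>\<^sup>+y. ennreal \<bar>h y\<bar> \<partial>M)
        \<le> (\<integral>\<^sup>+y. ennreal t * ennreal (w y) + ennreal (t powr (1 - p)) * ennreal (w y * \<bar>f y\<bar> powr p) \<partial>M)"
    proof (rule nn_integral_mono_AE)
      show "AE y in M. ennreal \<bar>h y\<bar> \<le>
        ennreal t * ennreal (w y) + ennreal (t powr (1 - p)) * ennreal (w y * \<bar>f y\<bar> powr p)"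
        using h AE_space
      proof eventually_elim
        case (elim y)
        have "w y * \<bar>f y\<bar> \<le> w y * (t + t powr (1 - p) * \<bar>f y\<bar> powr p)"
          by (intro mult_left_mono split t w elim) auto
        then have "\<bar>h y\<bar> \<le> t * w y + t powr (1 - p) * (w y * \<bar>f y\<bar> powr p)"
          using elim by (simp add: algebra_simps)
        then have "ennreal \<bar>h y\<bar> \<le> ennreal (t * w y + t powr (1 - p) * (w y * \<bar>f y\<bar> powr p))"
          by (rule ennreal_leI)
        then show ?case
          using t w elim by (simp add: ennreal_plus ennreal_mult)
      qed
    qed
    also have "\<dots> = ennreal t * (\<integral>\<^sup>+y. ennreal (w y) \<partial>M) + ennreal (t powr (1 - p)) * ?I"
      by (simp add: nn_integral_add nn_integral_cmult)
    also have "\<dots> \<le> ennreal (t * B) + ennreal (t powr (1 - p)) * ?I"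
      using mass t B by (auto simp: ennreal_mult intro!: add_right_mono mult_left_mono)
    finally show ?thesis .
  qed
  show int: "integrable M h" if "?I < \<infinity>"
  proof (rule integrableI_bounded)
    have "(\<integral>\<^sup>+y. ennreal \<bar>h y\<bar> \<partial>M) \<le> ennreal (1 * B) + ennreal (1 powr (1 - p)) * ?I"
      by (rule bound) simp
    also have "\<dots> < \<infinity>" using that by (simp add: ennreal_mult_less_top)
    finally show "(\<integral>\<^sup>+y. ennreal (norm (h y)) \<partial>M) < \<infinity>" by simp
  qed simp
  show "ennreal (\<bar>\<integral>y. h y \<partial>M\<bar> powr p) \<le> ennreal (2 powr p * B powr (p - 1)) * ?I"
  proof (cases "?I < \<infinity>")
    \<comment> \<open>The right side is infinite, so a default value of the Bochner integral does no
      harm.\<close>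
    case False
    then have "?I = top" by (simp add: not_less top_unique)
    then have "ennreal (2 powr p * B powr (p - 1)) * ?I = top"
      using B by (simp add: ennreal_mult_eq_top_iff)
    then show ?thesis by simp
  next
    case True
    define i where "i = enn2real ?I"
    have I: "?I = ennreal i" using True by (simp add: i_def)
    have i0: "0 \<le> i" by (simp add: i_def)
    have "\<bar>\<integral>y. h y \<partial>M\<bar> \<le> t * B + t powr (1 - p) * i" if "0 < t" for t
    proof -
      have "ennreal (\<integral>y. \<bar>h y\<bar> \<partial>M) = (\<integral>\<^sup>+y. ennreal \<bar>h y\<bar> \<partial>M)"
        using int[OF True] by (intro nn_integral_eq_integral[symmetric]) auto
      also have "\<dots> \<le> ennreal (t * B) + ennreal (t powr (1 - p)) * ennreal i"
        using bound[OF that] by (simp add: I)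
      also have "\<dots> = ennreal (t * B + t powr (1 - p) * i)"
        using that B i0 by (simp add: ennreal_plus ennreal_mult)
      finally have "(\<integral>y. \<bar>h y\<bar> \<partial>M) \<le> t * B + t powr (1 - p) * i"
        using that B i0 by (subst (asm) ennreal_le_iff) auto
      moreover have "\<bar>\<integral>y. h y \<partial>M\<bar> \<le> (\<integral>y. \<bar>h y\<bar> \<partial>M)"
        by (rule integral_abs_bound)
      ultimately show ?thesis by linarith
    qed
    then have "\<bar>\<integral>y. h y \<partial>M\<bar> powr p \<le> 2 powr p * B powr (p - 1) * i"
      using young_optimise[OF p B i0, of "\<bar>\<integral>y. h y \<partial>M\<bar>"] by auto
    then show ?thesis
      using i0 by (simp add: I flip: ennreal_mult)
  qed
qed

lemma powr_add_le:
  fixes a b p :: real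
  assumes "0 \<le> p"
  shows "\<bar>a + b\<bar> powr p \<le> 2 powr p * (\<bar>a\<bar> powr p + \<bar>b\<bar> powr p)"
proof -
  have "\<bar>a + b\<bar> powr p \<le> (2 * max \<bar>a\<bar> \<bar>b\<bar>) powr p"
    using assms by (intro powr_mono2) auto
  also have "\<dots> = 2 powr p * max \<bar>a\<bar> \<bar>b\<bar> powr p"
    by (simp add: powr_mult)
  also have "max \<bar>a\<bar> \<bar>b\<bar> powr p \<le> \<bar>a\<bar> powr p + \<bar>b\<bar> powr p"
    by (auto simp: max_def)
  finally show ?thesis by simp
qed

text \<open>\<open>M\<close> stands for \<open>surface S\<close>, whose measurable sets are traces
  of Borel sets; \<open>id_measurable\<close> makes Borel functions of the position measurable on
  it. The exponent \<open>n\<close> is real because it is compared with real orders of singularity.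
  Centres of balls may lie off the space.\<close>

locale upper_regular_measure = finite_measure M
  for M :: "'a::euclidean_space measure" +
  fixes n C :: real
  assumes id_measurable [measurable]: "(\<lambda>x. x) \<in> M \<rightarrow>\<^sub>M borel"
    and bounded_space: "bounded (space M)"
    and n_pos: "0 < n"
    and regular: "\<And>x t. 0 < t \<Longrightarrow> emeasure M {y \<in> space M. dist x y \<le> t} \<le> ennreal (C * t powr n)"
begin

text \<open>A point lies in balls of arbitrarily small radius \<open>t\<close>, whose mass
  \<open>C * t powr n\<close> tends to \<open>0\<close>. Kernel bounds that exclude the diagonal can
  thus be used under the integral.\<close>

lemma AE_neq: "AE y in M. y \<noteq> x"
proof -
  have m: "{y \<in> space M. y = x} \<in> sets M" by measurable
  have "emeasure M {y \<in> space M. y = x} \<le> 0"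
  proof (rule tendsto_lowerbound)
    show "((\<lambda>t. ennreal (C * t powr n)) \<longlongrightarrow> 0) (at_right 0)"
    proof -
      have "((\<lambda>t::real. C * t powr n) \<longlongrightarrow> C * 0) (at_right 0)"
        using n_pos
        by (intro tendsto_intros tendsto_zero_powrI[where b=n])
           (auto simp: eventually_at_right_less intro!: eventually_mono[OF eventually_at_right_less])
      then show ?thesis by (metis ennreal_0 mult_zero_right tendsto_ennrealI)
    qed
    show "\<forall>\<^sub>F t in at_right 0. emeasure M {y \<in> space M. y = x} \<le> ennreal (C * t powr n)"
      using eventually_at_right_less
    proof eventually_elim
      case (elim t)
      have "emeasure M {y \<in> space M. y = x} \<le> emeasure M {y \<in> space M. dist x y \<le> t}"
        using elim by (intro emeasure_mono) auto
      then show ?case using regular[OF elim, of x] by simp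
    qed
  qed simp
  then show ?thesis using m by (subst AE_iff_measurable[OF m]) auto
qed

text \<open>Dyadic shells around \<open>x\<close>: on the shell of radius about
  \<open>D / 2 ^ k\<close> the integrand is comparable with a fixed power of the radius, and
  regularity bounds the mass of the shell. The contributions form a geometric series with ratio
  \<open>2 powr (- (n - a))\<close>, the same for all \<open>x\<close>.\<close>

lemma riesz_mass_bounded:
  assumes "a < n"
  obtains B where "B > 0"
    "\<And>x. x \<in> space M \<Longrightarrow> (\<integral>\<^sup>+y. ennreal (dist x y powr (- a)) \<partial>M) \<le> ennreal B"
proof -
  obtain D where D: "D > 0" and dist: "\<And>x y. x \<in> space M \<Longrightarrow> y \<in> space M \<Longrightarrow> dist x y \<le> D"
  proof -
    obtain e where e: "\<And>x y. x \<in> space M \<Longrightarrow> y \<in> space M \<Longrightarrow> dist x y \<le> e"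
      using bounded_space unfolding bounded_two_points by blast
    show ?thesis by (rule that[of "max e 1"]) (auto simp: le_max_iff_disj e)
  qed
  define C' where "C' = max C 0"
  define u where "u k = D / 2 ^ k" for k :: nat
  have u: "u k > 0" for k using D by (simp add: u_def)
  define q where "q = 2 powr (- (n - a))"
  have q: "0 < q" "q < 1" using assms by (auto simp: q_def powr_less_one)
  \<comment> \<open>The factor \<open>2 powr \<bar>a\<bar>\<close> compares the integrand across a
    shell whose radii differ by a factor \<open>2\<close>, for either sign of \<open>a\<close>.
    Negative orders occur below, where \<open>b\<close> may be negative.\<close>
  define c where "c k = 2 powr \<bar>a\<bar> * u k powr (- a) * (C' * u k powr n)" for k
  have c_eq: "c k = (2 powr \<bar>a\<bar> * C' * D powr (n - a)) * q ^ k" for k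
  proof -
    have "u k powr (- a) * u k powr n = u k powr (n - a)" by (simp flip: powr_add)
    also have "\<dots> = D powr (n - a) * q ^ k"
    proof -
      have "(2::real) ^ k = 2 powr real k" by (simp add: powr_realpow)
      then have "((2::real) ^ k) powr (n - a) = 2 powr (real k * (n - a))" by (simp add: powr_powr)
      moreover have "q ^ k = 2 powr (- (real k * (n - a)))"
        by (simp add: q_def powr_power powr_powr flip: powr_realpow) (simp add: algebra_simps)
      ultimately show ?thesis using D unfolding u_def by (subst powr_divide) (simp_all add: powr_minus divide_inverse)
    qed
    finally show ?thesis by (simp add: c_def mult_ac)
  qed
  have summable: "summable c" unfolding c_eq[abs_def]
    using q by (intro summable_mult summable_geometric) simp
  have c0: "0 \<le> c k" for k by (simp add: c_def C'_def)
  have "(\<integral>\<^sup>+y. ennreal (dist x y powr (- a)) \<partial>M) \<le> ennreal (\<Sum>k. c k)" if x: "x \<in> space M" for x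
  proof -
    have "(\<integral>\<^sup>+y. ennreal (dist x y powr (- a)) \<partial>M) \<le>
      (\<integral>\<^sup>+y. (\<Sum>k. ennreal (2 powr \<bar>a\<bar> * u k powr (- a)) * indicator {y \<in> space M. dist x y \<le> u k} y) \<partial>M)"
    proof (rule nn_integral_mono)
      fix y assume y: "y \<in> space M"
      let ?g = "\<lambda>k. ennreal (2 powr \<bar>a\<bar> * u k powr (- a)) * indicator {y \<in> space M. dist x y \<le> u k} y"
      show "ennreal (dist x y powr (- a)) \<le> (\<Sum>k. ?g k)"
      \<comment> \<open>On the diagonal \<open>0 powr (- a)\<close> is \<open>0\<close>, so only
        \<open>x \<noteq> y\<close> has to be covered by a shell.\<close>
      proof (cases "x = y")
        case False
        define t where "t = dist x y"
        have t: "0 < t" "t \<le> D" using False dist[OF x y] by (auto simp: t_def)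
        define k where "k = nat \<lfloor>log 2 (D / t)\<rfloor>"
        have "0 \<le> log 2 (D / t)" using t D by (simp add: field_simps)
        then have k: "real k \<le> log 2 (D / t)" "log 2 (D / t) < real k + 1"
          unfolding k_def by (auto simp: le_nat_floor)
        have "2 powr real k \<le> D / t" "D / t < 2 powr (real k + 1)"
          using k t D by (auto simp: le_log_iff log_less_iff)
        then have tu: "t \<le> u k" "u k / 2 < t"
          using t D by (auto simp: u_def field_simps powr_realpow powr_add)
        define \<tau> where "\<tau> = t / u k"
        have \<tau>: "1 / 2 < \<tau>" "\<tau> \<le> 1" "0 < \<tau>" using tu u[of k] t by (auto simp: \<tau>_def field_simps)
        have "\<tau> powr (- a) \<le> 2 powr \<bar>a\<bar>"
        proof (cases "0 \<le> a")
          case True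
          have "\<tau> powr (- a) \<le> (1 / 2) powr (- a)" using True \<tau> by (intro powr_mono2') auto
          then show ?thesis using True by (simp add: powr_divide powr_minus)
        next
          case False
          have "\<tau> powr (- a) \<le> 1 powr (- a)" using False \<tau> by (intro powr_mono2) auto
          also have "\<dots> \<le> 2 powr \<bar>a\<bar>" by (simp add: ge_one_powr_ge_zero)
          finally show ?thesis .
        qed
        then have "t powr (- a) \<le> 2 powr \<bar>a\<bar> * u k powr (- a)"
          using u[of k] \<tau> by (simp add: \<tau>_def powr_divide field_simps)
        then have "ennreal (dist x y powr (- a)) \<le> ?g k"
          using y tu by (simp add: t_def ennreal_leI)
        also have "\<dots> \<le> (\<Sum>k. ?g k)"
        proof -
          have "(\<Sum>i\<in>{k}. ?g i) \<le> (\<Sum>k. ?g k)" by (rule sum_le_suminf) auto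
          then show ?thesis by (simp only: sum.insert sum.empty finite.emptyI empty_iff not_False_eq_True add_0_right)
        qed
        finally show ?thesis .
      qed simp
    qed
    also have "\<dots> = (\<Sum>k. \<integral>\<^sup>+y. ennreal (2 powr \<bar>a\<bar> * u k powr (- a)) * indicator {y \<in> space M. dist x y \<le> u k} y \<partial>M)"
      by (rule nn_integral_suminf) measurable
    also have "\<dots> = (\<Sum>k. ennreal (2 powr \<bar>a\<bar> * u k powr (- a)) * emeasure M {y \<in> space M. dist x y \<le> u k})"
      by (intro suminf_cong nn_integral_cmult_indicator) measurable
    also have "\<dots> \<le> (\<Sum>k. ennreal (c k))"
    proof (intro suminf_le)
      fix k
      have "emeasure M {y \<in> space M. dist x y \<le> u k} \<le> ennreal (C * u k powr n)"
        by (rule regular[OF u])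
      also have "\<dots> \<le> ennreal (C' * u k powr n)"
        by (intro ennreal_leI mult_right_mono) (auto simp: C'_def)
      finally show "ennreal (2 powr \<bar>a\<bar> * u k powr (- a)) * emeasure M {y \<in> space M. dist x y \<le> u k} \<le> ennreal (c k)"
        by (simp add: c_def ennreal_mult C'_def mult_left_mono)
    qed auto
    also have "\<dots> = ennreal (\<Sum>k. c k)"
      by (rule suminf_ennreal2[OF c0 summable])
    finally show ?thesis .
  qed
  then have "(\<integral>\<^sup>+y. ennreal (dist x y powr (- a)) \<partial>M) \<le> ennreal (\<bar>\<Sum>k. c k\<bar> + 1)" if "x \<in> space M" for x
    using that by (meson abs_ge_self add_increasing2 ennreal_leI order_trans zero_le_one)
  then show ?thesis using that[of "\<bar>\<Sum>k. c k\<bar> + 1"] by simp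
qed

text \<open>A Schur test. The potential \<open>\<Psi>\<close> of \<open>\<bar>f\<bar> powr p\<close>
  with singularity \<open>a\<close> controls everything pointwise: it bounds the \<open>p\<close>-th
  power of the image at \<open>x\<close>, and \<open>\<Psi> x + \<Psi> x'\<close> times
  \<open>dist x x' powr (\<theta> * p)\<close> bounds that of the difference, up to constants.
  Integrating these with the uniform mass bounds leaves the \<open>p\<close>-th power integral of
  \<open>f\<close>.\<close>

lemma kernel_operator_bounds:
  fixes K :: "'a \<Rightarrow> 'a \<Rightarrow> real"
  assumes s: "0 \<le> s" "s < \<theta>" and a: "a < n" and p: "1 < p"
    and [measurable]: "case_prod K \<in> borel_measurable (M \<Otimes>\<^sub>M M)"
    and size: "\<And>x y. x \<in> space M \<Longrightarrow> y \<in> space M \<Longrightarrow> x \<noteq> y \<Longrightarrow> \<bar>K x y\<bar> \<le> A * dist x y powr (- a)"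
    and hoelder: "\<And>x x' y. x \<in> space M \<Longrightarrow> x' \<in> space M \<Longrightarrow> y \<in> space M \<Longrightarrow> x \<noteq> y \<Longrightarrow> x' \<noteq> y \<Longrightarrow>
      \<bar>K x y - K x' y\<bar> \<le> A * dist x x' powr \<theta> * (dist x y powr (- a) + dist x' y powr (- a))"
  obtains B where "0 \<le> B"
    "\<And>f. f \<in> borel_measurable M \<Longrightarrow>
      (\<integral>\<^sup>+x. ennreal (\<bar>\<integral>y. K x y * f y \<partial>M\<bar> powr p) \<partial>M) +
      (\<integral>\<^sup>+x. (\<integral>\<^sup>+x'. ennreal (\<bar>(\<integral>y. K x y * f y \<partial>M) - (\<integral>y. K x' y * f y \<partial>M)\<bar> powr p /
          norm (x - x') powr (n + s * p)) \<partial>M) \<partial>M)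
      \<le> ennreal B * (\<integral>\<^sup>+y. ennreal (\<bar>f y\<bar> powr p) \<partial>M)"
    "\<And>f. f \<in> borel_measurable M \<Longrightarrow> (\<integral>\<^sup>+y. ennreal (\<bar>f y\<bar> powr p) \<partial>M) < \<infinity> \<Longrightarrow>
      AE x in M. integrable M (\<lambda>y. K x y * f y)"
proof -
  interpret pair_sigma_finite M M ..
  obtain B1 where B1: "B1 > 0"
    and mass1: "\<And>x. x \<in> space M \<Longrightarrow> (\<integral>\<^sup>+y. ennreal (dist x y powr (- a)) \<partial>M) \<le> ennreal B1"
    by (rule riesz_mass_bounded[OF a]) blast
  \<comment> \<open>Dividing \<open>dist x x' powr (\<theta> * p)\<close> by the Slobodeckij weight
    \<open>dist x x' powr (n + s * p)\<close> leaves \<open>dist x x' powr (- b)\<close>;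
    \<open>b < n\<close> amounts to \<open>s < \<theta>\<close>.\<close>
  define b where "b = n - (\<theta> - s) * p"
  have b: "b < n" using s p by (simp add: b_def)
  obtain B2 where B2: "B2 > 0"
    and mass2: "\<And>x. x \<in> space M \<Longrightarrow> (\<integral>\<^sup>+y. ennreal (dist x y powr (- b)) \<partial>M) \<le> ennreal B2"
    by (rule riesz_mass_bounded[OF b]) blast
  \<comment> \<open>Made positive because the kernel difference is divided by a multiple of it,
    while \<open>A\<close> has no sign.\<close>
  define A' where "A' = \<bar>A\<bar> + 1"
  have A': "A' > 0" "A \<le> A'" by (auto simp: A'_def)
  define c1 where "c1 = 2 powr p * (A' * B1) powr (p - 1) * A'"
  define c2 where "c2 = A' powr p * (2 powr p * (2 * B1) powr (p - 1))"
  have c0: "0 \<le> c1" "0 \<le> c2" using A' B1 by (auto simp: c1_def c2_def)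
  define B where "B = c1 * B1 + 2 * c2 * B2 * B1"
  have B0: "0 \<le> B" using c0 B1 B2 by (simp add: B_def)
  note [measurable] = borel_measurable_lebesgue_integral borel_measurable_nn_integral

  have pot: "(\<integral>\<^sup>+x. ennreal (\<bar>\<integral>y. K x y * f y \<partial>M\<bar> powr p) \<partial>M) +
      (\<integral>\<^sup>+x. (\<integral>\<^sup>+x'. ennreal (\<bar>(\<integral>y. K x y * f y \<partial>M) - (\<integral>y. K x' y * f y \<partial>M)\<bar> powr p /
          norm (x - x') powr (n + s * p)) \<partial>M) \<partial>M)
      \<le> ennreal B * (\<integral>\<^sup>+y. ennreal (\<bar>f y\<bar> powr p) \<partial>M) \<and>
      ((\<integral>\<^sup>+y. ennreal (\<bar>f y\<bar> powr p) \<partial>M) < \<infinity> \<longrightarrow> (AE x in M. integrable M (\<lambda>y. K x y * f y)))"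
    if f[measurable]: "f \<in> borel_measurable M" for f
  proof -
    let ?T = "\<lambda>x. \<integral>y. K x y * f y \<partial>M"
    let ?I = "\<integral>\<^sup>+y. ennreal (\<bar>f y\<bar> powr p) \<partial>M"
    define \<Psi> where "\<Psi> x = (\<integral>\<^sup>+y. ennreal (dist x y powr (- a) * \<bar>f y\<bar> powr p) \<partial>M)" for x
    have \<Psi>m[measurable]: "\<Psi> \<in> borel_measurable M" unfolding \<Psi>_def by measurable
    have Tm[measurable]: "?T \<in> borel_measurable M" by measurable
    have \<Psi>int: "(\<integral>\<^sup>+x. \<Psi> x \<partial>M) \<le> ennreal B1 * ?I"
    proof -
      have "(\<integral>\<^sup>+x. \<Psi> x \<partial>M) = (\<integral>\<^sup>+y. (\<integral>\<^sup>+x. ennreal (dist x y powr (- a) * \<bar>f y\<bar> powr p) \<partial>M) \<partial>M)"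
        unfolding \<Psi>_def by (rule Fubini'[symmetric]) measurable
      also have "\<dots> = (\<integral>\<^sup>+y. (\<integral>\<^sup>+x. ennreal (dist y x powr (- a)) \<partial>M) * ennreal (\<bar>f y\<bar> powr p) \<partial>M)"
        by (intro nn_integral_cong) (simp add: ennreal_mult nn_integral_multc dist_commute)
      also have "\<dots> \<le> (\<integral>\<^sup>+y. ennreal B1 * ennreal (\<bar>f y\<bar> powr p) \<partial>M)"
        by (intro nn_integral_mono mult_right_mono mass1) auto
      also have "\<dots> = ennreal B1 * ?I" by (simp add: nn_integral_cmult)
      finally show ?thesis .
    qed
    have AEx: "AE y in M. y \<noteq> x" for x by (rule AE_neq)
    have Tx: "ennreal (\<bar>?T x\<bar> powr p) \<le> ennreal c1 * \<Psi> x"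
      and Tint: "\<Psi> x < \<infinity> \<Longrightarrow> integrable M (\<lambda>y. K x y * f y)" if x: "x \<in> space M" for x
    proof -
      have Km[measurable]: "K x \<in> borel_measurable M" using x by measurable
      have [measurable]: "(\<lambda>y. dist x y) \<in> borel_measurable M" by measurable
      have w0: "0 \<le> A' * dist x y powr (- a)" for y using A' by simp
      have mass: "(\<integral>\<^sup>+y. ennreal (A' * dist x y powr (- a)) \<partial>M) \<le> ennreal (A' * B1)"
        using mass1[OF x] A' B1 by (simp add: ennreal_mult nn_integral_cmult mult_left_mono)
      have dom: "AE y in M. \<bar>K x y * f y\<bar> \<le> A' * dist x y powr (- a) * \<bar>f y\<bar>"
        using AEx[of x] AE_space
      proof eventually_elim
        case (elim y)
        then have "\<bar>K x y\<bar> \<le> A * dist x y powr (- a)" using size[of x y] x by auto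
        also have "\<dots> \<le> A' * dist x y powr (- a)" using A' by (intro mult_right_mono) auto
        finally show ?case by (simp add: abs_mult mult_right_mono)
      qed
      have eq: "(\<integral>\<^sup>+y. ennreal (A' * dist x y powr (- a) * \<bar>f y\<bar> powr p) \<partial>M) = ennreal A' * \<Psi> x"
        unfolding \<Psi>_def using A' by (subst nn_integral_cmult[symmetric]) (auto simp: ennreal_mult mult.assoc)
      have AB: "0 < A' * B1" using A' B1 by simp
      show "ennreal (\<bar>?T x\<bar> powr p) \<le> ennreal c1 * \<Psi> x"
      proof -
        have "ennreal (\<bar>?T x\<bar> powr p) \<le> ennreal (2 powr p * (A' * B1) powr (p - 1)) * (ennreal A' * \<Psi> x)"
          unfolding eq[symmetric] by (rule weighted_integral_powr_bound(2)[OF p AB _ _ _ w0 mass dom]) measurable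
        then show ?thesis using A' by (simp add: c1_def ennreal_mult mult_ac)
      qed
      show "integrable M (\<lambda>y. K x y * f y)" if "\<Psi> x < \<infinity>"
      proof (rule weighted_integral_powr_bound(1)[OF p AB _ _ _ w0 mass dom])
        show "(\<integral>\<^sup>+y. ennreal (A' * dist x y powr (- a) * \<bar>f y\<bar> powr p) \<partial>M) < \<infinity>"
          unfolding eq using that by (simp add: ennreal_mult_less_top)
      qed measurable
    qed
    have Td: "ennreal (\<bar>?T x - ?T x'\<bar> powr p / norm (x - x') powr (n + s * p))
        \<le> ennreal (c2 * dist x x' powr (- b)) * (\<Psi> x + \<Psi> x')"
      if x: "x \<in> space M" and x': "x' \<in> space M" for x x'
    \<comment> \<open>Where \<open>\<Psi>\<close> is infinite the integrals in \<open>?T\<close> may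
      have defaulted to \<open>0\<close> and their difference carries no information, but there the
      right side is infinite. Otherwise both integrals converge and may be subtracted.\<close>
    proof (cases "x = x' \<or> \<Psi> x + \<Psi> x' = \<infinity>")
      case True
      show ?thesis
      proof (cases "x = x'")
        case False
        have "c2 * dist x x' powr (- b) > 0"
          using False A' B1 by (simp add: c2_def)
        moreover have "\<Psi> x + \<Psi> x' = top" using True False by simp
        ultimately have "ennreal (c2 * dist x x' powr (- b)) * (\<Psi> x + \<Psi> x') = top"
          using False by (auto simp: ennreal_mult_eq_top_iff)
        then show ?thesis by simp
      qed simp
    next
      case False
      then have ne: "x \<noteq> x'" and fin: "\<Psi> x < \<infinity>" "\<Psi> x' < \<infinity>"
        by (auto simp: less_top)
      have Km[measurable]: "K x \<in> borel_measurable M" "K x' \<in> borel_measurable M"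
        using x x' by measurable
      let ?w = "\<lambda>y. dist x y powr (- a) + dist x' y powr (- a)"
      define L where "L = A' * dist x x' powr \<theta>"
      have L: "L > 0" using A' ne by (simp add: L_def)
      let ?h = "\<lambda>y. (K x y * f y - K x' y * f y) / L"
      have w0: "0 \<le> ?w y" for y by simp
      have mass: "(\<integral>\<^sup>+y. ennreal (?w y) \<partial>M) \<le> ennreal (2 * B1)"
      proof -
        have "(\<integral>\<^sup>+y. ennreal (?w y) \<partial>M) =
          (\<integral>\<^sup>+y. ennreal (dist x y powr (- a)) \<partial>M) + (\<integral>\<^sup>+y. ennreal (dist x' y powr (- a)) \<partial>M)"
          by (simp add: ennreal_plus nn_integral_add)
        also have "\<dots> \<le> ennreal B1 + ennreal B1" by (intro add_mono mass1 x x')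
        finally show ?thesis using B1 by (simp flip: ennreal_plus)
      qed
      have dom: "AE y in M. \<bar>?h y\<bar> \<le> ?w y * \<bar>f y\<bar>"
        using AEx[of x] AEx[of x'] AE_space
      proof eventually_elim
        case (elim y)
        have "\<bar>K x y - K x' y\<bar> \<le> A * dist x x' powr \<theta> * ?w y"
          using hoelder[of x x' y] elim x x' by auto
        also have "\<dots> \<le> L * ?w y" unfolding L_def using A' by (intro mult_right_mono) auto
        finally have "\<bar>K x y - K x' y\<bar> * \<bar>f y\<bar> \<le> L * ?w y * \<bar>f y\<bar>" by (intro mult_right_mono) auto
        moreover have "\<bar>?h y\<bar> = \<bar>K x y - K x' y\<bar> * \<bar>f y\<bar> / L"
          using L by (simp add: abs_mult left_diff_distrib flip: abs_mult)
        ultimately show ?case using L by (simp add: field_simps)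
      qed
      have eq: "(\<integral>\<^sup>+y. ennreal (?w y * \<bar>f y\<bar> powr p) \<partial>M) = \<Psi> x + \<Psi> x'"
        unfolding \<Psi>_def by (subst nn_integral_add[symmetric]) (auto simp: distrib_right ennreal_plus)
      have hint: "(\<integral>y. ?h y \<partial>M) = (?T x - ?T x') / L"
        using Tint[OF x fin(1)] Tint[OF x' fin(2)] by simp
      have B11: "0 < 2 * B1" using B1 by simp
      have J: "ennreal (\<bar>(?T x - ?T x') / L\<bar> powr p) \<le>
          ennreal (2 powr p * (2 * B1) powr (p - 1)) * (\<Psi> x + \<Psi> x')"
        unfolding eq[symmetric] hint[symmetric]
        by (rule weighted_integral_powr_bound(2)[OF p B11 _ _ _ w0 mass dom]) measurable
      have scale: "\<bar>?T x - ?T x'\<bar> powr p / norm (x - x') powr (n + s * p) =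
          A' powr p * dist x x' powr (- b) * \<bar>(?T x - ?T x') / L\<bar> powr p"
      proof -
        have "dist x x' powr (- b) = dist x x' powr (\<theta> * p) / dist x x' powr (n + s * p)"
          by (simp add: b_def algebra_simps flip: powr_diff)
        moreover have "\<bar>(?T x - ?T x') / L\<bar> powr p =
            \<bar>?T x - ?T x'\<bar> powr p / (A' powr p * dist x x' powr (\<theta> * p))"
          using L A' by (simp add: abs_divide powr_divide powr_mult powr_powr L_def)
        ultimately show ?thesis using A' ne by (simp add: dist_norm)
      qed
      have coeff: "ennreal (A' powr p * dist x x' powr (- b)) *
          (ennreal (2 powr p * (2 * B1) powr (p - 1)) * (\<Psi> x + \<Psi> x'))
          = ennreal (c2 * dist x x' powr (- b)) * (\<Psi> x + \<Psi> x')"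
        by (simp add: c2_def ennreal_mult mult_ac)
      have "ennreal (A' powr p * dist x x' powr (- b) * \<bar>(?T x - ?T x') / L\<bar> powr p)
          = ennreal (A' powr p * dist x x' powr (- b)) * ennreal (\<bar>(?T x - ?T x') / L\<bar> powr p)"
        by (rule ennreal_mult) auto
      then show ?thesis
        unfolding scale coeff[symmetric] by (simp only:) (rule mult_left_mono[OF J zero_le])
    qed
    have sum1: "(\<integral>\<^sup>+x. ennreal (\<bar>?T x\<bar> powr p) \<partial>M) \<le> ennreal (c1 * B1) * ?I"
    proof -
      have "(\<integral>\<^sup>+x. ennreal (\<bar>?T x\<bar> powr p) \<partial>M) \<le> (\<integral>\<^sup>+x. ennreal c1 * \<Psi> x \<partial>M)"
        by (intro nn_integral_mono Tx)
      also have "\<dots> = ennreal c1 * (\<integral>\<^sup>+x. \<Psi> x \<partial>M)" by (simp add: nn_integral_cmult)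
      also have "\<dots> \<le> ennreal c1 * (ennreal B1 * ?I)" by (intro mult_left_mono \<Psi>int) simp
      finally show ?thesis using c0 B1 by (simp add: ennreal_mult mult.assoc)
    qed
    have half: "(\<integral>\<^sup>+x. (\<integral>\<^sup>+x'. ennreal (c2 * dist x x' powr (- b)) * \<Psi> x \<partial>M) \<partial>M) \<le> ennreal (c2 * B2 * B1) * ?I"
    proof -
      have "(\<integral>\<^sup>+x. (\<integral>\<^sup>+x'. ennreal (c2 * dist x x' powr (- b)) * \<Psi> x \<partial>M) \<partial>M)
        = (\<integral>\<^sup>+x. ennreal c2 * (\<integral>\<^sup>+x'. ennreal (dist x x' powr (- b)) \<partial>M) * \<Psi> x \<partial>M)"
        using c0 by (intro nn_integral_cong) (simp add: ennreal_mult nn_integral_multc nn_integral_cmult)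
      also have "\<dots> \<le> (\<integral>\<^sup>+x. ennreal c2 * ennreal B2 * \<Psi> x \<partial>M)"
        by (intro nn_integral_mono mult_right_mono mult_left_mono mass2) auto
      also have "\<dots> = ennreal c2 * ennreal B2 * (\<integral>\<^sup>+x. \<Psi> x \<partial>M)" by (simp add: nn_integral_cmult)
      also have "\<dots> \<le> ennreal c2 * ennreal B2 * (ennreal B1 * ?I)" by (intro mult_left_mono \<Psi>int) simp
      finally show ?thesis using c0 B1 B2 by (simp add: ennreal_mult mult.assoc)
    qed
    have half': "(\<integral>\<^sup>+x. (\<integral>\<^sup>+x'. ennreal (c2 * dist x x' powr (- b)) * \<Psi> x' \<partial>M) \<partial>M)
       = (\<integral>\<^sup>+x. (\<integral>\<^sup>+x'. ennreal (c2 * dist x x' powr (- b)) * \<Psi> x \<partial>M) \<partial>M)"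
      using Fubini'[of "\<lambda>x x'. ennreal (c2 * dist x x' powr (- b)) * \<Psi> x"] by (simp add: dist_commute)
    have "(\<integral>\<^sup>+x. (\<integral>\<^sup>+x'. ennreal (\<bar>?T x - ?T x'\<bar> powr p / norm (x - x') powr (n + s * p)) \<partial>M) \<partial>M)
        \<le> (\<integral>\<^sup>+x. (\<integral>\<^sup>+x'. ennreal (c2 * dist x x' powr (- b)) * (\<Psi> x + \<Psi> x') \<partial>M) \<partial>M)"
      by (intro nn_integral_mono Td)
    also have "\<dots> = (\<integral>\<^sup>+x. (\<integral>\<^sup>+x'. ennreal (c2 * dist x x' powr (- b)) * \<Psi> x \<partial>M) +
        (\<integral>\<^sup>+x'. ennreal (c2 * dist x x' powr (- b)) * \<Psi> x' \<partial>M) \<partial>M)"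
      by (intro nn_integral_cong) (simp add: distrib_left nn_integral_add)
    also have "\<dots> = (\<integral>\<^sup>+x. (\<integral>\<^sup>+x'. ennreal (c2 * dist x x' powr (- b)) * \<Psi> x \<partial>M) \<partial>M) +
        (\<integral>\<^sup>+x. (\<integral>\<^sup>+x'. ennreal (c2 * dist x x' powr (- b)) * \<Psi> x' \<partial>M) \<partial>M)"
      by (rule nn_integral_add) measurable
    also have "\<dots> \<le> ennreal (c2 * B2 * B1) * ?I + ennreal (c2 * B2 * B1) * ?I"
      unfolding half' by (intro add_mono half)
    finally have sum2: "(\<integral>\<^sup>+x. (\<integral>\<^sup>+x'. ennreal (\<bar>?T x - ?T x'\<bar> powr p / norm (x - x') powr (n + s * p)) \<partial>M) \<partial>M)
      \<le> ennreal (c2 * B2 * B1) * ?I + ennreal (c2 * B2 * B1) * ?I" .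
    have "ennreal B * ?I = ennreal (c1 * B1) * ?I + (ennreal (c2 * B2 * B1) * ?I + ennreal (c2 * B2 * B1) * ?I)"
    proof -
      have "ennreal B = ennreal (c1 * B1) + (ennreal (c2 * B2 * B1) + ennreal (c2 * B2 * B1))"
        using c0 B1 B2 by (simp add: B_def flip: ennreal_plus)
      then show ?thesis by (simp add: distrib_right)
    qed
    moreover have "AE x in M. integrable M (\<lambda>y. K x y * f y)" if "?I < \<infinity>"
    proof -
      have "(\<integral>\<^sup>+x. \<Psi> x \<partial>M) \<noteq> \<infinity>"
        using \<Psi>int that by (metis ennreal_mult_less_top ennreal_less_top infinity_ennreal_def leD)
      then have "AE x in M. \<Psi> x \<noteq> \<infinity>" by (intro nn_integral_PInf_AE) auto
      then show ?thesis using AE_space by eventually_elim (auto intro!: Tint simp: less_top)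
    qed
    ultimately show ?thesis using add_mono[OF sum1 sum2] by auto
  qed
  show ?thesis by (rule that[of B]) (use B0 pot in auto)
qed

end

section \<open>Hausdorff measure of smooth boundaries\<close>

lemma space_hausdorff_measure [simp]: "space (hausdorff_measure n) = UNIV"
  and sets_hausdorff_measure [simp, measurable_cong]: "sets (hausdorff_measure n) = sets borel"
  unfolding hausdorff_measure_def
  by (simp_all add: space_measure_of_conv sets_measure_of sets.sigma_sets_eq[of borel, simplified])

lemma emeasure_hausdorff_measure_conv:
  fixes A :: "'a::metric_space set"
  assumes "A \<in> sets borel"
  shows "emeasure (hausdorff_measure n) A =
    (if measure_space UNIV (sets (borel :: 'a measure)) (hausdorff_outer n) then hausdorff_outer n A else 0)"
  unfolding hausdorff_measure_def using assms
  by (subst emeasure_measure_of_conv) (simp add: sets.sigma_sets_eq[of borel, simplified])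

lemma emeasure_hausdorff_measure_le: "emeasure (hausdorff_measure n) A \<le> hausdorff_outer n A"
proof (cases "A \<in> sets borel")
  case False
  then have "emeasure (hausdorff_measure n) A = 0" by (simp add: emeasure_notin_sets)
  then show ?thesis by simp
qed (simp add: emeasure_hausdorff_measure_conv)

text \<open>\<open>hausdorff_pre\<close> takes covers indexed by all naturals, so a finite family is
  continued by empty sets. These cost nothing because \<open>0 < n\<close> makes
  \<open>0 ^ n\<close> vanish.\<close>

lemma hausdorff_pre_le_finite_cover:
  fixes A :: "'a::metric_space set"
  assumes n: "0 < n" and I: "finite I" "A \<subseteq> (\<Union>i\<in>I. U i)"
    and U: "\<And>i. i \<in> I \<Longrightarrow> bounded (U i)" "\<And>i. i \<in> I \<Longrightarrow> diameter (U i) \<le> h" and h: "0 \<le> h" "h \<le> \<delta>"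
  shows "hausdorff_pre n \<delta> A \<le> ennreal (real (card I) * (unit_ball_vol (real n) * (h / 2) ^ n))"
proof -
  obtain f where f: "bij_betw f {..<card I} I"
    using ex_bij_betw_nat_finite[OF I(1)] by (auto simp: atLeast0LessThan)
  define V where "V k = (if k < card I then U (f k) else {})" for k
  have fI: "f k \<in> I" if "k < card I" for k using f that by (auto simp: bij_betw_def)
  have "A \<subseteq> (\<Union>k. V k)"
  proof
    fix x assume "x \<in> A"
    then obtain i where i: "i \<in> I" "x \<in> U i" using I by auto
    then obtain k where "k < card I" "f k = i" using f unfolding bij_betw_def by (metis imageE lessThan_iff)
    then show "x \<in> (\<Union>k. V k)" using i by (auto simp: V_def intro!: exI[of _ k])
  qed
  moreover have Vd: "bounded (V k) \<and> diameter (V k) \<le> h \<and> 0 \<le> diameter (V k)" for k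
    using U fI h by (auto simp: V_def diameter_ge_0)
  ultimately have "hausdorff_pre n \<delta> A \<le> (\<Sum>k. ennreal (unit_ball_vol (real n) * (diameter (V k) / 2) ^ n))"
    unfolding hausdorff_pre_def using h by (intro INF_lower) (auto intro: order_trans)
  also have "\<dots> = (\<Sum>k<card I. ennreal (unit_ball_vol (real n) * (diameter (V k) / 2) ^ n))"
    using n by (intro suminf_finite) (auto simp: V_def)
  also have "\<dots> \<le> (\<Sum>k<card I. ennreal (unit_ball_vol (real n) * (h / 2) ^ n))"
    using Vd by (intro sum_mono ennreal_leI mult_left_mono power_mono) auto
  also have "\<dots> = ennreal (real (card I) * (unit_ball_vol (real n) * (h / 2) ^ n))"
    using h by (simp add: ennreal_of_nat_eq_real_of_nat ennreal_mult)
  finally show ?thesis .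
qed

text \<open>Lets tangential distances be controlled by coordinate intervals. The basis vectors are
  orthogonal to \<open>e\<close>, so \<open>z\<close> and its projection have the same
  coordinates.\<close>

lemma orthonormal_basis_hyperplane:
  fixes e :: "'a::euclidean_space"
  assumes "norm e = 1"
  obtains B where "finite B" "card B = DIM('a) - 1" "\<And>b. b \<in> B \<Longrightarrow> norm b = 1"
    "\<And>z. norm (z - (z \<bullet> e) *\<^sub>R e) \<le> (\<Sum>b\<in>B. \<bar>z \<bullet> b\<bar>)"
proof -
  let ?S = "{x. e \<bullet> x = 0}"
  obtain B where B: "B \<subseteq> ?S" "pairwise orthogonal B" "\<And>x. x \<in> B \<Longrightarrow> norm x = 1"
    "independent B" "card B = dim ?S" "span B = ?S"
    using orthonormal_basis_subspace[OF subspace_hyperplane[of e]] by metis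
  have fin: "finite B" using B(4) by (rule independent_imp_finite)
  have "e \<noteq> 0" using assms by auto
  then have card: "card B = DIM('a) - 1" using B(5) by (simp add: dim_hyperplane)
  have "norm (z - (z \<bullet> e) *\<^sub>R e) \<le> (\<Sum>b\<in>B. \<bar>z \<bullet> b\<bar>)" for z
  proof -
    let ?z = "z - (z \<bullet> e) *\<^sub>R e"
    have "e \<bullet> e = 1" using assms by (simp add: dot_square_norm)
    then have "?z \<in> span B" by (simp add: B(6) inner_diff_right inner_commute)
    then have "?z = (\<Sum>b\<in>B. (?z \<bullet> b) *\<^sub>R b)"
      using orthonormal_basis_expand[OF B(2,3) _ fin] by simp
    then have "norm ?z \<le> (\<Sum>b\<in>B. norm ((?z \<bullet> b) *\<^sub>R b))" by (metis norm_sum)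
    also have "\<dots> = (\<Sum>b\<in>B. \<bar>z \<bullet> b\<bar>)"
      using B(1,3) by (intro sum.cong) (auto simp: inner_diff_left)
    finally show ?thesis .
  qed
  then show ?thesis using that fin card B(3) by blast
qed

text \<open>In the hyperplane orthogonal to \<open>e\<close>, cells of side \<open>h = t / N\<close>
  are used. The part of \<open>A\<close> over one cell has diameter at most
  \<open>(1 + L) * n * h\<close>, and \<open>(2 * N + 1) ^ n\<close> cells suffice. Since
  \<open>2 * N + 1 \<le> 3 * N\<close>, the total cost has a bound independent of \<open>N\<close>,
  so the mesh \<open>\<delta>\<close> may tend to \<open>0\<close>.\<close>

lemma hausdorff_outer_Lipschitz_graph:
  fixes A :: "'a::euclidean_space set"
  assumes d: "2 \<le> DIM('a)" and e: "norm e = 1" and L: "0 \<le> L"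
    and lip: "\<And>y y'. y \<in> A \<Longrightarrow> y' \<in> A \<Longrightarrow>
      \<bar>(y - y') \<bullet> e\<bar> \<le> L * norm ((y - y') - ((y - y') \<bullet> e) *\<^sub>R e)"
    and t: "0 < t" and A: "A \<subseteq> cball y0 t"
  shows "hausdorff_outer (DIM('a) - 1) A \<le>
    ennreal (unit_ball_vol (real (DIM('a) - 1)) * (3 * (1 + L) * real (DIM('a) - 1) / 2) ^ (DIM('a) - 1) * t ^ (DIM('a) - 1))"
proof -
  define n where "n = DIM('a) - 1"
  have n: "0 < n" using d by (simp add: n_def)
  obtain B where B: "finite B" "card B = n" "\<And>b. b \<in> B \<Longrightarrow> norm b = 1"
    and coord: "\<And>z. norm (z - (z \<bullet> e) *\<^sub>R e) \<le> (\<Sum>b\<in>B. \<bar>z \<bullet> b\<bar>)"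
    using orthonormal_basis_hyperplane[OF e] unfolding n_def by metis
  define q where "q = (1 + L) * real n * t"
  have q: "0 < q" using n t L by (simp add: q_def)
  have "hausdorff_pre n \<delta> A \<le> ennreal (unit_ball_vol (real n) * (3 * (1 + L) * real n / 2) ^ n * t ^ n)"
    if \<delta>: "0 < \<delta>" for \<delta>
  proof -
    obtain N :: nat where N: "q / \<delta> < real N" using reals_Archimedean2 by blast
    have N0: "0 < N" using N q \<delta> by (metis divide_pos_pos of_nat_0_less_iff order_less_trans)
    define h where "h = t / real N"
    have h: "0 < h" using t N0 by (simp add: h_def)
    \<comment> \<open>There are \<open>2 * N + 1\<close> indices per axis, not \<open>2 * N\<close>:
      the floor equals \<open>2 * N\<close> when a coordinate sits at the right end of its
      range.\<close>
    define I where "I = PiE B (\<lambda>_. {..2 * N})"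
    define U where "U k = {y \<in> A. \<forall>b\<in>B. real (k b) * h \<le> (y - y0) \<bullet> b + t \<and> (y - y0) \<bullet> b + t \<le> (real (k b) + 1) * h}"
      for k :: "'a \<Rightarrow> nat"
    have fin: "finite I" using B by (auto simp: I_def intro: finite_PiE)
    have card: "card I = (2 * N + 1) ^ n" using B by (simp add: I_def card_PiE)
    have cover: "A \<subseteq> (\<Union>k\<in>I. U k)"
    proof
      fix y assume y: "y \<in> A"
      define k where "k = restrict (\<lambda>b. nat \<lfloor>((y - y0) \<bullet> b + t) / h\<rfloor>) B"
      have *: "0 \<le> ((y - y0) \<bullet> b + t) / h \<and> ((y - y0) \<bullet> b + t) / h \<le> 2 * real N" if "b \<in> B" for b
      proof -
        have "\<bar>(y - y0) \<bullet> b\<bar> \<le> norm (y - y0) * norm b" by (rule Cauchy_Schwarz_ineq2)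
        also have "\<dots> \<le> t" using A y B(3)[OF that] by (auto simp: dist_norm norm_minus_commute)
        finally have "0 \<le> (y - y0) \<bullet> b + t" "(y - y0) \<bullet> b + t \<le> 2 * t" by auto
        then have "0 \<le> ((y - y0) \<bullet> b + t) / h" "((y - y0) \<bullet> b + t) / h \<le> 2 * t / h"
          using h by (auto intro!: divide_nonneg_pos divide_right_mono)
        then show ?thesis using t N0 by (simp add: h_def)
      qed
      have "k b \<le> 2 * N" if "b \<in> B" for b
      proof -
        have "\<lfloor>((y - y0) \<bullet> b + t) / h\<rfloor> \<le> \<lfloor>2 * real N\<rfloor>" using *[OF that] by (intro floor_mono) auto
        also have "\<lfloor>2 * real N\<rfloor> = 2 * int N" using floor_of_nat[of "2 * N"] by simp
        finally show ?thesis using that by (simp add: k_def nat_le_iff)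
      qed
      then have "k \<in> I" by (auto simp: I_def k_def)
      moreover have "y \<in> U k"
      proof -
        have "real (k b) \<le> ((y - y0) \<bullet> b + t) / h \<and> ((y - y0) \<bullet> b + t) / h \<le> real (k b) + 1" if "b \<in> B" for b
          using *[OF that] that by (simp add: k_def)
        then show ?thesis using y h by (auto simp: U_def field_simps)
      qed
      ultimately show "y \<in> (\<Union>k\<in>I. U k)" by blast
    qed
    have diam: "norm (y - y') \<le> q / real N" if "y \<in> U k" "y' \<in> U k" for y y' k
    proof -
      let ?z = "y - y'"
      have "\<bar>?z \<bullet> b\<bar> \<le> h" if "b \<in> B" for b
      proof -
        have "real (k b) * h \<le> (y - y0) \<bullet> b + t" "(y - y0) \<bullet> b + t \<le> (real (k b) + 1) * h"
          "real (k b) * h \<le> (y' - y0) \<bullet> b + t" "(y' - y0) \<bullet> b + t \<le> (real (k b) + 1) * h"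
          using that \<open>y \<in> U k\<close> \<open>y' \<in> U k\<close> by (auto simp: U_def)
        moreover have "?z \<bullet> b = (y - y0) \<bullet> b - (y' - y0) \<bullet> b" by (simp add: inner_diff_left)
        ultimately show ?thesis by (simp add: distrib_right abs_le_iff)
      qed
      then have "(\<Sum>b\<in>B. \<bar>?z \<bullet> b\<bar>) \<le> real n * h" using sum_bounded_above[of B "\<lambda>b. \<bar>?z \<bullet> b\<bar>" h] B by simp
      then have z: "norm (?z - (?z \<bullet> e) *\<^sub>R e) \<le> real n * h" using coord[of ?z] by linarith
      have "norm ?z = norm ((?z - (?z \<bullet> e) *\<^sub>R e) + (?z \<bullet> e) *\<^sub>R e)" by simp
      also have "\<dots> \<le> norm (?z - (?z \<bullet> e) *\<^sub>R e) + norm ((?z \<bullet> e) *\<^sub>R e)" by (rule norm_triangle_ineq)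
      also have "\<dots> \<le> norm (?z - (?z \<bullet> e) *\<^sub>R e) + L * norm (?z - (?z \<bullet> e) *\<^sub>R e)"
        using lip[of y y'] that e by (auto simp: U_def)
      also have "\<dots> = (1 + L) * norm (?z - (?z \<bullet> e) *\<^sub>R e)" by (simp add: algebra_simps)
      also have "\<dots> \<le> (1 + L) * (real n * h)" using z L by (intro mult_left_mono) auto
      finally show ?thesis by (simp add: q_def h_def)
    qed
    have "hausdorff_pre n \<delta> A \<le> ennreal (real (card I) * (unit_ball_vol (real n) * (q / real N / 2) ^ n))"
    proof (rule hausdorff_pre_le_finite_cover[OF n fin cover])
      fix k
      show "bounded (U k)" unfolding U_def using bounded_subset[OF bounded_cball A] by (rule bounded_subset) auto
      show "diameter (U k) \<le> q / real N" using diam q by (intro diameter_le) auto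
    qed (use q N N0 \<delta> in \<open>auto simp: field_simps\<close>)
    also have "\<dots> \<le> ennreal (unit_ball_vol (real n) * (3 * (1 + L) * real n / 2) ^ n * t ^ n)"
    proof (rule ennreal_leI)
      have "real (card I) = (2 * real N + 1) ^ n" by (simp add: card add.commute)
      also have "\<dots> \<le> (3 * real N) ^ n" using N0 by (intro power_mono) auto
      finally have "real (card I) * (unit_ball_vol (real n) * (q / real N / 2) ^ n)
         \<le> (3 * real N) ^ n * (unit_ball_vol (real n) * (q / real N / 2) ^ n)"
        using q by (intro mult_right_mono) auto
      also have "\<dots> = unit_ball_vol (real n) * (3 * real N * (q / real N / 2)) ^ n"
        by (simp only: power_mult_distrib mult.left_commute)
      also have "3 * real N * (q / real N / 2) = 3 * (1 + L) * real n / 2 * t"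
        using N0 by (simp add: q_def)
      finally show "real (card I) * (unit_ball_vol (real n) * (q / real N / 2) ^ n)
        \<le> unit_ball_vol (real n) * (3 * (1 + L) * real n / 2) ^ n * t ^ n"
        by (simp only: power_mult_distrib mult.assoc)
    qed
    finally show ?thesis .
  qed
  then show ?thesis unfolding hausdorff_outer_def n_def[symmetric] by (intro SUP_least) auto
qed

text \<open>\<open>Ck\<close> provides continuity of the derivative in each fixed direction. The
  operator norm is therefore bounded through the sum of absolute partial derivatives, which is
  continuous and so bounded on the compact ball; convexity of the ball then gives the mean value
  inequality.\<close>

lemma smooth_imp_Lipschitz_on_cball:
  fixes g :: "'a::euclidean_space \<Rightarrow> real"
  assumes "smooth g"
  obtains L where "0 \<le> L" "\<And>y z. y \<in> cball x R \<Longrightarrow> z \<in> cball x R \<Longrightarrow> \<bar>g y - g z\<bar> \<le> L * norm (y - z)"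
proof -
  have "Ck (Suc 0) g" using assms by (auto simp: smooth_def)
  then obtain g' where g': "\<And>x. (g has_derivative g' x) (at x)" and cont: "\<And>v. continuous_on UNIV (\<lambda>x. g' x v)"
    by auto
  have "continuous_on (cball x R) (\<lambda>x. \<Sum>b\<in>Basis. \<bar>g' x b\<bar>)"
    by (intro continuous_intros continuous_on_subset[OF cont]) auto
  then have "bounded ((\<lambda>x. \<Sum>b\<in>Basis. \<bar>g' x b\<bar>) ` cball x R)"
    by (intro compact_imp_bounded compact_continuous_image) auto
  then obtain L where L: "\<And>y. y \<in> cball x R \<Longrightarrow> (\<Sum>b\<in>Basis. \<bar>g' y b\<bar>) \<le> L"
    unfolding bounded_real by (metis abs_le_D1 image_eqI)
  have "onorm (g' y) \<le> max L 0" if y: "y \<in> cball x R" for y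
  proof (rule onorm_le)
    fix v
    have bl: "bounded_linear (g' y)" using g' by (rule has_derivative_bounded_linear)
    then have lin: "linear (g' y)" by (rule bounded_linear.linear)
    have "g' y v = g' y (\<Sum>b\<in>Basis. (v \<bullet> b) *\<^sub>R b)" by (simp add: euclidean_representation)
    also have "\<dots> = (\<Sum>b\<in>Basis. (v \<bullet> b) * g' y b)"
      using lin by (simp add: linear_sum linear_cmul)
    finally have "norm (g' y v) \<le> (\<Sum>b\<in>Basis. \<bar>(v \<bullet> b) * g' y b\<bar>)"
      by (simp add: sum_abs)
    also have "\<dots> \<le> (\<Sum>b\<in>Basis. norm v * \<bar>g' y b\<bar>)"
      by (intro sum_mono) (auto simp: abs_mult Basis_le_norm intro!: mult_right_mono)
    also have "\<dots> = (\<Sum>b\<in>Basis. \<bar>g' y b\<bar>) * norm v" by (simp add: sum_distrib_left mult.commute)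
    also have "\<dots> \<le> max L 0 * norm v" using L[OF y] by (intro mult_right_mono) auto
    finally show "norm (g' y v) \<le> max L 0 * norm v" .
  qed
  then have "norm (g y - g z) \<le> max L 0 * norm (y - z)" if "y \<in> cball x R" "z \<in> cball x R" for y z
    using that by (intro differentiable_bound[OF convex_cball, of x R g g']) (auto intro: g' has_derivative_at_withinI)
  then show ?thesis using that[of "max L 0"] by auto
qed

text \<open>Inside the ball the boundary lies on the graph of \<open>g\<close>, and \<open>g\<close>
  is Lipschitz on the shadow of that ball because the projection \<open>\<pi>\<close> does not
  increase distances.\<close>

lemma frontier_local_regularity:
  fixes \<Omega> :: "'a::euclidean_space set"
  assumes d: "2 \<le> DIM('a)" and "open \<Omega>" and "smooth_boundary \<Omega>" and x: "x \<in> frontier \<Omega>"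
  obtains \<rho> C where "0 < \<rho>" "0 \<le> C"
    "\<And>y t. 0 < t \<Longrightarrow> hausdorff_outer (DIM('a) - 1) (frontier \<Omega> \<inter> ball x \<rho> \<inter> cball y t) \<le> ennreal (C * t ^ (DIM('a) - 1))"
proof -
  obtain \<rho> e g where \<rho>: "0 < \<rho>" and e: "norm e = 1" and g: "smooth g"
    and eq: "\<Omega> \<inter> ball x \<rho> = {y \<in> ball x \<rho>. g (y - (y \<bullet> e) *\<^sub>R e) < y \<bullet> e}"
    using assms(3) x unfolding smooth_boundary_def by blast
  define \<pi> where "\<pi> y = y - (y \<bullet> e) *\<^sub>R e" for y
  have eqD: "y \<in> \<Omega> \<longleftrightarrow> g (\<pi> y) < y \<bullet> e" if "y \<in> ball x \<rho>" for y
    unfolding \<pi>_def using eq that by blast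
  have ee: "e \<bullet> e = 1" using e by (simp add: dot_square_norm)
  have \<pi>_diff: "\<pi> y - \<pi> z = \<pi> (y - z)" for y z by (simp add: \<pi>_def algebra_simps inner_diff_left)
  have \<pi>_norm: "norm (\<pi> z) \<le> norm z" for z
  proof -
    have "(norm (\<pi> z))\<^sup>2 = (norm z)\<^sup>2 - (z \<bullet> e)\<^sup>2"
      unfolding \<pi>_def power2_norm_eq_inner
      by (simp add: inner_diff_left inner_diff_right ee inner_commute power2_eq_square)
    then have "(norm (\<pi> z))\<^sup>2 \<le> (norm z)\<^sup>2" by simp
    then show ?thesis by (rule power2_le_imp_le) simp
  qed
  obtain L where L: "0 \<le> L" "\<And>y z. y \<in> cball (\<pi> x) \<rho> \<Longrightarrow> z \<in> cball (\<pi> x) \<rho> \<Longrightarrow> \<bar>g y - g z\<bar> \<le> L * norm (y - z)"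
    by (rule smooth_imp_Lipschitz_on_cball[OF g]) blast
  have "Ck 0 g" using g by (auto simp: smooth_def)
  then have gc: "continuous_on UNIV g" by simp
  then have gp: "continuous_on UNIV (\<lambda>y. g (\<pi> y))"
    unfolding \<pi>_def by (rule continuous_on_compose2) (auto intro!: continuous_intros)
  \<comment> \<open>Openness puts \<open>y\<close> outside \<open>\<Omega>\<close>, hence not
    strictly above the graph; as a limit of points strictly above it, \<open>y\<close> is not
    strictly below either.\<close>
  have graph: "g (\<pi> y) = y \<bullet> e" if "y \<in> frontier \<Omega> \<inter> ball x \<rho>" for y
  proof (rule antisym)
    have yb: "y \<in> ball x \<rho>" and yc: "y \<in> closure \<Omega>" and yn: "y \<notin> \<Omega>"
      using that \<open>open \<Omega>\<close> by (auto simp: frontier_def interior_open)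
    show "y \<bullet> e \<le> g (\<pi> y)" using yn eqD[OF yb] by simp
    have "y \<in> closure (\<Omega> \<inter> ball x \<rho>)"
      using open_Int_closure_subset[OF open_ball, of x \<rho> \<Omega>] yb yc unfolding Int_commute[of \<Omega>] by blast
    moreover have "closed {y. g (\<pi> y) \<le> y \<bullet> e}"
      by (intro closed_Collect_le gp continuous_intros)
    moreover have "\<Omega> \<inter> ball x \<rho> \<subseteq> {y. g (\<pi> y) \<le> y \<bullet> e}" using eqD by fastforce
    ultimately show "g (\<pi> y) \<le> y \<bullet> e" using closure_minimal by blast
  qed
  have \<pi>_ball: "\<pi> y \<in> cball (\<pi> x) \<rho>" if "y \<in> ball x \<rho>" for y
    using that \<pi>_norm[of "x - y"] by (simp add: dist_norm \<pi>_diff)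
  have lip: "\<bar>(y - y') \<bullet> e\<bar> \<le> L * norm ((y - y') - ((y - y') \<bullet> e) *\<^sub>R e)"
    if "y \<in> frontier \<Omega> \<inter> ball x \<rho>" "y' \<in> frontier \<Omega> \<inter> ball x \<rho>" for y y'
  proof -
    have "(y - y') \<bullet> e = g (\<pi> y) - g (\<pi> y')" using graph that by (simp add: inner_diff_left)
    moreover have "\<bar>g (\<pi> y) - g (\<pi> y')\<bar> \<le> L * norm (\<pi> y - \<pi> y')" using that by (intro L(2) \<pi>_ball) auto
    moreover have "\<pi> y - \<pi> y' = (y - y') - ((y - y') \<bullet> e) *\<^sub>R e" unfolding \<pi>_diff by (simp add: \<pi>_def)
    ultimately show ?thesis by simp
  qed
  show ?thesis
  proof (rule that[OF \<rho>])
    let ?C = "unit_ball_vol (real (DIM('a) - 1)) * (3 * (1 + L) * real (DIM('a) - 1) / 2) ^ (DIM('a) - 1)"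
    show "0 \<le> ?C" using L by simp
    show "hausdorff_outer (DIM('a) - 1) (frontier \<Omega> \<inter> ball x \<rho> \<inter> cball y t) \<le> ennreal (?C * t ^ (DIM('a) - 1))"
      if "0 < t" for y t
      by (rule hausdorff_outer_Lipschitz_graph[OF d e L(1) _ that]) (auto intro!: lip)
  qed
qed

text \<open>Compactness leaves finitely many local pieces. Their bounds concern the outer measure,
  but they are added for \<open>hausdorff_measure\<close>, where subadditivity follows from the
  measure axioms instead of the covering definition.\<close>

lemma frontier_regularity:
  fixes \<Omega> :: "'a::euclidean_space set"
  assumes d: "2 \<le> DIM('a)" and "open \<Omega>" and "bounded \<Omega>" and "smooth_boundary \<Omega>"
  obtains C where "0 \<le> C"
    "\<And>y t. 0 < t \<Longrightarrow> emeasure (hausdorff_measure (DIM('a) - 1)) (frontier \<Omega> \<inter> cball y t) \<le> ennreal (C * t ^ (DIM('a) - 1))"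
proof -
  let ?n = "DIM('a) - 1"
  have "\<exists>\<rho> C. 0 < \<rho> \<and> 0 \<le> C \<and> (\<forall>y t. 0 < t \<longrightarrow>
      hausdorff_outer ?n (frontier \<Omega> \<inter> ball x \<rho> \<inter> cball y t) \<le> ennreal (C * t ^ ?n))" if "x \<in> frontier \<Omega>" for x
    using frontier_local_regularity[OF d assms(2,4) that] by metis
  then obtain \<rho> C where \<rho>: "\<And>x. x \<in> frontier \<Omega> \<Longrightarrow> 0 < \<rho> x" and C: "\<And>x. x \<in> frontier \<Omega> \<Longrightarrow> 0 \<le> C x"
    and bound: "\<And>x y t. x \<in> frontier \<Omega> \<Longrightarrow> 0 < t \<Longrightarrow>
      hausdorff_outer ?n (frontier \<Omega> \<inter> ball x (\<rho> x) \<inter> cball y t) \<le> ennreal (C x * t ^ ?n)"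
    by metis
  have "compact (frontier \<Omega>)" by (rule compact_frontier_bounded[OF \<open>bounded \<Omega>\<close>])
  moreover have "frontier \<Omega> \<subseteq> (\<Union>x\<in>frontier \<Omega>. ball x (\<rho> x))" using \<rho> by (auto intro!: bexI)
  ultimately obtain D where D: "D \<subseteq> frontier \<Omega>" "finite D" "frontier \<Omega> \<subseteq> (\<Union>x\<in>D. ball x (\<rho> x))"
    using compactE_image[of "frontier \<Omega>" "frontier \<Omega>" "\<lambda>x. ball x (\<rho> x)"] by auto
  show ?thesis
  proof (rule that)
    show "0 \<le> (\<Sum>x\<in>D. C x)" using C D by (intro sum_nonneg) auto
    fix y :: 'a and t :: real assume t: "0 < t"
    let ?H = "hausdorff_measure ?n"
    let ?P = "\<lambda>x. frontier \<Omega> \<inter> ball x (\<rho> x) \<inter> cball y t"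
    have ms: "?P x \<in> sets ?H" for x by simp
    have "emeasure ?H (frontier \<Omega> \<inter> cball y t) \<le> emeasure ?H (\<Union>x\<in>D. ?P x)"
      using D ms by (intro emeasure_mono sets.finite_UN) auto
    also have "\<dots> \<le> (\<Sum>x\<in>D. emeasure ?H (?P x))"
      using D ms by (intro emeasure_subadditive_finite) auto
    also have "\<dots> \<le> (\<Sum>x\<in>D. ennreal (C x * t ^ ?n))"
      using D t by (intro sum_mono order_trans[OF emeasure_hausdorff_measure_le] bound) auto
    also have "\<dots> = ennreal (\<Sum>x\<in>D. C x * t ^ ?n)" using C D t by (intro sum_ennreal) auto
    also have "(\<Sum>x\<in>D. C x * t ^ ?n) = (\<Sum>x\<in>D. C x) * t ^ ?n" by (simp add: sum_distrib_right)
    finally show "emeasure ?H (frontier \<Omega> \<inter> cball y t) \<le> ennreal ((\<Sum>x\<in>D. C x) * t ^ ?n)" .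
  qed
qed

section \<open>Hausdorff measure under dilations\<close>

lemma hausdorff_outer_scale_le:
  fixes A :: "'a::euclidean_space set"
  assumes c: "0 < c"
  shows "hausdorff_outer n ((*\<^sub>R) c ` A) \<le> ennreal (c ^ n) * hausdorff_outer n A"
  unfolding hausdorff_outer_def
proof (rule SUP_least)
  fix \<delta> :: real assume \<delta>: "\<delta> \<in> {0<..}"
  \<comment> \<open>The factor is moved to the left so that the right side is a bare infimum and one
    cover can be fixed. Dilating a cover of mesh \<open>\<delta> / c\<close> gives one of mesh
    \<open>\<delta>\<close>.\<close>
  have "inverse (ennreal (c ^ n)) * hausdorff_pre n \<delta> ((*\<^sub>R) c ` A) \<le> hausdorff_pre n (\<delta> / c) A"
    unfolding hausdorff_pre_def[of n "\<delta> / c"]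
  proof (rule INF_greatest)
    fix U :: "nat \<Rightarrow> 'a set"
    assume "U \<in> {U. A \<subseteq> (\<Union>i. U i) \<and> (\<forall>i. bounded (U i) \<and> diameter (U i) \<le> \<delta> / c)}"
    then have U: "A \<subseteq> (\<Union>i. U i)" "\<forall>i. bounded (U i) \<and> diameter (U i) \<le> \<delta> / c" by auto
    let ?V = "\<lambda>i. (*\<^sub>R) c ` U i"
    have dV: "diameter (?V i) \<le> c * diameter (U i)" for i
    proof (rule diameter_le)
      show "?V i \<noteq> {} \<or> 0 \<le> c * diameter (U i)" using U(2) c by (simp add: diameter_ge_0)
      fix x y assume "x \<in> ?V i" "y \<in> ?V i"
      then obtain x' y' where xy: "x' \<in> U i" "y' \<in> U i" "x = c *\<^sub>R x'" "y = c *\<^sub>R y'" by blast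
      have "norm (x - y) = c * dist x' y'"
        unfolding xy scaleR_diff_right[symmetric] dist_norm using c by simp
      also have "\<dots> \<le> c * diameter (U i)"
        using c U(2) xy by (intro mult_left_mono diameter_bounded_bound) auto
      finally show "norm (x - y) \<le> c * diameter (U i)" .
    qed
    have bV: "bounded (?V i)" for i using U(2) by (intro bounded_scaling) auto
    have "diameter (?V i) \<le> \<delta>" for i
    proof -
      have "diameter (U i) * c \<le> \<delta>" using U(2) c by (simp add: pos_le_divide_eq)
      then show ?thesis using dV[of i] by (simp add: mult.commute)
    qed
    then have "hausdorff_pre n \<delta> ((*\<^sub>R) c ` A) \<le> (\<Sum>i. ennreal (unit_ball_vol (real n) * (diameter (?V i) / 2) ^ n))"
      unfolding hausdorff_pre_def using image_mono[OF U(1), of "(*\<^sub>R) c"] bV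
      by (intro INF_lower) (simp add: image_UN)
    also have "\<dots> \<le> (\<Sum>i. ennreal (c ^ n) * ennreal (unit_ball_vol (real n) * (diameter (U i) / 2) ^ n))"
    proof (intro suminf_le)
      fix i
      have "(diameter (?V i) / 2) ^ n \<le> (c * diameter (U i) / 2) ^ n"
        using dV[of i] bV[of i] by (intro power_mono divide_right_mono) (auto simp: diameter_ge_0)
      then have "unit_ball_vol (real n) * (diameter (?V i) / 2) ^ n \<le> unit_ball_vol (real n) * (c * diameter (U i) / 2) ^ n"
        by (intro mult_left_mono) auto
      also have "\<dots> = c ^ n * (unit_ball_vol (real n) * (diameter (U i) / 2) ^ n)"
        by (simp add: power_mult_distrib power_divide)
      finally have "unit_ball_vol (real n) * (diameter (?V i) / 2) ^ n \<le> c ^ n * (unit_ball_vol (real n) * (diameter (U i) / 2) ^ n)" .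
      then show "ennreal (unit_ball_vol (real n) * (diameter (?V i) / 2) ^ n) \<le>
          ennreal (c ^ n) * ennreal (unit_ball_vol (real n) * (diameter (U i) / 2) ^ n)"
        using c by (simp add: ennreal_leI flip: ennreal_mult')
    qed auto
    also have "\<dots> = ennreal (c ^ n) * (\<Sum>i. ennreal (unit_ball_vol (real n) * (diameter (U i) / 2) ^ n))"
      by simp
    finally have "inverse (ennreal (c ^ n)) * hausdorff_pre n \<delta> ((*\<^sub>R) c ` A) \<le>
      inverse (ennreal (c ^ n)) * (ennreal (c ^ n) * (\<Sum>i. ennreal (unit_ball_vol (real n) * (diameter (U i) / 2) ^ n)))"
      by (intro mult_left_mono) auto
    also have "\<dots> = (\<Sum>i. ennreal (unit_ball_vol (real n) * (diameter (U i) / 2) ^ n))"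
      using c by (simp add: inverse_ennreal mult.assoc[symmetric] ennreal_mult[symmetric])
    finally show "inverse (ennreal (c ^ n)) * hausdorff_pre n \<delta> ((*\<^sub>R) c ` A)
        \<le> (\<Sum>i. ennreal (unit_ball_vol (real n) * (diameter (U i) / 2) ^ n))" .
  qed
  also have "\<dots> \<le> (SUP \<delta>\<in>{0<..}. hausdorff_pre n \<delta> A)" using \<delta> c by (intro SUP_upper) auto
  finally have "ennreal (c ^ n) * (inverse (ennreal (c ^ n)) * hausdorff_pre n \<delta> ((*\<^sub>R) c ` A))
      \<le> ennreal (c ^ n) * (SUP \<delta>\<in>{0<..}. hausdorff_pre n \<delta> A)"
    by (rule mult_left_mono) simp
  then show "hausdorff_pre n \<delta> ((*\<^sub>R) c ` A) \<le> ennreal (c ^ n) * (SUP \<delta>\<in>{0<..}. hausdorff_pre n \<delta> A)"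
    using c by (simp add: inverse_ennreal mult.assoc[symmetric] ennreal_mult[symmetric])
qed

text \<open>The reverse inequality is the same estimate for the dilation by
  \<open>1 / c\<close>.\<close>

lemma hausdorff_outer_scale:
  fixes A :: "'a::euclidean_space set"
  assumes c: "0 < c"
  shows "hausdorff_outer n ((*\<^sub>R) c ` A) = ennreal (c ^ n) * hausdorff_outer n A"
proof (rule antisym[OF hausdorff_outer_scale_le[OF c]])
  have "(*\<^sub>R) (1 / c) ` (*\<^sub>R) c ` A = A" using c by (simp add: image_image)
  then have "hausdorff_outer n A \<le> ennreal ((1 / c) ^ n) * hausdorff_outer n ((*\<^sub>R) c ` A)"
    using hausdorff_outer_scale_le[of "1 / c" n "(*\<^sub>R) c ` A"] c by simp
  then have "ennreal (c ^ n) * hausdorff_outer n A \<le> ennreal (c ^ n) * (ennreal ((1 / c) ^ n) * hausdorff_outer n ((*\<^sub>R) c ` A))"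
    by (rule mult_left_mono) simp
  also have "\<dots> = hausdorff_outer n ((*\<^sub>R) c ` A)"
    using c by (simp add: power_divide mult.assoc[symmetric] ennreal_mult[symmetric])
  finally show "ennreal (c ^ n) * hausdorff_outer n A \<le> hausdorff_outer n ((*\<^sub>R) c ` A)" .
qed

lemma emeasure_hausdorff_measure_scale:
  fixes A :: "'a::euclidean_space set"
  assumes c: "0 < c" and A: "A \<in> sets borel"
  shows "emeasure (hausdorff_measure n) ((*\<^sub>R) c ` A) = ennreal (c ^ n) * emeasure (hausdorff_measure n) A"
proof -
  have "(*\<^sub>R) c ` A = (\<lambda>x. x /\<^sub>R c) -` A \<inter> space borel"
    using c by (auto simp: image_iff intro!: bexI[where x="_ /\<^sub>R c"])
  also have "\<dots> \<in> sets borel" by (rule measurable_sets[OF _ A]) simp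
  finally show ?thesis using A by (simp add: emeasure_hausdorff_measure_conv hausdorff_outer_scale[OF c])
qed

section \<open>Sobolev spaces on scaled surfaces\<close>

text \<open>\<open>f\<close> is arbitrary because \<open>sob_energy\<close> is formed for arbitrary
  functions. \<open>nn_integral\<close> is a supremum over simple functions below \<open>f\<close>,
  and each of these composed with \<open>T\<close> is a measurable function below the composite.
  Only one direction results, since a simple function below the composite need not factor through
  \<open>T\<close>.\<close>

lemma nn_integral_transport_le:
  fixes f :: "'b \<Rightarrow> ennreal"
  assumes T[measurable]: "T \<in> M \<rightarrow>\<^sub>M N"
    and em: "\<And>A. A \<in> sets N \<Longrightarrow> emeasure N A = c * emeasure M (T -` A \<inter> space M)"
  shows "(\<integral>\<^sup>+y. f y \<partial>N) \<le> c * (\<integral>\<^sup>+x. f (T x) \<partial>M)"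
  unfolding nn_integral_def[of N]
proof (rule SUP_least, clarify)
  fix g assume g: "simple_function N g" "g \<le> f"
  have [measurable]: "g \<in> borel_measurable N" using g by (intro borel_measurable_simple_function)
  have N: "N = scale_measure c (distr M N T)"
    by (rule measure_eqI) (auto simp: emeasure_distr em)
  have "integral\<^sup>S N g = (\<integral>\<^sup>+y. g y \<partial>N)" using g by (simp add: nn_integral_eq_simple_integral)
  also have "\<dots> = c * (\<integral>\<^sup>+y. g y \<partial>distr M N T)" by (subst N) (simp add: nn_integral_scale_measure)
  also have "\<dots> = c * (\<integral>\<^sup>+x. g (T x) \<partial>M)" by (simp add: nn_integral_distr)
  also have "\<dots> \<le> c * (\<integral>\<^sup>+x. f (T x) \<partial>M)"
    using g by (intro mult_left_mono nn_integral_mono) (auto simp: le_fun_def)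
  finally show "integral\<^sup>S N g \<le> c * (\<integral>\<^sup>+x. f (T x) \<partial>M)" .
qed

text \<open>Again for arbitrary \<open>f\<close>. One inequality comes from simple functions, the
  other from the first one applied to the factor \<open>1 / c\<close>.\<close>

lemma nn_integral_cmult_finite:
  fixes f :: "'b \<Rightarrow> ennreal"
  assumes "0 < c"
  shows "(\<integral>\<^sup>+x. ennreal c * f x \<partial>M) = ennreal c * (\<integral>\<^sup>+x. f x \<partial>M)"
proof -
  have le: "(\<integral>\<^sup>+x. ennreal c * f x \<partial>M) \<le> ennreal c * (\<integral>\<^sup>+x. f x \<partial>M)" if c: "0 < c" for c and f :: "'b \<Rightarrow> ennreal"
    unfolding nn_integral_def[of M "\<lambda>x. ennreal c * f x"]
  proof (rule SUP_least, clarify)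
    fix g assume g: "simple_function M g" "g \<le> (\<lambda>x. ennreal c * f x)"
    have [measurable]: "g \<in> borel_measurable M" using g by (intro borel_measurable_simple_function)
    have cc: "ennreal c * (ennreal (1 / c) * z) = z" "ennreal (1 / c) * (ennreal c * z) = z" for z
      using c by (simp_all add: mult.assoc[symmetric] ennreal_mult[symmetric])
    have "integral\<^sup>S M g = ennreal c * (\<integral>\<^sup>+x. ennreal (1 / c) * g x \<partial>M)"
      using g by (simp add: nn_integral_eq_simple_integral[symmetric] nn_integral_cmult cc)
    also have "\<dots> \<le> ennreal c * (\<integral>\<^sup>+x. f x \<partial>M)"
    proof (intro mult_left_mono nn_integral_mono)
      fix x
      have "ennreal (1 / c) * g x \<le> ennreal (1 / c) * (ennreal c * f x)"
        using g by (intro mult_left_mono) (auto simp: le_fun_def)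
      then show "ennreal (1 / c) * g x \<le> f x" by (simp add: cc)
    qed simp
    finally show "integral\<^sup>S M g \<le> ennreal c * (\<integral>\<^sup>+x. f x \<partial>M)" .
  qed
  have cc: "ennreal c * (ennreal (1 / c) * z) = z" "ennreal (1 / c) * (ennreal c * z) = z" for z
    using assms by (simp_all add: mult.assoc[symmetric] ennreal_mult[symmetric])
  have "(\<integral>\<^sup>+x. f x \<partial>M) \<le> ennreal (1 / c) * (\<integral>\<^sup>+x. ennreal c * f x \<partial>M)"
    using le[of "1 / c" "\<lambda>x. ennreal c * f x"] assms by (simp add: cc)
  then have "ennreal c * (\<integral>\<^sup>+x. f x \<partial>M) \<le> ennreal c * (ennreal (1 / c) * (\<integral>\<^sup>+x. ennreal c * f x \<partial>M))"
    by (rule mult_left_mono) simp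
  then show ?thesis using le[OF assms] by (simp add: cc antisym)
qed

text \<open>The inverse map \<open>T'\<close> transports the measure back with factor
  \<open>1 / c\<close> and so supplies the direction missing in
  \<open>nn_integral_transport_le\<close>.\<close>

lemma integral_transport:
  fixes T :: "'b \<Rightarrow> 'c" and f :: "'c \<Rightarrow> real"
  assumes T[measurable]: "T \<in> M \<rightarrow>\<^sub>M N" and T'[measurable]: "T' \<in> N \<rightarrow>\<^sub>M M"
    and inv: "\<And>x. x \<in> space M \<Longrightarrow> T' (T x) = x" "\<And>y. y \<in> space N \<Longrightarrow> T (T' y) = y"
    and c: "0 < c"
    and em: "\<And>A. A \<in> sets N \<Longrightarrow> emeasure N A = ennreal c * emeasure M (T -` A \<inter> space M)"
  shows "(\<integral>\<^sup>+y. g y \<partial>N) = ennreal c * (\<integral>\<^sup>+x. g (T x) \<partial>M)"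
    and "(\<integral>y. f y \<partial>N) = c * (\<integral>x. f (T x) \<partial>M)"
proof -
  have cc: "ennreal c * (ennreal (1 / c) * z) = z" "ennreal (1 / c) * (ennreal c * z) = z" for z
    using c by (simp_all add: mult.assoc[symmetric] ennreal_mult[symmetric])
  have em': "emeasure M A = ennreal (1 / c) * emeasure N (T' -` A \<inter> space N)" if A: "A \<in> sets M" for A
  proof -
    have "T -` (T' -` A \<inter> space N) \<inter> space M = A"
      using inv sets.sets_into_space[OF A] measurable_space[OF T] by auto
    moreover have "T' -` A \<inter> space N \<in> sets N" using A by measurable
    ultimately show ?thesis by (simp add: em cc)
  qed
  show "(\<integral>\<^sup>+y. g y \<partial>N) = ennreal c * (\<integral>\<^sup>+x. g (T x) \<partial>M)"
  proof (rule antisym[OF nn_integral_transport_le[OF T em]])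
    have "(\<integral>\<^sup>+x. g (T x) \<partial>M) \<le> ennreal (1 / c) * (\<integral>\<^sup>+y. g (T (T' y)) \<partial>N)"
      by (rule nn_integral_transport_le[OF T' em'])
    also have "(\<integral>\<^sup>+y. g (T (T' y)) \<partial>N) = (\<integral>\<^sup>+y. g y \<partial>N)"
      by (intro nn_integral_cong) (simp add: inv)
    finally have "ennreal c * (\<integral>\<^sup>+x. g (T x) \<partial>M) \<le> ennreal c * (ennreal (1 / c) * (\<integral>\<^sup>+y. g y \<partial>N))"
      by (rule mult_left_mono) simp
    then show "ennreal c * (\<integral>\<^sup>+x. g (T x) \<partial>M) \<le> (\<integral>\<^sup>+y. g y \<partial>N)" by (simp add: cc)
  qed
  show "(\<integral>y. f y \<partial>N) = c * (\<integral>x. f (T x) \<partial>M)"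
  proof (cases "f \<in> borel_measurable N")
    case True
    note [measurable] = True
    have N: "N = density (distr M N T) (\<lambda>_. ennreal c)"
      by (rule measure_eqI) (auto simp: emeasure_distr em emeasure_density_const)
    have "(\<integral>y. f y \<partial>N) = (\<integral>y. c *\<^sub>R f y \<partial>distr M N T)"
      using c by (subst N) (simp add: integral_density)
    also have "\<dots> = (\<integral>x. c *\<^sub>R f (T x) \<partial>M)" by (rule integral_distr) auto
    finally show ?thesis by simp
  next
    \<comment> \<open>Measurability passes through the bijection both ways, so neither function is
      integrable and both integrals default to \<open>0\<close>.\<close>
    case False
    have "(\<lambda>x. f (T x)) \<notin> borel_measurable M"
    proof
      assume "(\<lambda>x. f (T x)) \<in> borel_measurable M"
      then have "(\<lambda>y. f (T (T' y))) \<in> borel_measurable N" by (rule measurable_compose[OF T'])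
      also have "?this \<longleftrightarrow> f \<in> borel_measurable N" by (rule measurable_cong) (simp add: inv)
      finally show False using False by blast
    qed
    then have "\<not> integrable M (\<lambda>x. f (T x))" "\<not> integrable N f"
      using False by auto
    then show ?thesis by (simp add: not_integrable_integral_eq)
  qed
qed

lemma ennreal_powr_add_le:
  assumes "0 \<le> p"
  shows "ennreal (\<bar>a + b\<bar> powr p) \<le> ennreal (2 powr p) * (ennreal (\<bar>a\<bar> powr p) + ennreal (\<bar>b\<bar> powr p))"
proof -
  have "ennreal (\<bar>a + b\<bar> powr p) \<le> ennreal (2 powr p * (\<bar>a\<bar> powr p + \<bar>b\<bar> powr p))"
    by (intro ennreal_leI powr_add_le assms)
  also have "\<dots> = ennreal (2 powr p) * (ennreal (\<bar>a\<bar> powr p) + ennreal (\<bar>b\<bar> powr p))"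
    by (subst ennreal_mult) auto
  finally show ?thesis .
qed

section \<open>Surface measure and Sobolev energies under restriction, multiples and
  dilation\<close>

lemma space_surface [simp]: "space (surface S) = S"
  by (simp add: surface_def space_restrict_space)

lemma sets_surface [measurable_cong]: "sets (surface S) = sets (restrict_space borel S)"
  unfolding surface_def by (rule sets_restrict_space_cong) simp

lemma measurable_surface_id [measurable]: "(\<lambda>x. x) \<in> surface S \<rightarrow>\<^sub>M borel"
  by (subst measurable_cong_sets[OF sets_surface refl]) (rule measurable_restrict_space1, simp)

lemma measurable_into_surface:
  assumes "f \<in> M \<rightarrow>\<^sub>M borel" "\<And>x. x \<in> space M \<Longrightarrow> f x \<in> S"
  shows "f \<in> M \<rightarrow>\<^sub>M surface S"
proof -
  have "f \<in> M \<rightarrow>\<^sub>M restrict_space borel S" using assms by (intro measurable_restrict_space2) auto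
  then show ?thesis by (simp cong: measurable_cong_sets add: sets_surface)
qed

lemma emeasure_surface:
  fixes S :: "'a::euclidean_space set"
  assumes "S \<in> sets borel" "A \<subseteq> S"
  shows "emeasure (surface S) A = emeasure (hausdorff_measure (DIM('a) - 1)) A"
  unfolding surface_def using assms by (intro emeasure_restrict_space) auto

lemma nn_integral_surface_mono:
  assumes "S \<in> sets borel" "S' \<in> sets borel" "S \<subseteq> S'" "\<And>x. x \<in> S \<Longrightarrow> f x \<le> g x"
  shows "(\<integral>\<^sup>+x. f x \<partial>surface S) \<le> (\<integral>\<^sup>+x. g x \<partial>surface S')"
proof -
  have "(\<integral>\<^sup>+x. f x \<partial>surface S) = (\<integral>\<^sup>+x. f x * indicator S x \<partial>hausdorff_measure (DIM('a) - 1))"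
    using assms unfolding surface_def by (intro nn_integral_restrict_space) auto
  also have "\<dots> \<le> (\<integral>\<^sup>+x. g x * indicator S' x \<partial>hausdorff_measure (DIM('a) - 1))"
    using assms by (intro nn_integral_mono) (auto simp: indicator_def)
  also have "\<dots> = (\<integral>\<^sup>+x. g x \<partial>surface S')"
    using assms unfolding surface_def by (intro nn_integral_restrict_space[symmetric]) auto
  finally show ?thesis .
qed

lemma sob_energy_mono:
  assumes "S \<in> sets borel" "S' \<in> sets borel" "S \<subseteq> S'"
  shows "sob_energy s p S f \<le> sob_energy s p S' f"
proof (cases "s = 0")
  case True
  then show ?thesis
    unfolding sob_energy_def by (simp, intro nn_integral_surface_mono assms order_refl)
next
  case False
  then show ?thesis
    unfolding sob_energy_def by (simp, intro add_mono nn_integral_surface_mono assms order_refl)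
qed

lemma sob_energy_cong:
  assumes "\<And>x. x \<in> S \<Longrightarrow> f x = g x"
  shows "sob_energy s p S f = sob_energy s p S g"
proof -
  have "(\<integral>\<^sup>+x. ennreal (\<bar>f x\<bar> powr p) \<partial>surface S) = (\<integral>\<^sup>+x. ennreal (\<bar>g x\<bar> powr p) \<partial>surface S)"
    using assms by (intro nn_integral_cong) auto
  moreover have "(\<integral>\<^sup>+x. (\<integral>\<^sup>+y. ennreal (\<bar>f x - f y\<bar> powr p / norm (x - y) powr (real DIM('a) - 1 + s * p))
          \<partial>surface S) \<partial>surface S) = (\<integral>\<^sup>+x. (\<integral>\<^sup>+y. ennreal (\<bar>g x - g y\<bar> powr p / norm (x - y) powr (real DIM('a) - 1 + s * p))
          \<partial>surface S) \<partial>surface S)"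
    using assms by (intro nn_integral_cong) auto
  ultimately show ?thesis by (simp add: sob_energy_def)
qed

lemma sob_energy_cmult:
  assumes "0 < p"
  shows "sob_energy s p S (\<lambda>x. c * f x) = ennreal (\<bar>c\<bar> powr p) * sob_energy s p S f"
proof (cases "c = 0")
  case True
  then show ?thesis using assms by (simp add: sob_energy_def)
next
  case False
  then have c: "\<bar>c\<bar> powr p > 0" by simp
  have "\<bar>c * f x - c * f y\<bar> = \<bar>c\<bar> * \<bar>f x - f y\<bar>" for x y
    by (simp flip: right_diff_distrib abs_mult)
  then show ?thesis
    unfolding sob_energy_def
    by (simp add: abs_mult powr_mult ennreal_mult nn_integral_cmult_finite[OF c] distrib_left
        flip: times_divide_eq_right)
qed

lemma eta_measurable [measurable]: "eta r m \<in> borel_measurable borel"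
  unfolding eta_def[abs_def] by measurable

context
  fixes r :: real and S :: "'a::euclidean_space set" and k :: nat
  assumes r: "0 < r" and S: "closed S"
begin

lemma closed_eta_image: "closed (eta r m ` S)"
  unfolding eta_def[abs_def] using S by (rule closed_scaling)

lemma surface_transport:
  fixes g :: "'a \<Rightarrow> ennreal" and f :: "'a \<Rightarrow> real"
  shows "(\<integral>\<^sup>+y. g y \<partial>surface (eta r (int k) ` S)) =
      ennreal ((r ^ k) ^ (DIM('a) - 1)) * (\<integral>\<^sup>+x. g (eta r (int k) x) \<partial>surface S)"
    and "(\<integral>y. f y \<partial>surface (eta r (int k) ` S)) =
      (r ^ k) ^ (DIM('a) - 1) * (\<integral>x. f (eta r (int k) x) \<partial>surface S)"
proof -
  let ?T = "eta r (int k) :: 'a \<Rightarrow> 'a"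
  have 1: "?T \<in> surface S \<rightarrow>\<^sub>M surface (?T ` S)"
    by (rule measurable_into_surface[OF measurable_compose[OF measurable_surface_id eta_measurable]]) auto
  have 2: "eta r (- int k) \<in> surface (?T ` S) \<rightarrow>\<^sub>M surface S"
    by (rule measurable_into_surface[OF measurable_compose[OF measurable_surface_id eta_measurable]])
      (auto simp: eta_cancel r)
  have 3: "emeasure (surface (?T ` S)) A =
      ennreal ((r ^ k) ^ (DIM('a) - 1)) * emeasure (surface S) (?T -` A \<inter> space (surface S))"
    if A: "A \<in> sets (surface (?T ` S))" for A
  proof -
    have AS: "A \<subseteq> ?T ` S" using sets.sets_into_space[OF A] by simp
    define B where "B = ?T -` A \<inter> space (surface S)"
    have "B \<in> sets (surface S)" unfolding B_def by (rule measurable_sets[OF 1 A])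
    then have B: "B \<in> sets borel" "B \<subseteq> S"
      using S by (auto simp: sets_surface sets_restrict_space_iff)
    have "A = ?T ` B" using AS by (auto simp: B_def)
    moreover have "?T = (*\<^sub>R) (r ^ k)" by (rule ext) (simp add: eta_def)
    ultimately have "A = (*\<^sub>R) (r ^ k) ` B" by simp
    then have "emeasure (surface (?T ` S)) A = ennreal ((r ^ k) ^ (DIM('a) - 1)) * emeasure (surface S) B"
      using emeasure_surface[of "?T ` S" A] emeasure_surface[of S B] AS B S r closed_eta_image
        emeasure_hausdorff_measure_scale[of "r ^ k" B "DIM('a) - 1"] by simp
    then show ?thesis by (simp add: B_def)
  qed
  have 4: "0 < (r ^ k) ^ (DIM('a) - 1)" using r by simp
  note tr = integral_transport[OF 1 2 _ _ 4 3]
  show "(\<integral>\<^sup>+y. g y \<partial>surface (?T ` S)) =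
      ennreal ((r ^ k) ^ (DIM('a) - 1)) * (\<integral>\<^sup>+x. g (?T x) \<partial>surface S)"
    using r by (intro tr) (auto simp: eta_cancel)
  show "(\<integral>y. f y \<partial>surface (?T ` S)) = (r ^ k) ^ (DIM('a) - 1) * (\<integral>x. f (?T x) \<partial>surface S)"
    using r by (intro tr) (auto simp: eta_cancel)
qed

text \<open>The Lebesgue part scales by \<open>c\<close> and the Slobodeckij part by
  \<open>c * e * c\<close>, which is \<open>(r ^ k) powr (d - 1 - s * p)\<close>; the energies are
  equivalent, not proportional. The second factor is the \<open>p\<close>-th power of
  \<open>(r ^ k) powr \<alpha>\<close> for \<open>\<alpha> = (d - 1) / p - s\<close>: with this
  \<open>\<alpha>\<close> the rescaling preserves the seminorm of each component.\<close>

lemma sob_energy_transport: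
  obtains a b where "0 < a" "0 < b"
    "\<And>f. sob_energy s p (eta r (int k) ` S) f \<le> ennreal a * sob_energy s p S (\<lambda>x. f (eta r (int k) x))"
    "\<And>f. sob_energy s p S (\<lambda>x. f (eta r (int k) x)) \<le> ennreal b * sob_energy s p (eta r (int k) ` S) f"
proof -
  define c where "c = (r ^ k) ^ (DIM('a) - 1)"
  define E where "E = real DIM('a) - 1 + s * p"
  define e where "e = (r ^ k) powr (- E)"
  have c: "0 < c" and e: "0 < e" using r by (auto simp: c_def e_def)
  have cce: "0 < c * e * c" using c e by simp
  define I1 where "I1 f = (\<integral>\<^sup>+x. ennreal (\<bar>f (eta r (int k) x)\<bar> powr p) \<partial>surface S)" for f :: "'a \<Rightarrow> real"
  define I2 where "I2 f = (\<integral>\<^sup>+x. (\<integral>\<^sup>+y. ennreal (\<bar>f (eta r (int k) x) - f (eta r (int k) y)\<bar> powr p / norm (x - y) powr E)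
          \<partial>surface S) \<partial>surface S)" for f :: "'a \<Rightarrow> real"
  have S_eq: "sob_energy s p S (\<lambda>x. f (eta r (int k) x)) = I1 f + (if s = 0 then 0 else I2 f)" for f
    by (simp add: sob_energy_def I1_def I2_def E_def)
  have norm: "norm (eta r (int k) x - eta r (int k) y) powr E =
      norm (x - y) powr E / e" for x y :: 'a
    using r by (simp add: eta_def e_def powr_mult powr_minus divide_inverse mult.commute flip: scaleR_diff_right)
  have en: "ennreal (z / norm (eta r (int k) x - eta r (int k) y) powr E) = ennreal e * ennreal (z / norm (x - y) powr E)"
    if "0 \<le> z" for x y :: 'a and z
    unfolding norm using e that by (subst ennreal_mult[symmetric]) (auto simp: mult.commute)
  have T_eq: "sob_energy s p (eta r (int k) ` S) f = ennreal c * I1 f + (if s = 0 then 0 else ennreal (c * e * c) * I2 f)" for f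
  proof -
    have "(\<integral>\<^sup>+x. (\<integral>\<^sup>+y. ennreal (\<bar>f x - f y\<bar> powr p / norm (x - y) powr E)
          \<partial>surface (eta r (int k) ` S)) \<partial>surface (eta r (int k) ` S)) =
      ennreal c * (\<integral>\<^sup>+x. ennreal c * (\<integral>\<^sup>+y. ennreal e * ennreal (\<bar>f (eta r (int k) x) - f (eta r (int k) y)\<bar> powr p / norm (x - y) powr E)
          \<partial>surface S) \<partial>surface S)"
      by (simp only: surface_transport(1) en powr_ge_zero c_def)
    also have "\<dots> = ennreal (c * e * c) * I2 f"
      using c e by (simp add: nn_integral_cmult_finite I2_def ennreal_mult mult_ac)
    finally show ?thesis unfolding sob_energy_def E_def[symmetric] by (simp add: surface_transport(1) I1_def c_def)
  qed
  define a where "a = max c (c * e * c)"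
  define b where "b = max (1 / c) (1 / (c * e * c))"
  have inv: "z = ennreal (1 / w) * (ennreal w * z)" if "0 < w" for w z
    using that by (simp add: mult.assoc[symmetric] ennreal_mult[symmetric])
  show ?thesis
  proof (rule that)
    show "0 < a" "0 < b" using c by (auto simp: a_def b_def less_max_iff_disj)
    show "sob_energy s p (eta r (int k) ` S) f \<le> ennreal a * sob_energy s p S (\<lambda>x. f (eta r (int k) x))" for f
      unfolding S_eq T_eq distrib_left
      by (intro add_mono) (auto simp: a_def intro!: mult_right_mono ennreal_leI)
    show "sob_energy s p S (\<lambda>x. f (eta r (int k) x)) \<le> ennreal b * sob_energy s p (eta r (int k) ` S) f" for f
      unfolding S_eq T_eq distrib_left
    proof (intro add_mono)
      have "I1 f = ennreal (1 / c) * (ennreal c * I1 f)" by (rule inv[OF c])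
      also have "\<dots> \<le> ennreal b * (ennreal c * I1 f)" by (intro mult_right_mono ennreal_leI) (auto simp: b_def)
      finally show "I1 f \<le> ennreal b * (ennreal c * I1 f)" .
      have "I2 f = ennreal (1 / (c * e * c)) * (ennreal (c * e * c) * I2 f)" by (rule inv[OF cce])
      also have "\<dots> \<le> ennreal b * (ennreal (c * e * c) * I2 f)" by (intro mult_right_mono ennreal_leI) (auto simp: b_def)
      finally show "(if s = 0 then 0 else I2 f) \<le> ennreal b * (if s = 0 then 0 else ennreal (c * e * c) * I2 f)"
        by simp
    qed
  qed
qed

end

section \<open>Elements of the dual spaces\<close>

lemma W_dual_add:
  assumes "F \<in> W_dual s p S" "v \<in> W_fun (- s) (p / (p - 1)) S" "w \<in> W_fun (- s) (p / (p - 1)) S"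
  shows "F (\<lambda>x. v x + w x) = F v + F w"
  using assms by (simp add: W_dual_def Let_def)

lemma W_dual_cmult:
  assumes "F \<in> W_dual s p S" "v \<in> W_fun (- s) (p / (p - 1)) S"
  shows "F (\<lambda>x. c * v x) = c * F v"
  using assms by (simp add: W_dual_def Let_def)

lemma W_dual_bounded:
  assumes "F \<in> W_dual s p S"
  obtains C where "0 \<le> C"
    "\<And>v. v \<in> W_fun (- s) (p / (p - 1)) S \<Longrightarrow> \<bar>F v\<bar> \<le> C * sob_norm (- s) (p / (p - 1)) S v"
proof -
  obtain C where C: "\<And>v. v \<in> W_fun (- s) (p / (p - 1)) S \<Longrightarrow> \<bar>F v\<bar> \<le> C * sob_norm (- s) (p / (p - 1)) S v"
    using assms unfolding W_dual_def Let_def by blast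
  show ?thesis
  proof (rule that)
    show "\<bar>F v\<bar> \<le> \<bar>C\<bar> * sob_norm (- s) (p / (p - 1)) S v" if "v \<in> W_fun (- s) (p / (p - 1)) S" for v
      using C[OF that] by (rule order_trans) (intro mult_right_mono, auto simp: sob_norm_def)
  qed simp
qed

text \<open>Only the upper half of Ahlfors regularity is assumed. A null surface is not excluded; there
  \<open>P0_comp\<close> divides by \<open>0\<close>.\<close>

locale regular_surface =
  fixes S :: "'a::euclidean_space set" and C :: real
  assumes closed: "closed S" and bounded: "bounded S" and dim: "2 \<le> DIM('a)"
    and reg: "\<And>x t. 0 < t \<Longrightarrow> emeasure (hausdorff_measure (DIM('a) - 1)) (S \<inter> cball x t) \<le> ennreal (C * t ^ (DIM('a) - 1))"
begin

lemma borel_S [measurable]: "S \<in> sets borel" using closed by simp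

sublocale upper_regular_measure "surface S" "real DIM('a) - 1" C
proof -
  obtain t where t: "0 < t" "S \<subseteq> cball 0 t" using bounded unfolding bounded_pos by (auto simp: subset_iff)
  have "emeasure (surface S) S = emeasure (hausdorff_measure (DIM('a) - 1)) (S \<inter> cball 0 t)"
    using t by (simp add: emeasure_surface Int_absorb2)
  also have "\<dots> \<le> ennreal (C * t ^ (DIM('a) - 1))" by (rule reg[OF t(1)])
  also have "\<dots> < \<infinity>" by simp
  finally interpret finite_measure "surface S" by (intro finite_measureI) simp
  show "upper_regular_measure (surface S) (real DIM('a) - 1) C"
  proof
    show "(\<lambda>x. x) \<in> surface S \<rightarrow>\<^sub>M borel" by measurable
    show "bounded (space (surface S))" using bounded by simp
    show "0 < real DIM('a) - 1" using dim by simp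
    fix x :: 'a and t :: real assume t: "0 < t"
    have "{y \<in> space (surface S). dist x y \<le> t} = S \<inter> cball x t" by auto
    moreover have "t powr (real DIM('a) - 1) = t ^ (DIM('a) - 1)"
      using t dim by (simp add: powr_realpow[symmetric] of_nat_diff)
    ultimately show "emeasure (surface S) {y \<in> space (surface S). dist x y \<le> t} \<le> ennreal (C * t powr (real DIM('a) - 1))"
      using reg[OF t, of x] by (simp add: emeasure_surface)
  qed
qed

lemma sob_energy_add_le:
  assumes p: "0 < p" and [measurable]: "f \<in> borel_measurable (surface S)" "g \<in> borel_measurable (surface S)"
  shows "sob_energy s p S (\<lambda>x. f x + g x) \<le> ennreal (2 powr p) * (sob_energy s p S f + sob_energy s p S g)"
proof -
  let ?M = "surface S" let ?N = "\<lambda>x y::'a. norm (x - y) powr (real DIM('a) - 1 + s * p)"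
  have [measurable]: "(\<lambda>x. x) \<in> ?M \<rightarrow>\<^sub>M borel" by measurable
  have 1: "(\<integral>\<^sup>+x. ennreal (\<bar>f x + g x\<bar> powr p) \<partial>?M) \<le>
      ennreal (2 powr p) * ((\<integral>\<^sup>+x. ennreal (\<bar>f x\<bar> powr p) \<partial>?M) + (\<integral>\<^sup>+x. ennreal (\<bar>g x\<bar> powr p) \<partial>?M))"
  proof -
    have "(\<integral>\<^sup>+x. ennreal (\<bar>f x + g x\<bar> powr p) \<partial>?M) \<le> (\<integral>\<^sup>+x. ennreal (2 powr p) * (ennreal (\<bar>f x\<bar> powr p) + ennreal (\<bar>g x\<bar> powr p)) \<partial>?M)"
      using p by (intro nn_integral_mono ennreal_powr_add_le) simp
    then show ?thesis by (simp add: nn_integral_cmult nn_integral_add)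
  qed
  have 2: "(\<integral>\<^sup>+x. (\<integral>\<^sup>+y. ennreal (\<bar>(f x + g x) - (f y + g y)\<bar> powr p / ?N x y) \<partial>?M) \<partial>?M) \<le>
      ennreal (2 powr p) * ((\<integral>\<^sup>+x. (\<integral>\<^sup>+y. ennreal (\<bar>f x - f y\<bar> powr p / ?N x y) \<partial>?M) \<partial>?M) +
        (\<integral>\<^sup>+x. (\<integral>\<^sup>+y. ennreal (\<bar>g x - g y\<bar> powr p / ?N x y) \<partial>?M) \<partial>?M))"
  proof -
    have "ennreal (\<bar>(f x + g x) - (f y + g y)\<bar> powr p / ?N x y) \<le>
        ennreal (2 powr p) * (ennreal (\<bar>f x - f y\<bar> powr p / ?N x y) + ennreal (\<bar>g x - g y\<bar> powr p / ?N x y))" for x y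
    proof -
      have "\<bar>(f x + g x) - (f y + g y)\<bar> powr p \<le> 2 powr p * (\<bar>f x - f y\<bar> powr p + \<bar>g x - g y\<bar> powr p)"
        using powr_add_le[of p "f x - f y" "g x - g y"] p by (simp add: add_diff_add)
      then have "\<bar>(f x + g x) - (f y + g y)\<bar> powr p / ?N x y \<le> 2 powr p * (\<bar>f x - f y\<bar> powr p + \<bar>g x - g y\<bar> powr p) / ?N x y"
        by (intro divide_right_mono) auto
      also have "\<dots> = 2 powr p * (\<bar>f x - f y\<bar> powr p / ?N x y + \<bar>g x - g y\<bar> powr p / ?N x y)"
        by (simp only: distrib_left add_divide_distrib times_divide_eq_right)
      finally have "ennreal (\<bar>(f x + g x) - (f y + g y)\<bar> powr p / ?N x y) \<le>
          ennreal (2 powr p * (\<bar>f x - f y\<bar> powr p / ?N x y + \<bar>g x - g y\<bar> powr p / ?N x y))"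
        by (rule ennreal_leI)
      also have "\<dots> = ennreal (2 powr p) * (ennreal (\<bar>f x - f y\<bar> powr p / ?N x y) + ennreal (\<bar>g x - g y\<bar> powr p / ?N x y))"
        by (subst ennreal_mult) auto
      finally show ?thesis .
    qed
    then have "(\<integral>\<^sup>+x. (\<integral>\<^sup>+y. ennreal (\<bar>(f x + g x) - (f y + g y)\<bar> powr p / ?N x y) \<partial>?M) \<partial>?M) \<le>
      (\<integral>\<^sup>+x. (\<integral>\<^sup>+y. ennreal (2 powr p) * (ennreal (\<bar>f x - f y\<bar> powr p / ?N x y) + ennreal (\<bar>g x - g y\<bar> powr p / ?N x y)) \<partial>?M) \<partial>?M)"
      by (intro nn_integral_mono)
    also have "\<dots> = (\<integral>\<^sup>+x. ennreal (2 powr p) * ((\<integral>\<^sup>+y. ennreal (\<bar>f x - f y\<bar> powr p / ?N x y) \<partial>?M) +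
        (\<integral>\<^sup>+y. ennreal (\<bar>g x - g y\<bar> powr p / ?N x y) \<partial>?M)) \<partial>?M)"
      by (intro nn_integral_cong) (simp add: nn_integral_cmult nn_integral_add)
    also have "\<dots> = ennreal (2 powr p) * ((\<integral>\<^sup>+x. (\<integral>\<^sup>+y. ennreal (\<bar>f x - f y\<bar> powr p / ?N x y) \<partial>?M) \<partial>?M) +
        (\<integral>\<^sup>+x. (\<integral>\<^sup>+y. ennreal (\<bar>g x - g y\<bar> powr p / ?N x y) \<partial>?M) \<partial>?M))"
      by (simp add: nn_integral_cmult nn_integral_add)
    finally show ?thesis .
  qed
  show ?thesis
    using add_mono[OF 1 2] 1 by (cases "s = 0") (auto simp: sob_energy_def distrib_left add_ac)
qed

lemma sob_energy_const:
  assumes "0 < p"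
  shows "sob_energy s p S (\<lambda>_. c) = ennreal (\<bar>c\<bar> powr p) * emeasure (surface S) S"
  using assms by (simp add: sob_energy_def)

lemma W_fun_add:
  assumes "0 < p" "f \<in> W_fun s p S" "g \<in> W_fun s p S"
  shows "(\<lambda>x. f x + g x) \<in> W_fun s p S"
proof -
  have m: "f \<in> borel_measurable (surface S)" "g \<in> borel_measurable (surface S)"
    and "sob_energy s p S f < \<infinity>" "sob_energy s p S g < \<infinity>"
    using assms by (simp_all add: W_fun_def)
  then have "ennreal (2 powr p) * (sob_energy s p S f + sob_energy s p S g) < \<infinity>"
    by (simp add: ennreal_mult_less_top)
  with sob_energy_add_le[OF assms(1) m] have "sob_energy s p S (\<lambda>x. f x + g x) < \<infinity>"
    by (rule le_less_trans)
  then show ?thesis using m by (simp add: W_fun_def)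
qed

lemma W_fun_cmult:
  assumes "0 < p" "f \<in> W_fun s p S"
  shows "(\<lambda>x. c * f x) \<in> W_fun s p S"
proof -
  have "f \<in> borel_measurable (surface S)" "sob_energy s p S f < \<infinity>"
    using assms by (simp_all add: W_fun_def)
  then show ?thesis using assms by (simp add: W_fun_def sob_energy_cmult ennreal_mult_less_top)
qed

lemma W_fun_const: "0 < p \<Longrightarrow> (\<lambda>_. c) \<in> W_fun s p S"
  by (simp add: W_fun_def sob_energy_const emeasure_eq_measure ennreal_mult_less_top)

lemma W_fun_cong:
  assumes "\<And>x. x \<in> S \<Longrightarrow> f x = g x"
  shows "f \<in> W_fun s p S \<longleftrightarrow> g \<in> W_fun s p S"
proof -
  have "f \<in> borel_measurable (surface S) \<longleftrightarrow> g \<in> borel_measurable (surface S)"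
    by (rule measurable_cong) (simp add: assms)
  moreover have "sob_energy s p S f = sob_energy s p S g" by (rule sob_energy_cong) (rule assms)
  ultimately show ?thesis by (simp add: W_fun_def)
qed

lemma Lp_le_sob_energy: "(\<integral>\<^sup>+x. ennreal (\<bar>f x\<bar> powr p) \<partial>surface S) \<le> sob_energy s p S f"
  by (simp add: sob_energy_def add_increasing2)

lemma mean_powr_bound:
  assumes p: "1 < p"
  obtains B where "0 \<le> B" "\<And>f. f \<in> borel_measurable (surface S) \<Longrightarrow>
    ennreal (\<bar>\<integral>x. f x \<partial>surface S\<bar> powr p) \<le> ennreal B * (\<integral>\<^sup>+x. ennreal (\<bar>f x\<bar> powr p) \<partial>surface S)"
    "\<And>f. f \<in> borel_measurable (surface S) \<Longrightarrow> (\<integral>\<^sup>+x. ennreal (\<bar>f x\<bar> powr p) \<partial>surface S) < \<infinity> \<Longrightarrow> integrable (surface S) f"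
proof -
  \<comment> \<open>The added \<open>1\<close> keeps the mass bound positive on a null
    surface.\<close>
  define m where "m = measure (surface S) S + 1"
  have m: "0 < m" by (simp add: m_def add_nonneg_pos)
  have mass: "(\<integral>\<^sup>+y. ennreal 1 \<partial>surface S) \<le> ennreal m"
    by (simp add: emeasure_eq_measure m_def)
  show ?thesis
  proof (rule that)
    show "0 \<le> 2 powr p * m powr (p - 1)" by simp
    fix f :: "'a \<Rightarrow> real" assume f: "f \<in> borel_measurable (surface S)"
    note W = weighted_integral_powr_bound[OF p m _ f f _ mass]
    show "ennreal (\<bar>\<integral>x. f x \<partial>surface S\<bar> powr p) \<le>
       ennreal (2 powr p * m powr (p - 1)) * (\<integral>\<^sup>+x. ennreal (\<bar>f x\<bar> powr p) \<partial>surface S)"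
      using W(2) by simp
    show "integrable (surface S) f" if "(\<integral>\<^sup>+x. ennreal (\<bar>f x\<bar> powr p) \<partial>surface S) < \<infinity>"
      using W(1) that by simp
  qed
qed

lemma W_fun_integrable:
  assumes "1 < p" "f \<in> W_fun s p S" shows "integrable (surface S) f"
proof -
  obtain B where "0 \<le> B" "\<And>f. f \<in> borel_measurable (surface S) \<Longrightarrow>
    ennreal (\<bar>\<integral>x. f x \<partial>surface S\<bar> powr p) \<le> ennreal B * (\<integral>\<^sup>+x. ennreal (\<bar>f x\<bar> powr p) \<partial>surface S)"
    and int: "\<And>f. f \<in> borel_measurable (surface S) \<Longrightarrow> (\<integral>\<^sup>+x. ennreal (\<bar>f x\<bar> powr p) \<partial>surface S) < \<infinity> \<Longrightarrow> integrable (surface S) f"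
    by (rule mean_powr_bound[OF assms(1)]) blast
  show ?thesis
    by (rule int) (use assms(2) le_less_trans[OF Lp_le_sob_energy[of f p s]] in \<open>simp_all add: W_fun_def\<close>)
qed

lemma P0_comp_Lp_bound:
  assumes p: "1 < p"
  obtains B where "0 \<le> B" "\<And>f. f \<in> borel_measurable (surface S) \<Longrightarrow>
    (\<integral>\<^sup>+x. ennreal (\<bar>P0_comp S f x\<bar> powr p) \<partial>surface S) \<le> ennreal B * (\<integral>\<^sup>+x. ennreal (\<bar>f x\<bar> powr p) \<partial>surface S)"
proof -
  obtain B where B: "0 \<le> B" and mean: "\<And>f. f \<in> borel_measurable (surface S) \<Longrightarrow>
    ennreal (\<bar>\<integral>x. f x \<partial>surface S\<bar> powr p) \<le> ennreal B * (\<integral>\<^sup>+x. ennreal (\<bar>f x\<bar> powr p) \<partial>surface S)"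
    and "\<And>f. f \<in> borel_measurable (surface S) \<Longrightarrow> (\<integral>\<^sup>+x. ennreal (\<bar>f x\<bar> powr p) \<partial>surface S) < \<infinity> \<Longrightarrow> integrable (surface S) f"
    by (rule mean_powr_bound[OF p]) blast
  define m where "m = measure (surface S) S"
  define D where "D = \<bar>1 / m\<bar> powr p * m"
  have D: "0 \<le> D" by (simp add: D_def m_def)
  show ?thesis
  proof (rule that)
    show "0 \<le> 2 powr p * (1 + D * B)" using B D by simp
    fix f :: "'a \<Rightarrow> real" assume f[measurable]: "f \<in> borel_measurable (surface S)"
    let ?I = "\<integral>\<^sup>+x. ennreal (\<bar>f x\<bar> powr p) \<partial>surface S"
    define c where "c = - (\<integral>y. f y \<partial>surface S) / m"
    have c: "ennreal (\<bar>c\<bar> powr p) * ennreal m = ennreal D * ennreal (\<bar>\<integral>x. f x \<partial>surface S\<bar> powr p)"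
      by (simp add: c_def D_def abs_divide powr_divide powr_one_eq_one m_def flip: ennreal_mult)
    have "(\<integral>\<^sup>+x. ennreal (\<bar>P0_comp S f x\<bar> powr p) \<partial>surface S) = (\<integral>\<^sup>+x. ennreal (\<bar>f x + c\<bar> powr p) \<partial>surface S)"
      by (simp add: P0_comp_def c_def m_def)
    also have "\<dots> \<le> (\<integral>\<^sup>+x. ennreal (2 powr p) * (ennreal (\<bar>f x\<bar> powr p) + ennreal (\<bar>c\<bar> powr p)) \<partial>surface S)"
      using p by (intro nn_integral_mono ennreal_powr_add_le) simp
    also have "\<dots> = ennreal (2 powr p) * (?I + ennreal (\<bar>c\<bar> powr p) * ennreal m)"
      by (simp add: nn_integral_cmult nn_integral_add emeasure_eq_measure m_def)
    also have "\<dots> \<le> ennreal (2 powr p) * (?I + ennreal D * (ennreal B * ?I))"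
      unfolding c by (intro mult_left_mono add_left_mono mean) auto
    also have "\<dots> = ennreal (2 powr p * (1 + D * B)) * ?I"
      using B D by (simp add: ennreal_mult distrib_left distrib_right mult.assoc)
    finally show "(\<integral>\<^sup>+x. ennreal (\<bar>P0_comp S f x\<bar> powr p) \<partial>surface S) \<le> ennreal (2 powr p * (1 + D * B)) * ?I" .
  qed
qed

lemma P0_comp_W_fun:
  assumes p: "1 < p" and f: "f \<in> W_fun s p S"
  shows "P0_comp S f \<in> W0_fun s p S"
proof -
  define c where "c = - (\<integral>y. f y \<partial>surface S) / measure (surface S) S"
  have eq: "P0_comp S f = (\<lambda>x. f x + c)" by (auto simp: P0_comp_def c_def)
  have "(\<integral>x. f x + c \<partial>surface S) = (\<integral>x. f x \<partial>surface S) + measure (surface S) S * c"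
    using W_fun_integrable[OF p f] by simp
  also have "\<dots> = 0"
  \<comment> \<open>On a null surface the correction is a division by \<open>0\<close>, hence
    \<open>0\<close>, and the integral of \<open>f\<close> vanishes by itself.\<close>
  proof (cases "measure (surface S) S = 0")
    case True
    then have "emeasure (surface S) (space (surface S)) = 0" by (simp add: emeasure_eq_measure)
    then have "AE x in surface S. False" by (intro AE_I[where N="space (surface S)"] sets.top) auto
    then have "AE x in surface S. f x = 0" by eventually_elim simp
    then have "(\<integral>x. f x \<partial>surface S) = 0" by (rule integral_eq_zero_AE)
    then show ?thesis using True by simp
  qed (simp add: c_def)
  finally show ?thesis
    using p f W_fun_add[of p f s "\<lambda>_. c"] W_fun_const by (auto simp: W0_fun_def eq)
qed

text \<open>Functionals are stored on functions rather than on classes. The bound by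
  \<open>sob_norm\<close> forces them to vanish on a difference that is \<open>0\<close> almost
  everywhere, which restores the passage to classes.\<close>

lemma W_dual_cong_AE:
  assumes p: "1 < p" and F: "F \<in> W_dual s p S"
    and v: "v \<in> W_fun (- s) (p / (p - 1)) S" and w: "w \<in> W_fun (- s) (p / (p - 1)) S"
    and ae: "AE x in surface S. v x = w x"
  shows "F v = F w"
proof -
  let ?q = "p / (p - 1)"
  have q: "0 < ?q" using p by simp
  define u where "u = (\<lambda>x. v x + (-1) * w x)"
  have w': "(\<lambda>x. (-1) * w x) \<in> W_fun (- s) ?q S" using W_fun_cmult[OF q w] .
  have u: "u \<in> W_fun (- s) ?q S" unfolding u_def by (rule W_fun_add[OF q v w'])
  have u0: "AE x in surface S. u x = 0" using ae by eventually_elim (simp add: u_def)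
  have "(\<integral>\<^sup>+x. ennreal (\<bar>u x\<bar> powr ?q) \<partial>surface S) = (\<integral>\<^sup>+x. 0 \<partial>surface S)"
    using u0 by (intro nn_integral_cong_AE) (auto elim!: eventually_mono)
  moreover have "(\<integral>\<^sup>+x. (\<integral>\<^sup>+y. ennreal (\<bar>u x - u y\<bar> powr ?q / norm (x - y) powr (real DIM('a) - 1 + - s * ?q))
          \<partial>surface S) \<partial>surface S) = (\<integral>\<^sup>+x. (\<integral>\<^sup>+y. 0 \<partial>surface S) \<partial>surface S)"
  proof (rule nn_integral_cong_AE, use u0 in eventually_elim)
    case (elim x)
    show ?case by (rule nn_integral_cong_AE, use u0 in eventually_elim) (simp add: elim)
  qed
  ultimately have "sob_energy (- s) ?q S u = 0" by (simp add: sob_energy_def)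
  then have "sob_norm (- s) ?q S u = 0" by (simp add: sob_norm_def)
  moreover obtain K where "\<bar>F u\<bar> \<le> K * sob_norm (- s) ?q S u"
    using W_dual_bounded[OF F] u by blast
  ultimately have "F u = 0" by simp
  moreover have "F u = F v + F (\<lambda>x. (-1) * w x)"
    unfolding u_def by (rule W_dual_add[OF F v w'])
  moreover have "F (\<lambda>x. (-1) * w x) = (-1) * F w"
    by (rule W_dual_cmult[OF F w])
  ultimately show ?thesis by simp
qed

end

section \<open>The fundamental solution\<close>

text \<open>The fractions \<open>1 / (1 + y)\<close> and \<open>y / (1 + y)\<close> add up to
  \<open>1\<close>, and \<open>z \<le> z powr \<theta>\<close> on the unit interval.\<close>

lemma powr_le_add_powr:
  fixes y \<theta> :: real
  assumes "0 \<le> y" "0 < \<theta>" "\<theta> \<le> 1"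
  shows "(1 + y) powr \<theta> \<le> 1 + y powr \<theta>"
proof -
  have le: "z \<le> z powr \<theta>" if "0 \<le> z" "z \<le> 1" for z :: real
    using powr_mono'[of \<theta> 1 z] that assms by simp
  have "1 = 1 / (1 + y) + y / (1 + y)" using assms by (simp add: field_simps)
  also have "\<dots> \<le> (1 / (1 + y)) powr \<theta> + (y / (1 + y)) powr \<theta>"
    using assms by (intro add_mono le) auto
  also have "\<dots> = (1 + y powr \<theta>) / (1 + y) powr \<theta>"
    using assms by (simp add: powr_divide add_divide_distrib)
  finally show ?thesis using assms by (simp add: field_simps)
qed

text \<open>With \<open>y = (v - u) / u\<close>, apply \<open>ln a \<le> a - 1\<close> to
  \<open>a = (1 + y) powr \<theta>\<close>; dividing by \<open>\<theta>\<close> at the end produces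
  the constant of the later kernel bounds.\<close>

lemma ln_diff_hoelder:
  fixes u v \<theta> :: real
  assumes "0 < u" "u \<le> v" "0 < \<theta>" "\<theta> \<le> 1"
  shows "ln v - ln u \<le> (1 / \<theta>) * (v - u) powr \<theta> * u powr (- \<theta>)"
proof -
  define y where "y = (v - u) / u"
  have y: "0 \<le> y" using assms by (simp add: y_def)
  have v: "v = u * (1 + y)" using assms by (simp add: y_def field_simps)
  have "\<theta> * (ln v - ln u) = ln ((1 + y) powr \<theta>)"
    unfolding v using assms y by (simp add: ln_mult ln_powr)
  also have "\<dots> \<le> (1 + y) powr \<theta> - 1" using y by (intro ln_le_minus_one) simp
  also have "\<dots> \<le> y powr \<theta>" using powr_le_add_powr[OF y assms(3,4)] by simp
  also have "\<dots> = (v - u) powr \<theta> * u powr (- \<theta>)"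
    unfolding y_def using assms by (subst powr_divide) (auto simp: powr_minus divide_inverse)
  finally show ?thesis using assms by (simp add: field_simps)
qed

text \<open>The relative increment \<open>(v - u) / v\<close> lies in the unit interval, so the
  power \<open>\<theta>\<close> enlarges it; then \<open>v\<close> in the denominator is replaced by
  the smaller \<open>u\<close>.\<close>

lemma inverse_diff_hoelder:
  fixes u v \<theta> :: real
  assumes "0 < u" "u \<le> v" "0 < \<theta>" "\<theta> \<le> 1"
  shows "1 / u - 1 / v \<le> (v - u) powr \<theta> * u powr (- (1 + \<theta>))"
proof -
  define z where "z = (v - u) / v"
  have z: "0 \<le> z" "z \<le> 1" using assms by (auto simp: z_def)
  have "1 / u - 1 / v = (1 / u) * z" using assms by (simp add: z_def field_simps)
  also have "\<dots> \<le> (1 / u) * z powr \<theta>"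
    using powr_mono'[of \<theta> 1 z] z assms by (intro mult_left_mono) auto
  also have "\<dots> \<le> (1 / u) * ((v - u) / u) powr \<theta>"
    using assms by (intro mult_left_mono powr_mono2) (auto simp: z_def intro!: divide_left_mono)
  also have "\<dots> = (v - u) powr \<theta> * u powr (- (1 + \<theta>))"
  proof -
    have "((v - u) / u) powr \<theta> = (v - u) powr \<theta> / u powr \<theta>" using assms by (subst powr_divide) auto
    moreover have "u powr (- (1 + \<theta>)) = inverse (u * u powr \<theta>)"
      unfolding powr_minus powr_add using assms by simp
    ultimately show ?thesis by (simp add: divide_inverse)
  qed
  finally show ?thesis .
qed

text \<open>\<open>ln a \<le> a - 1\<close> at \<open>t powr \<theta>\<close> and at
  \<open>t powr (- \<theta>)\<close> bounds the two signs of the logarithm. The factor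
  \<open>D powr (2 * \<theta>)\<close> turns the growing power into a multiple of the singular one
  for \<open>t \<le> D\<close>.\<close>

lemma abs_ln_le_powr:
  fixes t D \<theta> :: real
  assumes "0 < t" "t \<le> D" "0 < \<theta>"
  shows "\<bar>ln t\<bar> \<le> (1 / \<theta>) * (D powr (2 * \<theta>) + 1) * t powr (- \<theta>)"
proof -
  have "\<theta> * ln t = ln (t powr \<theta>)" using assms by (simp add: ln_powr)
  also have "\<dots> \<le> t powr \<theta> - 1" using assms by (intro ln_le_minus_one) simp
  finally have 1: "\<theta> * ln t \<le> t powr \<theta>" by simp
  have "- (\<theta> * ln t) = ln (t powr (- \<theta>))" using assms by (simp add: ln_powr)
  also have "\<dots> \<le> t powr (- \<theta>) - 1" using assms by (intro ln_le_minus_one) simp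
  finally have 2: "- (\<theta> * ln t) \<le> t powr (- \<theta>)" by simp
  have "t powr \<theta> = t powr (2 * \<theta>) * t powr (- \<theta>)" using assms by (simp flip: powr_add)
  also have "\<dots> \<le> D powr (2 * \<theta>) * t powr (- \<theta>)"
    using assms by (intro mult_right_mono powr_mono2) auto
  finally have 3: "t powr \<theta> \<le> D powr (2 * \<theta>) * t powr (- \<theta>)" .
  have "\<theta> * \<bar>ln t\<bar> = \<bar>\<theta> * ln t\<bar>" using assms by (simp add: abs_mult)
  also have "\<dots> \<le> t powr \<theta> + t powr (- \<theta>)"
    using 1 2 powr_ge_zero[of t \<theta>] powr_ge_zero[of t "- \<theta>"] by linarith
  also have "\<dots> \<le> (D powr (2 * \<theta>) + 1) * t powr (- \<theta>)" using 3 by (simp add: distrib_right)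
  finally show ?thesis using assms by (simp add: field_simps)
qed

lemma fund_sol_commute: "fund_sol x y = fund_sol y x"
  by (simp add: fund_sol_def norm_minus_commute)

text \<open>The singularity \<open>d - 2 + \<theta>\<close> is the order of the kernel plus the
  order \<open>\<theta>\<close> spent on the factor \<open>dist x x' powr \<theta>\<close>. The term
  of the point nearer to \<open>y\<close> alone dominates the difference; the sum makes the bound
  symmetric in \<open>x\<close> and \<open>x'\<close>.\<close>

lemma fund_sol_hoelder:
  fixes x x' y :: "'a::euclidean_space"
  assumes d: "DIM('a) = 2 \<or> DIM('a) = 3" and \<theta>: "0 < \<theta>" "\<theta> \<le> 1" and ne: "x \<noteq> y" "x' \<noteq> y"
  shows "\<bar>fund_sol x y - fund_sol x' y\<bar> \<le>
    (1 / \<theta>) * dist x x' powr \<theta> * (dist x y powr (- (real DIM('a) - 2 + \<theta>)) + dist x' y powr (- (real DIM('a) - 2 + \<theta>)))"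
proof -
  let ?a = "real DIM('a) - 2 + \<theta>"
  have le: "\<bar>fund_sol x y - fund_sol x' y\<bar> \<le> (1 / \<theta>) * dist x x' powr \<theta> * dist x y powr (- ?a)"
    if ne: "x \<noteq> y" "x' \<noteq> y" and uv: "dist x y \<le> dist x' y" for x x' :: 'a
  proof -
    define u v where "u = dist x y" and "v = dist x' y"
    have u: "0 < u" "u \<le> v" using that by (auto simp: u_def v_def)
    have h: "(v - u) powr \<theta> \<le> dist x x' powr \<theta>"
      using u \<theta> dist_triangle[of x' y x] by (intro powr_mono2) (auto simp: u_def v_def dist_commute)
    have two_pi: "1 \<le> 2 * pi" "1 \<le> 4 * pi" using pi_gt3 by linarith+
    show ?thesis
    proof (cases "DIM('a) = 2")
      case True
      have "0 \<le> ln v - ln u" using u by simp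
      have "\<bar>fund_sol x y - fund_sol x' y\<bar> = \<bar>ln u - ln v\<bar> / (2 * pi)"
        using True by (simp add: fund_sol_def u_def v_def dist_norm flip: diff_divide_distrib)
      also have "\<bar>ln u - ln v\<bar> = ln v - ln u" using \<open>0 \<le> ln v - ln u\<close> by simp
      finally have "\<bar>fund_sol x y - fund_sol x' y\<bar> = (ln v - ln u) / (2 * pi)" .
      also have "\<dots> \<le> ln v - ln u"
        using two_pi \<open>0 \<le> ln v - ln u\<close> by (subst pos_divide_le_eq) (auto intro: mult_left_mono[of 1 "2 * pi" "ln v - ln u", simplified])
      also have "\<dots> \<le> (1 / \<theta>) * (v - u) powr \<theta> * u powr (- \<theta>)" by (rule ln_diff_hoelder[OF u \<theta>])
      also have "\<dots> \<le> (1 / \<theta>) * dist x x' powr \<theta> * u powr (- \<theta>)"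
        using h \<theta> by (intro mult_right_mono mult_left_mono) auto
      finally show ?thesis using True by (simp add: u_def)
    next
      case False
      then have d3: "DIM('a) = 3" using d by simp
      have i: "0 \<le> 1 / u - 1 / v" using u by (simp add: field_simps)
      have "fund_sol x y - fund_sol x' y = - ((1 / u - 1 / v) / (4 * pi))"
        using False u by (simp add: fund_sol_def u_def v_def dist_norm divide_simps)
      then have "\<bar>fund_sol x y - fund_sol x' y\<bar> = (1 / u - 1 / v) / (4 * pi)"
        using i by (simp add: abs_divide)
      also have "\<dots> \<le> 1 / u - 1 / v"
        using two_pi i by (subst pos_divide_le_eq) (auto intro: mult_left_mono[of 1 "4 * pi" "1 / u - 1 / v", simplified])
      also have "\<dots> \<le> (v - u) powr \<theta> * u powr (- (1 + \<theta>))" by (rule inverse_diff_hoelder[OF u \<theta>])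
      also have "\<dots> \<le> dist x x' powr \<theta> * u powr (- (1 + \<theta>))" using h by (intro mult_right_mono) auto
      also have "\<dots> \<le> (1 / \<theta>) * (dist x x' powr \<theta> * u powr (- (1 + \<theta>)))"
        using \<theta> mult_right_mono[of 1 "1 / \<theta>" "dist x x' powr \<theta> * u powr (- (1 + \<theta>))"] by simp
      finally show ?thesis using d3 by (simp add: u_def mult.assoc)
    qed
  qed
  show ?thesis
  proof (cases "dist x y \<le> dist x' y")
    case True
    then show ?thesis
      using le[OF ne True] \<theta> by (simp add: distrib_left add_increasing2)
  next
    case False
    then show ?thesis
      using le[OF ne(2,1)] \<theta> by (simp add: distrib_left add_increasing abs_minus_commute dist_commute)
  qed
qed

text \<open>The kernel is less singular than stated; its order is raised by \<open>\<theta>\<close>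
  to match the Hoelder bound. The first summand of the constant serves dimension two, the second
  dimension three.\<close>

lemma fund_sol_size:
  fixes x y :: "'a::euclidean_space"
  assumes d: "DIM('a) = 2 \<or> DIM('a) = 3" and \<theta>: "0 < \<theta>" and ne: "x \<noteq> y" "dist x y \<le> D"
  shows "\<bar>fund_sol x y\<bar> \<le> ((1 / \<theta>) * (D powr (2 * \<theta>) + 1) + D powr \<theta>) * dist x y powr (- (real DIM('a) - 2 + \<theta>))"
proof -
  define t where "t = dist x y"
  have t: "0 < t" "t \<le> D" using ne by (auto simp: t_def)
  have two_pi: "1 \<le> 2 * pi" "1 \<le> 4 * pi" using pi_gt3 by linarith+
  show ?thesis
  proof (cases "DIM('a) = 2")
    case True
    have "\<bar>fund_sol x y\<bar> = \<bar>ln t\<bar> / (2 * pi)"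
      using True by (simp add: fund_sol_def t_def dist_norm abs_divide)
    also have "\<dots> \<le> \<bar>ln t\<bar>"
      using two_pi by (subst pos_divide_le_eq) (auto intro: mult_left_mono[of 1 "2 * pi" "\<bar>ln t\<bar>", simplified])
    also have "\<dots> \<le> (1 / \<theta>) * (D powr (2 * \<theta>) + 1) * t powr (- \<theta>)"
      by (rule abs_ln_le_powr[OF t \<theta>])
    also have "\<dots> \<le> ((1 / \<theta>) * (D powr (2 * \<theta>) + 1) + D powr \<theta>) * t powr (- \<theta>)"
      by (intro mult_right_mono) auto
    finally show ?thesis using True by (simp add: t_def)
  next
    case False
    then have d3: "DIM('a) = 3" using d by simp
    have "\<bar>fund_sol x y\<bar> = (1 / t) / (4 * pi)"
      using False t by (simp add: fund_sol_def t_def dist_norm abs_divide divide_simps)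
    also have "\<dots> \<le> 1 / t"
      using two_pi t by (subst pos_divide_le_eq) (auto intro: mult_left_mono[of 1 "4 * pi" "1 / t", simplified])
    also have "\<dots> = t powr \<theta> * t powr (- (1 + \<theta>))" using t by (simp add: powr_minus divide_inverse flip: powr_add)
    also have "\<dots> \<le> D powr \<theta> * t powr (- (1 + \<theta>))" using t \<theta> by (intro mult_right_mono powr_mono2) auto
    also have "\<dots> \<le> ((1 / \<theta>) * (D powr (2 * \<theta>) + 1) + D powr \<theta>) * t powr (- (1 + \<theta>))"
      using \<theta> by (intro mult_right_mono) auto
    finally show ?thesis using d3 by (simp add: t_def)
  qed
qed

lemma measurable_fund_sol [measurable]:
  fixes f g :: "'b \<Rightarrow> 'a::euclidean_space"
  assumes [measurable]: "f \<in> borel_measurable M" "g \<in> borel_measurable M"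
  shows "(\<lambda>x. fund_sol (f x) (g x)) \<in> borel_measurable M"
  unfolding fund_sol_def by (cases "DIM('a) = 2") simp_all

text \<open>Off the diagonal the two sides differ by a constant in dimension two; it is annihilated by
  densities of mean zero.\<close>

lemma fund_sol_eta:
  fixes x y :: "'a::euclidean_space"
  assumes d: "DIM('a) = 2 \<or> DIM('a) = 3" and r: "0 < r" and ne: "eta r (j - int k) x \<noteq> y"
  shows "fund_sol (eta r j x) (eta r (int k) y) =
    (1 / (r ^ k) ^ (DIM('a) - 2)) * fund_sol (eta r (j - int k) x) y + (if DIM('a) = 2 then ln (r ^ k) / (2 * pi) else 0)"
proof -
  let ?z = "eta r (j - int k) x - y"
  have "r powi j = r ^ k * r powi (j - int k)" using r by (simp add: power_int_diff)
  then have "eta r j x - eta r (int k) y = (r ^ k) *\<^sub>R ?z"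
    by (simp add: eta_def scaleR_diff_right)
  then have n: "norm (eta r j x - eta r (int k) y) = r ^ k * norm ?z" using r by simp
  have z: "0 < norm ?z" using ne by simp
  show ?thesis
    using d
  proof
    assume "DIM('a) = 2"
    then show ?thesis using z r by (simp add: fund_sol_def n ln_mult add_divide_distrib)
  next
    assume "DIM('a) = 3"
    then show ?thesis by (simp add: fund_sol_def n)
  qed
qed

text \<open>If \<open>g2 * f\<close> is not integrable then \<open>g1 * f\<close> is not either,
  because \<open>b * f\<close> is integrable and \<open>a \<noteq> 0\<close>; both integrals then
  default to \<open>0\<close>. Hence potentials scale at every point, not only where they
  converge.\<close>

lemma integral_affine_mult:
  fixes f g1 g2 :: "'b \<Rightarrow> real"
  assumes f: "integrable M f" "(\<integral>y. f y \<partial>M) = 0" and a: "a \<noteq> 0"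
    and [measurable]: "g1 \<in> borel_measurable M" "g2 \<in> borel_measurable M"
    and ae: "AE y in M. g1 y = a * g2 y + b"
  shows "(\<integral>y. g1 y * f y \<partial>M) = a * (\<integral>y. g2 y * f y \<partial>M)"
proof -
  have [measurable]: "f \<in> borel_measurable M" using f by auto
  have "(\<integral>y. g1 y * f y \<partial>M) = (\<integral>y. a * (g2 y * f y) + b * f y \<partial>M)"
    using ae by (intro integral_cong_AE) (auto elim!: eventually_mono simp: algebra_simps)
  also have "\<dots> = a * (\<integral>y. g2 y * f y \<partial>M)"
  proof (cases "integrable M (\<lambda>y. g2 y * f y)")
    case True
    then show ?thesis using f by simp
  next
    case False
    have "\<not> integrable M (\<lambda>y. a * (g2 y * f y) + b * f y)"
    proof
      assume "integrable M (\<lambda>y. a * (g2 y * f y) + b * f y)"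
      then have "integrable M (\<lambda>y. (1 / a) * ((a * (g2 y * f y) + b * f y) - b * f y))"
        using f by (intro integrable_mult_right Bochner_Integration.integrable_diff) auto
      then show False using False a by simp
    qed
    then show ?thesis using False by (simp add: not_integrable_integral_eq)
  qed
  finally show ?thesis .
qed

text \<open>The column weight stays in the argument of \<open>A\<close>, which is not known to be
  homogeneous. That \<open>A\<close> maps \<open>0\<close> to \<open>0\<close> removes the other
  entries of \<open>single_seq\<close>.\<close>

lemma block_diag_toeplitz_diag:
  assumes "\<And>m. A m (\<lambda>_. 0) = (\<lambda>_. 0)"
  shows "block (diag_op r a \<circ> toeplitz_op A \<circ> diag_op r b) j k \<psi> x =
    r powr (real j * a) * A (int j - int k) (\<lambda>y. r powr (real k * b) * \<psi> y) x"
proof -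
  have "diag_op r b (single_seq k \<psi>) = single_seq k (\<lambda>y. r powr (real k * b) * \<psi> y)"
    by (auto simp: diag_op_def single_seq_def fun_eq_iff)
  then show ?thesis
    using block_toeplitz_op[of A j k "\<lambda>y. r powr (real k * b) * \<psi> y", OF assms]
    by (simp add: block_def diag_op_def)
qed

section \<open>Projection, restriction and kernel operators on a regular surface\<close>

lemma P0_comp_cong:
  assumes "\<And>x. x \<in> S \<Longrightarrow> f x = g x" "x \<in> S"
  shows "P0_comp S f x = P0_comp S g x"
proof -
  have "(\<integral>y. f y \<partial>surface S) = (\<integral>y. g y \<partial>surface S)"
    using assms by (intro Bochner_Integration.integral_cong) auto
  then show ?thesis using assms by (simp add: P0_comp_def)
qed

lemma P0_comp_cmult: "P0_comp S (\<lambda>x. c * f x) = (\<lambda>x. c * P0_comp S f x)"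
  by (auto simp: P0_comp_def right_diff_distrib)

lemma nn_integral_surface_subset:
  fixes g :: "'a::euclidean_space \<Rightarrow> ennreal"
  assumes "S \<in> sets borel" "S' \<in> sets borel" "S \<subseteq> S'" "\<And>x. x \<in> S' - S \<Longrightarrow> g x = 0"
  shows "(\<integral>\<^sup>+x. g x \<partial>surface S') = (\<integral>\<^sup>+x. g x \<partial>surface S)"
proof -
  have "(\<integral>\<^sup>+x. g x \<partial>surface S) = (\<integral>\<^sup>+x. g x * indicator S x \<partial>hausdorff_measure (DIM('a) - 1))"
    using assms unfolding surface_def by (intro nn_integral_restrict_space) auto
  also have "\<dots> = (\<integral>\<^sup>+x. g x * indicator S' x \<partial>hausdorff_measure (DIM('a) - 1))"
    using assms by (intro nn_integral_cong) (auto simp: indicator_def)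
  also have "\<dots> = (\<integral>\<^sup>+x. g x \<partial>surface S')"
    using assms unfolding surface_def by (intro nn_integral_restrict_space[symmetric]) auto
  finally show ?thesis by simp
qed

context regular_surface
begin

lemma kernel_W_fun:
  fixes K :: "'a \<Rightarrow> 'a \<Rightarrow> real"
  assumes "0 \<le> s" "s < \<theta>" "a < real DIM('a) - 1" "1 < p"
    and K[measurable]: "case_prod K \<in> borel_measurable (surface S \<Otimes>\<^sub>M surface S)"
    and "\<And>x y. x \<in> S \<Longrightarrow> y \<in> S \<Longrightarrow> x \<noteq> y \<Longrightarrow> \<bar>K x y\<bar> \<le> A * dist x y powr (- a)"
    and "\<And>x x' y. x \<in> S \<Longrightarrow> x' \<in> S \<Longrightarrow> y \<in> S \<Longrightarrow> x \<noteq> y \<Longrightarrow> x' \<noteq> y \<Longrightarrow>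
      \<bar>K x y - K x' y\<bar> \<le> A * dist x x' powr \<theta> * (dist x y powr (- a) + dist x' y powr (- a))"
  obtains B where "0 \<le> B"
    "\<And>f. f \<in> borel_measurable (surface S) \<Longrightarrow>
      sob_energy s p S (\<lambda>x. \<integral>y. K x y * f y \<partial>surface S) \<le> ennreal B * (\<integral>\<^sup>+y. ennreal (\<bar>f y\<bar> powr p) \<partial>surface S)"
    "\<And>f. f \<in> borel_measurable (surface S) \<Longrightarrow> (\<lambda>x. \<integral>y. K x y * f y \<partial>surface S) \<in> borel_measurable (surface S)"
    "\<And>f. f \<in> borel_measurable (surface S) \<Longrightarrow> (\<integral>\<^sup>+y. ennreal (\<bar>f y\<bar> powr p) \<partial>surface S) < \<infinity> \<Longrightarrow>
      AE x in surface S. integrable (surface S) (\<lambda>y. K x y * f y)"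
proof -
  let ?M = "surface S"
  obtain B where B: "0 \<le> B"
    and en: "\<And>f. f \<in> borel_measurable ?M \<Longrightarrow>
      (\<integral>\<^sup>+x. ennreal (\<bar>\<integral>y. K x y * f y \<partial>?M\<bar> powr p) \<partial>?M) +
      (\<integral>\<^sup>+x. (\<integral>\<^sup>+x'. ennreal (\<bar>(\<integral>y. K x y * f y \<partial>?M) - (\<integral>y. K x' y * f y \<partial>?M)\<bar> powr p /
          norm (x - x') powr (real DIM('a) - 1 + s * p)) \<partial>?M) \<partial>?M)
      \<le> ennreal B * (\<integral>\<^sup>+y. ennreal (\<bar>f y\<bar> powr p) \<partial>?M)"
    and ae: "\<And>f. f \<in> borel_measurable ?M \<Longrightarrow> (\<integral>\<^sup>+y. ennreal (\<bar>f y\<bar> powr p) \<partial>?M) < \<infinity> \<Longrightarrow>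
      AE x in ?M. integrable ?M (\<lambda>y. K x y * f y)"
    by (rule kernel_operator_bounds[OF assms(1-5), of A]) (use assms in \<open>simp, simp, blast\<close>)
  show ?thesis
  proof (rule that[OF B _ _ ae])
    fix f :: "'a \<Rightarrow> real" assume f[measurable]: "f \<in> borel_measurable ?M"
    show "sob_energy s p S (\<lambda>x. \<integral>y. K x y * f y \<partial>?M) \<le> ennreal B * (\<integral>\<^sup>+y. ennreal (\<bar>f y\<bar> powr p) \<partial>?M)"
    proof (rule order_trans[OF _ en[OF f]])
      show "sob_energy s p S (\<lambda>x. \<integral>y. K x y * f y \<partial>?M) \<le>
        (\<integral>\<^sup>+x. ennreal (\<bar>\<integral>y. K x y * f y \<partial>?M\<bar> powr p) \<partial>?M) +
        (\<integral>\<^sup>+x. (\<integral>\<^sup>+x'. ennreal (\<bar>(\<integral>y. K x y * f y \<partial>?M) - (\<integral>y. K x' y * f y \<partial>?M)\<bar> powr p /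
          norm (x - x') powr (real DIM('a) - 1 + s * p)) \<partial>?M) \<partial>?M)"
        unfolding sob_energy_def by (intro add_left_mono) simp
    qed
    show "(\<lambda>x. \<integral>y. K x y * f y \<partial>?M) \<in> borel_measurable ?M" by measurable
  qed auto
qed

end

section \<open>The union of the scaled boundaries\<close>

locale scaled_surfaces = regular_surface "frontier \<Omega>" C
  for \<Omega> :: "'a::euclidean_space set" and C :: real +
  fixes r :: real
  assumes d: "DIM('a) = 2 \<or> DIM('a) = 3" and r: "0 < r" "r < 1"
    and zero: "0 \<notin> frontier \<Omega>"
    and disj: "\<And>j k. j \<noteq> k \<Longrightarrow> Gam r \<Omega> j \<inter> Gam r \<Omega> k = {}"
begin

abbreviation "\<Gamma> \<equiv> frontier \<Omega>"
abbreviation "\<sigma> \<equiv> surface \<Gamma>"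

lemma Gam_closed: "closed (Gam r \<Omega> k)"
  unfolding Gam_def by (rule closed_eta_image[OF r(1) closed])

lemma Gam_borel [measurable]: "Gam r \<Omega> k \<in> sets borel"
  using Gam_closed by simp

lemma Gam_all_borel [measurable]: "Gam_all r \<Omega> \<in> sets borel"
  unfolding Gam_all_def by measurable

lemma Gam_subset_all: "Gam r \<Omega> k \<subseteq> Gam_all r \<Omega>"
  by (auto simp: Gam_all_def)

lemma eta_Gam_iff: "x \<in> \<Gamma> \<Longrightarrow> eta r (int j) x \<in> Gam r \<Omega> i \<longleftrightarrow> i = j"
  by (rule eta_mem_Gam[OF disj])

lemma powr_scale: "(r ^ k) ^ (DIM('a) - 1) = r powr (real k * (real DIM('a) - 1))"
proof -
  have "(r ^ k) ^ (DIM('a) - 1) = r powr (real (k * (DIM('a) - 1)))"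
    using r by (simp only: power_mult[symmetric] powr_realpow)
  then show ?thesis using dim by (simp add: of_nat_diff)
qed

text \<open>Jacobian times homogeneity of the kernel: in both dimensions a single power of
  \<open>r ^ k\<close> survives, the source of the \<open>1\<close> in the exponent
  \<open>1 - \<alpha>\<close>.\<close>

lemma powr_scale': "(r ^ k) ^ (DIM('a) - 1) * (1 / (r ^ k) ^ (DIM('a) - 2)) = r powr real k"
  using d r by (auto simp: powr_realpow power2_eq_square)

lemma nn_integral_Gam: "(\<integral>\<^sup>+y. g y \<partial>surface (Gam r \<Omega> k)) =
    ennreal ((r ^ k) ^ (DIM('a) - 1)) * (\<integral>\<^sup>+x. g (eta r (int k) x) \<partial>\<sigma>)"
  unfolding Gam_def by (rule surface_transport(1)[OF r(1) closed])

lemma integral_Gam: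
  fixes f :: "'a \<Rightarrow> real"
  shows "(\<integral>y. f y \<partial>surface (Gam r \<Omega> k)) =
    (r ^ k) ^ (DIM('a) - 1) * (\<integral>x. f (eta r (int k) x) \<partial>\<sigma>)"
  unfolding Gam_def by (rule surface_transport(2)[OF r(1) closed])

lemma Gam_compact: "compact (Gam r \<Omega> k)"
proof -
  have "compact \<Gamma>" using closed bounded by (simp add: compact_eq_bounded_closed)
  then show ?thesis unfolding Gam_def eta_def[abs_def] by (rule compact_scaling)
qed

text \<open>The components accumulate only at the origin, and component \<open>k\<close> stays at
  distance at least \<open>r ^ k * \<mu>\<close> from it. From some index \<open>N\<close> on, all
  components lie within half that distance of the origin; the finitely many others form a closed set
  disjoint from a compact one.\<close>

lemma Gam_separated:
  obtains \<delta> where "0 < \<delta>" "\<And>x i y. x \<in> Gam r \<Omega> k \<Longrightarrow> i \<noteq> k \<Longrightarrow> y \<in> Gam r \<Omega> i \<Longrightarrow> \<delta> \<le> dist x y"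
proof -
  obtain \<mu> where \<mu>: "0 < \<mu>" "\<And>x. x \<in> \<Gamma> \<Longrightarrow> \<mu> \<le> norm x"
    using separate_point_closed[OF closed zero] by auto
  obtain D where D: "0 < D" "\<And>x. x \<in> \<Gamma> \<Longrightarrow> norm x \<le> D"
    using bounded unfolding bounded_pos by blast
  have "0 < r ^ k * \<mu> / (2 * D)" using r \<mu> D by simp
  then obtain N where N: "r ^ N < r ^ k * \<mu> / (2 * D)" using real_arch_pow_inv[OF _ r(2)] by blast
  define U where "U = (\<Union>i\<in>{..<N} - {k}. Gam r \<Omega> i)"
  have "closed U" unfolding U_def by (intro closed_UN) (auto intro: Gam_closed)
  moreover have "Gam r \<Omega> k \<inter> U = {}" unfolding U_def using disj by fastforce
  ultimately obtain \<delta>1 where \<delta>1: "0 < \<delta>1" "\<And>x y. x \<in> Gam r \<Omega> k \<Longrightarrow> y \<in> U \<Longrightarrow> \<delta>1 \<le> dist x y"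
    using separate_compact_closed[OF Gam_compact] by metis
  show ?thesis
  proof (rule that)
    show "0 < min \<delta>1 (r ^ k * \<mu> / 2)" using \<delta>1 r \<mu> by simp
    fix x i y assume x: "x \<in> Gam r \<Omega> k" and i: "i \<noteq> k" and y: "y \<in> Gam r \<Omega> i"
    show "min \<delta>1 (r ^ k * \<mu> / 2) \<le> dist x y"
    proof (cases "i < N")
      case True
      then have "y \<in> U" using i y by (auto simp: U_def)
      then show ?thesis using \<delta>1(2)[OF x] by (simp add: min.coboundedI1)
    next
      case False
      obtain x' y' where x': "x' \<in> \<Gamma>" "x = eta r (int k) x'" and y': "y' \<in> \<Gamma>" "y = eta r (int i) y'"
        using x y by (auto simp: Gam_def)
      have "norm y = r ^ i * norm y'" using y' r by (simp add: eta_def)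
      also have "\<dots> \<le> r ^ N * D"
        using False r D(2)[OF y'(1)] by (intro mult_mono power_decreasing) auto
      also have "\<dots> \<le> r ^ k * \<mu> / 2" using N D by (simp add: field_simps)
      finally have "norm y \<le> r ^ k * \<mu> / 2" .
      moreover have "r ^ k * \<mu> \<le> norm x" using x' r \<mu>(2)[OF x'(1)] by (simp add: eta_def)
      moreover have "norm x - norm y \<le> dist x y" unfolding dist_norm by (rule norm_triangle_ineq2)
      ultimately have "r ^ k * \<mu> / 2 \<le> dist x y" by linarith
      then show ?thesis by (simp add: min.coboundedI2)
    qed
  qed
qed

text \<open>The areas of the components form a geometric series with ratio
  \<open>r ^ (d - 1)\<close>.\<close>

lemma finite_measure_Gam_all: "finite_measure (surface (Gam_all r \<Omega>))"
proof (rule finite_measureI)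
  let ?q = "r ^ (DIM('a) - 1)"
  have q: "0 < ?q" "?q < 1" using r dim by (auto simp: power_less_one_iff)
  define m where "m = measure \<sigma> \<Gamma>"
  have em: "emeasure (surface (Gam r \<Omega> j)) (Gam r \<Omega> j) = ennreal (?q ^ j * m)" for j
  proof -
    have "emeasure (surface (Gam r \<Omega> j)) (Gam r \<Omega> j) = ennreal ((r ^ j) ^ (DIM('a) - 1)) * emeasure \<sigma> \<Gamma>"
      using nn_integral_Gam[where g="\<lambda>_. 1" and k=j] by simp
    then show ?thesis
      using r by (simp add: emeasure_eq_measure m_def ennreal_mult power_mult[symmetric] mult.commute)
  qed
  have s: "summable (\<lambda>j. ?q ^ j * m)" using q by (intro summable_mult2 summable_geometric) simp
  let ?H = "hausdorff_measure (DIM('a) - 1) :: 'a measure"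
  have "emeasure (surface (Gam_all r \<Omega>)) (space (surface (Gam_all r \<Omega>))) = emeasure ?H (\<Union>j. Gam r \<Omega> j)"
    by (simp add: emeasure_surface Gam_all_borel) (simp add: Gam_all_def)
  also have "\<dots> \<le> (\<Sum>j. emeasure ?H (Gam r \<Omega> j))"
    by (rule emeasure_subadditive_countably) auto
  also have "\<dots> = (\<Sum>j. ennreal (?q ^ j * m))"
    using em by (simp add: emeasure_surface Gam_borel)
  also have "\<dots> = ennreal (\<Sum>j. ?q ^ j * m)" using q s by (intro suminf_ennreal2) (auto simp: m_def)
  finally show "emeasure (surface (Gam_all r \<Omega>)) (space (surface (Gam_all r \<Omega>))) \<noteq> \<infinity>"
    by (auto simp: top_unique)
qed

subsection \<open>Transplanting functions between the components\<close>

text \<open>The image of a single entry in position \<open>k\<close> under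
  \<open>resc_inv_fun\<close>, without its weight; also the test function that occurs in
  \<open>resc_dual\<close>.\<close>

definition lift :: "nat \<Rightarrow> ('a \<Rightarrow> real) \<Rightarrow> 'a \<Rightarrow> real" where
  "lift k h x = indicator (Gam r \<Omega> k) x * h (eta r (- int k) x)"

lemma lift_eta: "x \<in> \<Gamma> \<Longrightarrow> lift k h (eta r (int j) x) = (if j = k then h x else 0)"
  using r by (auto simp: lift_def eta_Gam_iff eta_cancel)

lemma lift_measurable:
  assumes h: "h \<in> borel_measurable \<sigma>"
  shows "lift k h \<in> borel_measurable (surface (Gam_all r \<Omega>))"
proof -
  let ?M = "surface (Gam_all r \<Omega>)"
  have sub: "Gam r \<Omega> k \<inter> space ?M \<in> sets ?M"
    using Gam_subset_all[of k] by (auto simp: sets_surface sets_restrict_space_iff Int_absorb2)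
  have "eta r (- int k) \<in> restrict_space ?M (Gam r \<Omega> k) \<rightarrow>\<^sub>M \<sigma>"
  proof (rule measurable_into_surface)
    have "eta r (- int k) \<in> ?M \<rightarrow>\<^sub>M borel"
      by (rule measurable_compose[OF measurable_surface_id eta_measurable])
    then show "eta r (- int k) \<in> restrict_space ?M (Gam r \<Omega> k) \<rightarrow>\<^sub>M borel"
      by (rule measurable_restrict_space1)
  qed (auto simp: space_restrict_space Gam_def eta_cancel r)
  then have "(\<lambda>x. h (eta r (- int k) x)) \<in> borel_measurable (restrict_space ?M (Gam r \<Omega> k))"
    by (rule measurable_compose[OF _ h])
  then show ?thesis
    unfolding lift_def[abs_def] using sub by (simp add: borel_measurable_restrict_space_iff)
qed

text \<open>Compared with the energy on component \<open>k\<close> alone, the new Slobodeckij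
  contribution comes from pairs with one point on that component and one off it. Their distance is
  at least \<open>\<delta>\<close>, so the weight is bounded there, and the union has finite
  measure.\<close>

lemma sob_energy_lift_finite:
  assumes s: "0 \<le> s" and p: "1 < p" and h: "h \<in> W_fun s p \<Gamma>"
  shows "sob_energy s p (Gam_all r \<Omega>) (lift k h) < \<infinity>"
proof -
  let ?M = "surface (Gam_all r \<Omega>)" and ?k = "Gam r \<Omega> k" and ?\<phi> = "lift k h"
  define E where "E = real DIM('a) - 1 + s * p"
  have E: "0 < E" using dim s p by (auto simp: E_def intro: add_pos_nonneg)
  interpret M: finite_measure ?M by (rule finite_measure_Gam_all)
  have [measurable]: "?\<phi> \<in> borel_measurable ?M" using h by (intro lift_measurable) (simp add: W_fun_def)
  obtain a b where ab: "0 < a" "\<And>f. sob_energy s p ?k f \<le> ennreal a * sob_energy s p \<Gamma> (\<lambda>x. f (eta r (int k) x))"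
    unfolding Gam_def by (rule sob_energy_transport[OF r(1) closed, where k=k and s=s and p=p]) blast
  have "sob_energy s p \<Gamma> (\<lambda>x. ?\<phi> (eta r (int k) x)) = sob_energy s p \<Gamma> h"
    by (rule sob_energy_cong) (simp add: lift_eta)
  then have fin: "sob_energy s p ?k ?\<phi> < \<infinity>"
    using ab(2)[of ?\<phi>] h by (auto simp: W_fun_def ennreal_mult_less_top elim!: le_less_trans)
  let ?I = "\<integral>\<^sup>+x. ennreal (\<bar>?\<phi> x\<bar> powr p) \<partial>?M"
  have I: "?I = (\<integral>\<^sup>+x. ennreal (\<bar>?\<phi> x\<bar> powr p) \<partial>surface ?k)"
    using p by (intro nn_integral_surface_subset Gam_borel Gam_all_borel Gam_subset_all) (simp add: lift_def)
  have Ifin: "?I < \<infinity>"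
    unfolding I using fin by (simp add: sob_energy_def)
  show ?thesis
  proof (cases "s = 0")
    case True
    then show ?thesis using Ifin by (simp add: sob_energy_def)
  next
    case False
    define J where "J x y = ennreal (\<bar>?\<phi> x - ?\<phi> y\<bar> powr p / norm (x - y) powr E)" for x y
    define J1 where "J1 x y = J x y * indicator ?k x * indicator ?k y" for x y
    have Jk: "(\<integral>\<^sup>+x. (\<integral>\<^sup>+y. J x y \<partial>surface ?k) \<partial>surface ?k) < \<infinity>"
      using fin False by (simp add: sob_energy_def J_def E_def)
    have J1: "(\<integral>\<^sup>+x. (\<integral>\<^sup>+y. J1 x y \<partial>?M) \<partial>?M) = (\<integral>\<^sup>+x. (\<integral>\<^sup>+y. J x y \<partial>surface ?k) \<partial>surface ?k)"
    proof -
      have "(\<integral>\<^sup>+y. J1 x y \<partial>?M) = (\<integral>\<^sup>+y. J1 x y \<partial>surface ?k)" for x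
        by (intro nn_integral_surface_subset Gam_borel Gam_all_borel Gam_subset_all) (simp add: J1_def)
      then have "(\<integral>\<^sup>+x. (\<integral>\<^sup>+y. J1 x y \<partial>?M) \<partial>?M) = (\<integral>\<^sup>+x. (\<integral>\<^sup>+y. J1 x y \<partial>surface ?k) \<partial>?M)" by simp
      also have "\<dots> = (\<integral>\<^sup>+x. (\<integral>\<^sup>+y. J1 x y \<partial>surface ?k) \<partial>surface ?k)"
        by (intro nn_integral_surface_subset Gam_borel Gam_all_borel Gam_subset_all) (simp add: J1_def)
      also have "\<dots> = (\<integral>\<^sup>+x. (\<integral>\<^sup>+y. J x y \<partial>surface ?k) \<partial>surface ?k)"
        by (intro nn_integral_cong) (simp add: J1_def)
      finally show ?thesis .
    qed
    obtain \<delta> where \<delta>: "0 < \<delta>" "\<And>x i y. x \<in> ?k \<Longrightarrow> i \<noteq> k \<Longrightarrow> y \<in> Gam r \<Omega> i \<Longrightarrow> \<delta> \<le> dist x y"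
      by (rule Gam_separated) blast
    define c where "c = \<delta> powr (- E)"
    have c: "0 < c" using \<delta> by (simp add: c_def)
    have far: "\<bar>z\<bar> powr p / norm (x - y) powr E \<le> c * \<bar>z\<bar> powr p"
      if x: "x \<in> ?k" and y: "y \<in> Gam_all r \<Omega> - ?k" for x y z
    proof -
      obtain i where "y \<in> Gam r \<Omega> i" "i \<noteq> k" using y by (auto simp: Gam_all_def)
      then have "\<delta> \<le> dist x y" using x \<delta>(2) by blast
      then have "norm (x - y) powr (- E) \<le> c"
        unfolding c_def using \<delta> E by (intro powr_mono2') (auto simp: dist_norm)
      then have "norm (x - y) powr (- E) * \<bar>z\<bar> powr p \<le> c * \<bar>z\<bar> powr p" by (rule mult_right_mono) simp
      then show ?thesis by (simp add: powr_minus divide_inverse mult.commute)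
    qed
    have le: "J x y \<le> J1 x y + (ennreal c * ennreal (\<bar>?\<phi> x\<bar> powr p) + ennreal c * ennreal (\<bar>?\<phi> y\<bar> powr p))"
      if xy: "x \<in> Gam_all r \<Omega>" "y \<in> Gam_all r \<Omega>" for x y
    proof (cases "x \<in> ?k \<longleftrightarrow> y \<in> ?k")
      case True
      then show ?thesis using p by (cases "x \<in> ?k") (auto simp: J1_def J_def lift_def)
    next
      case False
      show ?thesis
      proof (cases "x \<in> ?k")
        case True
        then have "J x y \<le> ennreal c * ennreal (\<bar>?\<phi> x\<bar> powr p)"
          using far[of x y "?\<phi> x"] xy False c by (auto simp: J_def lift_def ennreal_leI simp flip: ennreal_mult)
        then show ?thesis by (simp add: add_increasing add_increasing2)
      next
        case xk: False
        then have "J x y \<le> ennreal c * ennreal (\<bar>?\<phi> y\<bar> powr p)"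
          using far[of y x "?\<phi> y"] xy False c
          by (auto simp: J_def lift_def ennreal_leI norm_minus_commute simp flip: ennreal_mult)
        then show ?thesis by (simp add: add_increasing)
      qed
    qed
    have [measurable]: "(\<lambda>(x, y). J1 x y) \<in> borel_measurable (?M \<Otimes>\<^sub>M ?M)"
    proof -
      have [measurable]: "(\<lambda>x. x) \<in> ?M \<rightarrow>\<^sub>M borel" by measurable
      have [measurable]: "indicator ?k \<in> borel_measurable ?M"
        by (rule measurable_compose[OF measurable_surface_id]) simp
      show ?thesis unfolding J1_def J_def by measurable
    qed
    let ?m = "emeasure ?M (Gam_all r \<Omega>)"
    have mfin: "?m < \<infinity>" by (simp add: M.emeasure_eq_measure)
    have "(\<integral>\<^sup>+x. (\<integral>\<^sup>+y. J x y \<partial>?M) \<partial>?M) \<le>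
      (\<integral>\<^sup>+x. (\<integral>\<^sup>+y. J1 x y + (ennreal c * ennreal (\<bar>?\<phi> x\<bar> powr p) + ennreal c * ennreal (\<bar>?\<phi> y\<bar> powr p)) \<partial>?M) \<partial>?M)"
      using le by (intro nn_integral_mono) simp
    also have "\<dots> = (\<integral>\<^sup>+x. (\<integral>\<^sup>+y. J1 x y \<partial>?M) + (ennreal c * ennreal (\<bar>?\<phi> x\<bar> powr p) * ?m + ennreal c * ?I) \<partial>?M)"
      by (intro nn_integral_cong) (simp add: nn_integral_add nn_integral_cmult)
    also have "\<dots> = (\<integral>\<^sup>+x. (\<integral>\<^sup>+y. J1 x y \<partial>?M) \<partial>?M) + (ennreal c * ?I * ?m + ennreal c * ?I * ?m)"
      by (simp add: nn_integral_add nn_integral_cmult nn_integral_multc)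
    also have "\<dots> < \<infinity>"
      unfolding J1 using Jk Ifin mfin by (simp add: ennreal_mult_less_top)
    finally have "(\<integral>\<^sup>+x. (\<integral>\<^sup>+y. J x y \<partial>?M) \<partial>?M) < \<infinity>" .
    then show ?thesis using Ifin by (simp add: sob_energy_def J_def E_def)
  qed
qed

text \<open>Places a lifted density in the domain to which \<open>SL_proj_fun\<close> is
  restricted.\<close>

lemma lift_W0_fun_all:
  assumes s: "0 \<le> s" and p: "1 < p" and h: "h \<in> W0_fun s p \<Gamma>"
  shows "lift k h \<in> W0_fun_all s p r \<Omega>"
proof -
  have h': "h \<in> W_fun s p \<Gamma>" "(\<integral>x. h x \<partial>\<sigma>) = 0" using h by (auto simp: W0_fun_def)
  have "(\<integral>x. lift k h x \<partial>surface (Gam r \<Omega> j)) = 0" for j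
  proof -
    have "(\<integral>x. lift k h (eta r (int j) x) \<partial>\<sigma>) = (\<integral>x. (if j = k then h x else 0) \<partial>\<sigma>)"
      by (intro Bochner_Integration.integral_cong) (auto simp: lift_eta)
    then show ?thesis using h' by (cases "j = k") (simp_all add: integral_Gam)
  qed
  then show ?thesis
    using lift_measurable[of h k] sob_energy_lift_finite[OF s p h'(1)] h'(1)
    by (simp add: W0_fun_all_def W_fun_def)
qed

text \<open>Numerator and denominator of the mean carry the same Jacobian, so the projection
  commutes with dilation.\<close>

lemma P0_eta:
  assumes x: "x \<in> \<Gamma>"
  shows "P0 r \<Omega> u (eta r (int j) x) = P0_comp \<Gamma> (\<lambda>y. u (eta r (int j) y)) x"
proof -
  have c: "(r ^ j) ^ (DIM('a) - 1) \<noteq> 0" using r by simp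
  have m: "measure (surface (Gam r \<Omega> j)) (Gam r \<Omega> j) = (r ^ j) ^ (DIM('a) - 1) * measure \<sigma> \<Gamma>"
    using integral_Gam[where f="\<lambda>_. 1" and k=j] by simp
  have "P0 r \<Omega> u (eta r (int j) x) = P0_comp (Gam r \<Omega> j) u (eta r (int j) x)"
    unfolding P0_def by (subst suminf_one[of j]) (auto simp: eta_Gam_iff[OF x])
  then show ?thesis using c r by (simp add: P0_comp_def integral_Gam m)
qed

lemma P0_outside: "x \<notin> Gam_all r \<Omega> \<Longrightarrow> P0 r \<Omega> u x = 0"
  by (simp add: P0_def Gam_all_def)

lemma P0_lift: "P0 r \<Omega> (lift k h) = lift k (P0_comp \<Gamma> h)"
proof
  fix x
  show "P0 r \<Omega> (lift k h) x = lift k (P0_comp \<Gamma> h) x"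
  proof (cases "x \<in> Gam_all r \<Omega>")
    case True
    then obtain j z where z: "z \<in> \<Gamma>" "x = eta r (int j) z" by (auto simp: Gam_all_def Gam_def)
    have "P0_comp \<Gamma> (\<lambda>y. lift k h (eta r (int j) y)) z = P0_comp \<Gamma> (\<lambda>y. if j = k then h y else 0) z"
      by (rule P0_comp_cong) (auto simp: lift_eta z)
    also have "\<dots> = (if j = k then P0_comp \<Gamma> h z else 0)" by (simp add: P0_comp_def)
    finally show ?thesis by (simp add: z P0_eta lift_eta)
  next
    case False
    then have "x \<notin> Gam r \<Omega> k" by (auto simp: Gam_all_def)
    then show ?thesis using P0_outside[OF False] by (simp add: lift_def)
  qed
qed

lemma SL_lift: "SL r \<Omega> (lift k h) x = (r ^ k) ^ (DIM('a) - 1) * (\<integral>y. fund_sol x (eta r (int k) y) * h y \<partial>\<sigma>)"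
proof -
  have eq: "(\<integral>y. fund_sol x y * lift k h y \<partial>surface (Gam r \<Omega> j)) =
      (if j = k then (r ^ k) ^ (DIM('a) - 1) * (\<integral>y. fund_sol x (eta r (int k) y) * h y \<partial>\<sigma>) else 0)" for j
  proof -
    have "(\<integral>y. fund_sol x (eta r (int j) y) * lift k h (eta r (int j) y) \<partial>\<sigma>) =
        (\<integral>y. (if j = k then fund_sol x (eta r (int k) y) * h y else 0) \<partial>\<sigma>)"
      by (intro Bochner_Integration.integral_cong) (auto simp: lift_eta)
    then show ?thesis by (simp add: integral_Gam)
  qed
  show ?thesis unfolding SL_def eq by (subst suminf_one[of k]) auto
qed

subsection \<open>Mapping properties of the blocks\<close>

text \<open>For \<open>m \<noteq> 0\<close> the dilated surface keeps a positive distance from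
  \<open>\<Gamma>\<close>, and \<open>dist x y\<close> is bounded, so the lower bound holds with a
  small \<open>c\<close>; for \<open>m = 0\<close> it is an equality. Smooth off-diagonal blocks
  thereby obey the same kernel bounds as the singular diagonal block.\<close>

lemma eta_separated:
  obtains c D where "0 < c" "0 < D"
    "\<And>x y. x \<in> \<Gamma> \<Longrightarrow> y \<in> \<Gamma> \<Longrightarrow> c * dist x y \<le> dist (eta r m x) y"
    "\<And>x y. x \<in> \<Gamma> \<Longrightarrow> y \<in> \<Gamma> \<Longrightarrow> dist (eta r m x) y \<le> D"
proof -
  have cpt: "compact \<Gamma>" using closed bounded by (simp add: compact_eq_bounded_closed)
  have cpt': "compact (eta r m ` \<Gamma>)" unfolding eta_def[abs_def] by (rule compact_scaling[OF cpt])
  obtain R where R: "0 < R" "\<And>x. x \<in> \<Gamma> \<Longrightarrow> norm x \<le> R" "\<And>x. x \<in> \<Gamma> \<Longrightarrow> norm (eta r m x) \<le> R"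
  proof -
    have "bounded (\<Gamma> \<union> eta r m ` \<Gamma>)" using cpt cpt' by (simp add: compact_imp_bounded)
    then show ?thesis using that unfolding bounded_pos by auto
  qed
  have D: "dist x y \<le> 2 * R" if "norm x \<le> R" "norm y \<le> R" for x y :: 'a
    using norm_triangle_ineq4[of x y] that by (simp add: dist_norm)
  obtain c where c: "0 < c" "\<And>x y. x \<in> \<Gamma> \<Longrightarrow> y \<in> \<Gamma> \<Longrightarrow> c * dist x y \<le> dist (eta r m x) y"
  proof (cases "m = 0")
    case True
    then show ?thesis using that[of 1] by (simp add: eta_def)
  next
    case False
    have "eta r m ` \<Gamma> \<inter> \<Gamma> = {}"
    proof (rule equals0I)
      fix z assume "z \<in> eta r m ` \<Gamma> \<inter> \<Gamma>"
      then obtain x where x: "x \<in> \<Gamma>" "eta r m x \<in> \<Gamma>" by blast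
      show False
      proof (cases "0 \<le> m")
        case True
        then have "eta r (int 0) (eta r m x) \<in> Gam r \<Omega> (nat m)" using x by (auto simp: Gam_def eta_def)
        then show False using eta_Gam_iff[OF x(2), of 0 "nat m"] True False by simp
      next
        \<comment> \<open>Dilating by \<open>- m\<close> brings the pair back to the components with
          indices \<open>0\<close> and \<open>- m\<close>.\<close>
        case neg: False
        have "eta r (int 0) x = eta r (int (nat (- m))) (eta r m x)"
          using neg eta_cancel(1)[OF r(1), of m x] by (simp add: eta_def)
        then have "eta r (int 0) x \<in> Gam r \<Omega> (nat (- m))" using x by (auto simp: Gam_def)
        then show False using eta_Gam_iff[OF x(1), of 0 "nat (- m)"] neg by simp
      qed
    qed
    then obtain \<delta> where \<delta>: "0 < \<delta>" "\<And>x y. x \<in> eta r m ` \<Gamma> \<Longrightarrow> y \<in> \<Gamma> \<Longrightarrow> \<delta> \<le> dist x y"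
      using separate_compact_closed[OF cpt' closed] by metis
    show ?thesis
    proof (rule that)
      show "0 < \<delta> / (2 * R)" using \<delta> R by simp
      fix x y assume xy: "x \<in> \<Gamma>" "y \<in> \<Gamma>"
      have "\<delta> / (2 * R) * dist x y \<le> \<delta> / (2 * R) * (2 * R)"
        using D R xy \<delta> by (intro mult_left_mono) auto
      also have "\<dots> = \<delta>" using R by simp
      also have "\<dots> \<le> dist (eta r m x) y" using \<delta> xy by blast
      finally show "\<delta> / (2 * R) * dist x y \<le> dist (eta r m x) y" .
    qed
  qed
  show ?thesis
  proof (rule that[of c "2 * R"])
    show "0 < 2 * R" using R by simp
    show "dist (eta r m x) y \<le> 2 * R" if "x \<in> \<Gamma>" "y \<in> \<Gamma>" for x y
      by (intro D R that)
  qed (use c in auto)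
qed

text \<open>The singularity is measured by the distance of the undilated points, the form that
  \<open>kernel_operator_bounds\<close> takes. The third estimate gives regularity in the other
  variable, for the transposed kernel.\<close>

lemma scaled_kernel_bounds:
  assumes \<theta>: "0 < \<theta>" "\<theta> \<le> 1"
  obtains A where
    "\<And>x y. x \<in> \<Gamma> \<Longrightarrow> y \<in> \<Gamma> \<Longrightarrow> x \<noteq> y \<Longrightarrow> \<bar>fund_sol (eta r m x) y\<bar> \<le> A * dist x y powr (- (real DIM('a) - 2 + \<theta>))"
    "\<And>x x' y. x \<in> \<Gamma> \<Longrightarrow> x' \<in> \<Gamma> \<Longrightarrow> y \<in> \<Gamma> \<Longrightarrow> x \<noteq> y \<Longrightarrow> x' \<noteq> y \<Longrightarrow>
      \<bar>fund_sol (eta r m x) y - fund_sol (eta r m x') y\<bar> \<le> A * dist x x' powr \<theta> *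
        (dist x y powr (- (real DIM('a) - 2 + \<theta>)) + dist x' y powr (- (real DIM('a) - 2 + \<theta>)))"
    "\<And>x x' y. x \<in> \<Gamma> \<Longrightarrow> x' \<in> \<Gamma> \<Longrightarrow> y \<in> \<Gamma> \<Longrightarrow> x \<noteq> y \<Longrightarrow> x' \<noteq> y \<Longrightarrow>
      \<bar>fund_sol (eta r m y) x - fund_sol (eta r m y) x'\<bar> \<le> A * dist x x' powr \<theta> *
        (dist x y powr (- (real DIM('a) - 2 + \<theta>)) + dist x' y powr (- (real DIM('a) - 2 + \<theta>)))"
proof -
  let ?a = "real DIM('a) - 2 + \<theta>"
  have a: "0 < ?a" using dim \<theta> by simp
  obtain c D where c: "0 < c" and D: "0 < D"
    and low: "\<And>x y. x \<in> \<Gamma> \<Longrightarrow> y \<in> \<Gamma> \<Longrightarrow> c * dist x y \<le> dist (eta r m x) y"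
    and up: "\<And>x y. x \<in> \<Gamma> \<Longrightarrow> y \<in> \<Gamma> \<Longrightarrow> dist (eta r m x) y \<le> D"
    by (rule eta_separated[of m]) blast
  have ne: "eta r m x \<noteq> y" if "x \<in> \<Gamma>" "y \<in> \<Gamma>" "x \<noteq> y" for x y
  proof -
    have "0 < c * dist x y" using c that by simp
    also have "\<dots> \<le> dist (eta r m x) y" by (rule low[OF that(1,2)])
    finally show ?thesis by auto
  qed
  have pw: "dist (eta r m x) y powr (- ?a) \<le> c powr (- ?a) * dist x y powr (- ?a)"
    if "x \<in> \<Gamma>" "y \<in> \<Gamma>" "x \<noteq> y" for x y
  proof -
    have "dist (eta r m x) y powr (- ?a) \<le> (c * dist x y) powr (- ?a)"
      using c a that low[OF that(1,2)] by (intro powr_mono2') auto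
    then show ?thesis using c by (simp add: powr_mult)
  qed
  define A1 where "A1 = (1 / \<theta>) * (D powr (2 * \<theta>) + 1) + D powr \<theta>"
  define R where "R = (r powi m) powr \<theta>"
  define A where "A = A1 * c powr (- ?a) + (1 / \<theta>) * R * c powr (- ?a) + (1 / \<theta>) * c powr (- ?a)"
  have A1: "0 \<le> A1" using \<theta> by (simp add: A1_def)
  have R: "0 \<le> R" by (simp add: R_def)
  have le1: "A1 * c powr (- ?a) \<le> A" and le2: "(1 / \<theta>) * R * c powr (- ?a) \<le> A" and le3: "(1 / \<theta>) * c powr (- ?a) \<le> A"
    using A1 R \<theta> by (auto simp: A_def intro!: add_nonneg_nonneg)
  have dist_eta: "dist (eta r m x) (eta r m x') powr \<theta> = R * dist x x' powr \<theta>" for x x'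
    using r by (simp add: eta_def R_def powr_mult dist_norm flip: scaleR_diff_right)
  show ?thesis
  proof (rule that)
    fix x y assume xy: "x \<in> \<Gamma>" "y \<in> \<Gamma>" "x \<noteq> y"
    have "\<bar>fund_sol (eta r m x) y\<bar> \<le> A1 * dist (eta r m x) y powr (- ?a)"
      unfolding A1_def by (rule fund_sol_size[OF d \<theta>(1) ne[OF xy] up[OF xy(1,2)]])
    also have "\<dots> \<le> A1 * (c powr (- ?a) * dist x y powr (- ?a))" using pw[OF xy] A1 by (rule mult_left_mono)
    also have "\<dots> \<le> A * dist x y powr (- ?a)"
      unfolding mult.assoc[symmetric] using le1 by (intro mult_right_mono) auto
    finally show "\<bar>fund_sol (eta r m x) y\<bar> \<le> A * dist x y powr (- ?a)" .
  next
    fix x x' y assume xy: "x \<in> \<Gamma>" "x' \<in> \<Gamma>" "y \<in> \<Gamma>" "x \<noteq> y" "x' \<noteq> y"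
    have "\<bar>fund_sol (eta r m x) y - fund_sol (eta r m x') y\<bar> \<le> (1 / \<theta>) * dist (eta r m x) (eta r m x') powr \<theta> *
        (dist (eta r m x) y powr (- ?a) + dist (eta r m x') y powr (- ?a))"
      using xy by (intro fund_sol_hoelder[OF d \<theta>] ne) auto
    also have "\<dots> \<le> (1 / \<theta>) * (R * dist x x' powr \<theta>) *
        (c powr (- ?a) * dist x y powr (- ?a) + c powr (- ?a) * dist x' y powr (- ?a))"
      unfolding dist_eta using xy \<theta> R by (intro mult_left_mono add_mono pw) auto
    also have "\<dots> = (1 / \<theta>) * R * c powr (- ?a) * (dist x x' powr \<theta> * (dist x y powr (- ?a) + dist x' y powr (- ?a)))"
      by (simp only: distrib_left mult_ac)
    also have "\<dots> \<le> A * (dist x x' powr \<theta> * (dist x y powr (- ?a) + dist x' y powr (- ?a)))"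
      using le2 by (intro mult_right_mono) auto
    finally show "\<bar>fund_sol (eta r m x) y - fund_sol (eta r m x') y\<bar> \<le> A * dist x x' powr \<theta> *
        (dist x y powr (- ?a) + dist x' y powr (- ?a))" by (simp only: mult.assoc)
    have "\<bar>fund_sol (eta r m y) x - fund_sol (eta r m y) x'\<bar> = \<bar>fund_sol x (eta r m y) - fund_sol x' (eta r m y)\<bar>"
      by (simp only: fund_sol_commute[of "eta r m y"])
    also have "\<dots> \<le> (1 / \<theta>) * dist x x' powr \<theta> *
        (dist x (eta r m y) powr (- ?a) + dist x' (eta r m y) powr (- ?a))"
      using xy ne[of y x] ne[of y x'] by (intro fund_sol_hoelder[OF d \<theta>]) auto
    also have "\<dots> \<le> (1 / \<theta>) * dist x x' powr \<theta> *
        (c powr (- ?a) * dist x y powr (- ?a) + c powr (- ?a) * dist x' y powr (- ?a))"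
      using xy \<theta> pw[of y x] pw[of y x'] by (intro mult_left_mono add_mono) (auto simp: dist_commute)
    also have "\<dots> = (1 / \<theta>) * c powr (- ?a) * (dist x x' powr \<theta> * (dist x y powr (- ?a) + dist x' y powr (- ?a)))"
      by (simp only: distrib_left mult_ac)
    also have "\<dots> \<le> A * (dist x x' powr \<theta> * (dist x y powr (- ?a) + dist x' y powr (- ?a)))"
      using le3 by (intro mult_right_mono) auto
    finally show "\<bar>fund_sol (eta r m y) x - fund_sol (eta r m y) x'\<bar> \<le> A * dist x x' powr \<theta> *
        (dist x y powr (- ?a) + dist x' y powr (- ?a))" by (simp only: mult.assoc)
  qed
qed

lemma eta_surface_measurable [measurable]: "eta r m \<in> \<sigma> \<rightarrow>\<^sub>M borel"
  by (rule measurable_compose[OF measurable_surface_id eta_measurable])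

lemma scaled_potential_W_fun:
  assumes s: "0 \<le> s" "s < 1" and p: "1 < p"
  obtains B where "0 \<le> B"
    "\<And>f. f \<in> borel_measurable \<sigma> \<Longrightarrow>
      sob_energy s p \<Gamma> (\<lambda>x. \<integral>y. fund_sol (eta r m x) y * f y \<partial>\<sigma>) \<le> ennreal B * (\<integral>\<^sup>+y. ennreal (\<bar>f y\<bar> powr p) \<partial>\<sigma>)"
    "\<And>f. f \<in> borel_measurable \<sigma> \<Longrightarrow> (\<lambda>x. \<integral>y. fund_sol (eta r m x) y * f y \<partial>\<sigma>) \<in> borel_measurable \<sigma>"
proof -
  \<comment> \<open>Halfway between \<open>s\<close> and \<open>1\<close>: above \<open>s\<close>
    for the Slobodeckij seminorm, below \<open>1\<close> so that the singularity
    \<open>d - 2 + \<theta>\<close> stays below \<open>d - 1\<close>.\<close>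
  define \<theta> where "\<theta> = (1 + s) / 2"
  have \<theta>: "0 < \<theta>" "\<theta> \<le> 1" "s < \<theta>" "\<theta> < 1" using s by (auto simp: \<theta>_def)
  obtain A where A: "\<And>x y. x \<in> \<Gamma> \<Longrightarrow> y \<in> \<Gamma> \<Longrightarrow> x \<noteq> y \<Longrightarrow> \<bar>fund_sol (eta r m x) y\<bar> \<le> A * dist x y powr (- (real DIM('a) - 2 + \<theta>))"
    "\<And>x x' y. x \<in> \<Gamma> \<Longrightarrow> x' \<in> \<Gamma> \<Longrightarrow> y \<in> \<Gamma> \<Longrightarrow> x \<noteq> y \<Longrightarrow> x' \<noteq> y \<Longrightarrow>
      \<bar>fund_sol (eta r m x) y - fund_sol (eta r m x') y\<bar> \<le> A * dist x x' powr \<theta> *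
        (dist x y powr (- (real DIM('a) - 2 + \<theta>)) + dist x' y powr (- (real DIM('a) - 2 + \<theta>)))"
    by (rule scaled_kernel_bounds[OF \<theta>(1,2), of m]) blast
  have a: "real DIM('a) - 2 + \<theta> < real DIM('a) - 1" using \<theta> by simp
  have [measurable]: "(\<lambda>x. x) \<in> \<sigma> \<rightarrow>\<^sub>M borel" by measurable
  have m: "(\<lambda>(x, y). fund_sol (eta r m x) y) \<in> borel_measurable (\<sigma> \<Otimes>\<^sub>M \<sigma>)" by measurable
  show ?thesis
    by (rule kernel_W_fun[OF s(1) \<theta>(3) a p m A]) (use that in blast)+
qed

text \<open>Here \<open>y\<close> is the free point and the dilated variable is integrated.
  Convergence almost everywhere is recorded because additivity of \<open>transposed_block\<close>
  rests on it.\<close>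

lemma scaled_potential_transpose_W_fun:
  assumes s: "0 \<le> s" "s < 1" and p: "1 < p"
  obtains B where "0 \<le> B"
    "\<And>f. f \<in> borel_measurable \<sigma> \<Longrightarrow>
      sob_energy s p \<Gamma> (\<lambda>y. \<integral>x. fund_sol (eta r m x) y * f x \<partial>\<sigma>) \<le> ennreal B * (\<integral>\<^sup>+y. ennreal (\<bar>f y\<bar> powr p) \<partial>\<sigma>)"
    "\<And>f. f \<in> borel_measurable \<sigma> \<Longrightarrow> (\<lambda>y. \<integral>x. fund_sol (eta r m x) y * f x \<partial>\<sigma>) \<in> borel_measurable \<sigma>"
    "\<And>f. f \<in> borel_measurable \<sigma> \<Longrightarrow> (\<integral>\<^sup>+y. ennreal (\<bar>f y\<bar> powr p) \<partial>\<sigma>) < \<infinity> \<Longrightarrow>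
      AE y in \<sigma>. integrable \<sigma> (\<lambda>x. fund_sol (eta r m x) y * f x)"
proof -
  define \<theta> where "\<theta> = (1 + s) / 2"
  have \<theta>: "0 < \<theta>" "\<theta> \<le> 1" "s < \<theta>" "\<theta> < 1" using s by (auto simp: \<theta>_def)
  obtain A where A: "\<And>x y. x \<in> \<Gamma> \<Longrightarrow> y \<in> \<Gamma> \<Longrightarrow> x \<noteq> y \<Longrightarrow> \<bar>fund_sol (eta r m x) y\<bar> \<le> A * dist x y powr (- (real DIM('a) - 2 + \<theta>))"
    "\<And>x x' y. x \<in> \<Gamma> \<Longrightarrow> x' \<in> \<Gamma> \<Longrightarrow> y \<in> \<Gamma> \<Longrightarrow> x \<noteq> y \<Longrightarrow> x' \<noteq> y \<Longrightarrow>
      \<bar>fund_sol (eta r m y) x - fund_sol (eta r m y) x'\<bar> \<le> A * dist x x' powr \<theta> *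
        (dist x y powr (- (real DIM('a) - 2 + \<theta>)) + dist x' y powr (- (real DIM('a) - 2 + \<theta>)))"
    by (rule scaled_kernel_bounds[OF \<theta>(1,2), of m]) blast
  have A1: "\<bar>fund_sol (eta r m x) y\<bar> \<le> A * dist y x powr (- (real DIM('a) - 2 + \<theta>))"
    if "y \<in> \<Gamma>" "x \<in> \<Gamma>" "y \<noteq> x" for x y
    using A(1)[of x y] that by (simp add: dist_commute)
  have a: "real DIM('a) - 2 + \<theta> < real DIM('a) - 1" using \<theta> by simp
  have [measurable]: "(\<lambda>x. x) \<in> \<sigma> \<rightarrow>\<^sub>M borel" by measurable
  have m: "(\<lambda>(y, x). fund_sol (eta r m x) y) \<in> borel_measurable (\<sigma> \<Otimes>\<^sub>M \<sigma>)" by measurable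
  show ?thesis
    by (rule kernel_W_fun[OF s(1) \<theta>(3) a p m A1 A(2)]) (use that in blast)+
qed

end

section \<open>Factorisation\<close>

context scaled_surfaces
begin

lemma P0_comp_W0_fun: "h \<in> W0_fun s p \<Gamma> \<Longrightarrow> P0_comp \<Gamma> h = h"
  by (auto simp: W0_fun_def P0_comp_def)

lemma W0_fun_cmult:
  assumes "0 < p" "f \<in> W0_fun s p \<Gamma>"
  shows "(\<lambda>x. c * f x) \<in> W0_fun s p \<Gamma>"
  using W_fun_cmult[of p f s c] assms by (auto simp: W0_fun_def)

lemma S_tilde_fun_W0_fun:
  assumes s: "0 \<le> s" "s < 1" and p: "1 < p" and \<psi>: "\<psi> \<in> W0_fun s p \<Gamma>"
  shows "S_tilde_fun s p r \<Omega> m \<psi> \<in> W0_fun s p \<Gamma>"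
proof -
  let ?f = "\<lambda>x. \<integral>y. fund_sol (eta r m x) y * \<psi> y \<partial>\<sigma>"
  have \<psi>m: "\<psi> \<in> borel_measurable \<sigma>" and fin: "sob_energy s p \<Gamma> \<psi> < \<infinity>"
    using \<psi> by (auto simp: W0_fun_def W_fun_def)
  obtain B where B: "0 \<le> B"
    and en: "\<And>f. f \<in> borel_measurable \<sigma> \<Longrightarrow>
      sob_energy s p \<Gamma> (\<lambda>x. \<integral>y. fund_sol (eta r m x) y * f y \<partial>\<sigma>) \<le> ennreal B * (\<integral>\<^sup>+y. ennreal (\<bar>f y\<bar> powr p) \<partial>\<sigma>)"
    and ms: "\<And>f. f \<in> borel_measurable \<sigma> \<Longrightarrow> (\<lambda>x. \<integral>y. fund_sol (eta r m x) y * f y \<partial>\<sigma>) \<in> borel_measurable \<sigma>"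
    by (rule scaled_potential_W_fun[OF s p, of m]) blast
  have "ennreal B * (\<integral>\<^sup>+y. ennreal (\<bar>\<psi> y\<bar> powr p) \<partial>\<sigma>) < \<infinity>"
    using le_less_trans[OF Lp_le_sob_energy[of \<psi> p s] fin] by (simp add: ennreal_mult_less_top)
  then have "?f \<in> W_fun s p \<Gamma>" using le_less_trans[OF en[OF \<psi>m]] ms[OF \<psi>m] by (simp add: W_fun_def)
  then show ?thesis using P0_comp_W_fun[OF p] \<psi> by (simp add: S_tilde_fun_def)
qed

lemma S_tilde_fun_zero: "S_tilde_fun s p r \<Omega> m (\<lambda>_. 0) = (\<lambda>_. 0)"
  if "0 < p"
proof -
  have "(\<lambda>_. 0) \<in> W0_fun s p \<Gamma>" using W_fun_const[OF that, of 0 s] by (simp add: W0_fun_def)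
  then show ?thesis by (auto simp: S_tilde_fun_def P0_comp_def)
qed

text \<open>In both identities the factor \<open>r ^ k\<close> of the column is pulled out, and mean
  zero removes the logarithmic constant. In the first the integration variable belongs to component
  \<open>k\<close>, as for densities; in the second the free point does, as happens when the
  operator acts on test functions.\<close>

lemma fund_sol_eta_integral:
  assumes f: "integrable \<sigma> f" "(\<integral>y. f y \<partial>\<sigma>) = 0"
  shows "(\<integral>y. fund_sol (eta r (int j) x) (eta r (int k) y) * f y \<partial>\<sigma>) =
      (1 / (r ^ k) ^ (DIM('a) - 2)) * (\<integral>y. fund_sol (eta r (int j - int k) x) y * f y \<partial>\<sigma>)"
    and "(\<integral>y. fund_sol (eta r (int k) x) (eta r (int j) y) * f y \<partial>\<sigma>) =
      (1 / (r ^ k) ^ (DIM('a) - 2)) * (\<integral>y. fund_sol (eta r (int j - int k) y) x * f y \<partial>\<sigma>)"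
proof -
  have [measurable]: "(\<lambda>x. x) \<in> \<sigma> \<rightarrow>\<^sub>M borel" by measurable
  have a: "1 / (r ^ k) ^ (DIM('a) - 2) \<noteq> 0" using r by simp
  show "(\<integral>y. fund_sol (eta r (int j) x) (eta r (int k) y) * f y \<partial>\<sigma>) =
      (1 / (r ^ k) ^ (DIM('a) - 2)) * (\<integral>y. fund_sol (eta r (int j - int k) x) y * f y \<partial>\<sigma>)"
  proof (rule integral_affine_mult[OF f a])
    show "AE y in \<sigma>. fund_sol (eta r (int j) x) (eta r (int k) y) =
        (1 / (r ^ k) ^ (DIM('a) - 2)) * fund_sol (eta r (int j - int k) x) y + (if DIM('a) = 2 then ln (r ^ k) / (2 * pi) else 0)"
      using AE_neq[of "eta r (int j - int k) x"] by eventually_elim (rule fund_sol_eta[OF d r(1)], simp)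
  qed measurable
  show "(\<integral>y. fund_sol (eta r (int k) x) (eta r (int j) y) * f y \<partial>\<sigma>) =
      (1 / (r ^ k) ^ (DIM('a) - 2)) * (\<integral>y. fund_sol (eta r (int j - int k) y) x * f y \<partial>\<sigma>)"
  proof (rule integral_affine_mult[OF f a])
    show "AE y in \<sigma>. fund_sol (eta r (int k) x) (eta r (int j) y) =
        (1 / (r ^ k) ^ (DIM('a) - 2)) * fund_sol (eta r (int j - int k) y) x + (if DIM('a) = 2 then ln (r ^ k) / (2 * pi) else 0)"
      using AE_neq[of "eta r (- (int j - int k)) x"]
    proof eventually_elim
      case (elim y)
      then have "eta r (int j - int k) y \<noteq> x" using eta_cancel(1)[OF r(1), of "int j - int k" y] by auto
      then show ?case
        unfolding fund_sol_commute[of "eta r (int k) x"] by (rule fund_sol_eta[OF d r(1)])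
    qed
  qed measurable
qed

text \<open>A column of the conjugated operator is the potential of one lifted density. The inner
  projection fixes that density, which has mean zero on every component, and the outer projection
  commutes with the dilation.\<close>

lemma scaled_SL_fun_block:
  assumes s: "0 \<le> s" "s < 1" and p: "1 < p" and \<psi>: "\<psi> \<in> W0_fun s p \<Gamma>" and x: "x \<in> \<Gamma>"
  shows "block (scaled_SL_fun s p r \<Omega> \<alpha>) j k \<psi> x =
    block (diag_op r \<alpha> \<circ> toeplitz_op (S_tilde_fun s p r \<Omega>) \<circ> diag_op r (1 - \<alpha>)) j k \<psi> x"
proof -
  define h where "h y = r powr (- (real k * \<alpha>)) * \<psi> y" for y
  have p0: "0 < p" using p by simp
  have h: "h \<in> W0_fun s p \<Gamma>" unfolding h_def using p0 \<psi> by (rule W0_fun_cmult)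
  have hint: "integrable \<sigma> h" "(\<integral>y. h y \<partial>\<sigma>) = 0"
    using h W_fun_integrable[OF p] by (auto simp: W0_fun_def)
  let ?S = "\<lambda>\<psi> x. \<integral>y. fund_sol (eta r (int j - int k) x) y * \<psi> y \<partial>\<sigma>"
  have lift: "resc_inv_fun r \<Omega> \<alpha> (single_seq k \<psi>) = lift k h"
  proof
    fix y
    show "resc_inv_fun r \<Omega> \<alpha> (single_seq k \<psi>) y = lift k h y"
      unfolding resc_inv_fun_def by (subst suminf_one[of k]) (auto simp: single_seq_def lift_def h_def)
  qed
  have "block (scaled_SL_fun s p r \<Omega> \<alpha>) j k \<psi> x =
      r powr (real j * \<alpha>) * P0 r \<Omega> (SL r \<Omega> (lift k h)) (eta r (int j) x)"
    using lift_W0_fun_all[OF s(1) p h, of k]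
    by (simp add: block_def scaled_SL_fun_def lift resc_fun_def SL_proj_fun_def P0_lift P0_comp_W0_fun[OF h])
  also have "\<dots> = r powr (real j * \<alpha>) * P0_comp \<Gamma> (\<lambda>y. SL r \<Omega> (lift k h) (eta r (int j) y)) x"
    by (simp add: P0_eta[OF x])
  \<comment> \<open>Only the index difference \<open>j - k\<close> remains in the kernel: this is
    the Toeplitz structure.\<close>
  also have "(\<lambda>y. SL r \<Omega> (lift k h) (eta r (int j) y)) = (\<lambda>y. r powr real k * ?S h y)"
    unfolding SL_lift fund_sol_eta_integral(1)[OF hint] by (simp only: powr_scale' mult.assoc[symmetric])
  also have "\<dots> = (\<lambda>y. r powr (real k * (1 - \<alpha>)) * ?S \<psi> y)"
  proof -
    have "?S h y = r powr (- (real k * \<alpha>)) * ?S \<psi> y" for y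
      unfolding h_def by (simp add: mult.left_commute)
    moreover have "r powr real k * r powr (- (real k * \<alpha>)) = r powr (real k * (1 - \<alpha>))"
      by (simp add: algebra_simps flip: powr_add)
    ultimately show ?thesis by (simp add: mult.assoc[symmetric])
  qed
  \<comment> \<open>The weight moves under the bare integral, before \<open>S_tilde_fun\<close> with
    its restricted domain is formed.\<close>
  also have "\<dots> = ?S (\<lambda>y. r powr (real k * (1 - \<alpha>)) * \<psi> y)"
    by (simp add: mult.left_commute)
  also have "r powr (real j * \<alpha>) * P0_comp \<Gamma> \<dots> x =
      r powr (real j * \<alpha>) * S_tilde_fun s p r \<Omega> (int j - int k) (\<lambda>y. r powr (real k * (1 - \<alpha>)) * \<psi> y) x"
    using W0_fun_cmult[OF p0 \<psi>] by (simp add: S_tilde_fun_def)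
  finally show ?thesis by (simp add: block_diag_toeplitz_diag[where A="S_tilde_fun s p r \<Omega>", OF S_tilde_fun_zero[OF p0]])
qed

subsection \<open>The dual range\<close>

text \<open>Transposition reverses the order of the factors, so the projection acts on the test
  function before the kernel. On its domain \<open>S_tilde_dual\<close> composes a functional with
  this map.\<close>

definition transposed_block :: "int \<Rightarrow> ('a \<Rightarrow> real) \<Rightarrow> 'a \<Rightarrow> real" where
  "transposed_block m w y = (\<integral>x. fund_sol (eta r m x) y * P0_comp \<Gamma> w x \<partial>\<sigma>)"

text \<open>The norm bound passes through the \<open>p\<close>-th power integral: projection is
  bounded there, the transposed potential gains the smoothness, and the energy of \<open>w\<close>
  dominates. Additivity can fail where the potential of \<open>v\<close> or \<open>w\<close>
  diverges, since default values need not add up.\<close>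

lemma transposed_block_bounds:
  assumes s: "0 \<le> s" "s < 1" and p: "1 < p"
  obtains B where "0 \<le> B"
    "\<And>w. w \<in> W_fun s p \<Gamma> \<Longrightarrow> transposed_block m w \<in> W_fun s p \<Gamma>"
    "\<And>w. w \<in> W_fun s p \<Gamma> \<Longrightarrow> sob_norm s p \<Gamma> (transposed_block m w) \<le> B * sob_norm s p \<Gamma> w"
    "\<And>v w. v \<in> W_fun s p \<Gamma> \<Longrightarrow> w \<in> W_fun s p \<Gamma> \<Longrightarrow>
      AE y in \<sigma>. transposed_block m (\<lambda>x. v x + w x) y = transposed_block m v y + transposed_block m w y"
proof -
  obtain B1 where B1: "0 \<le> B1" and proj: "\<And>f. f \<in> borel_measurable \<sigma> \<Longrightarrow>
    (\<integral>\<^sup>+x. ennreal (\<bar>P0_comp \<Gamma> f x\<bar> powr p) \<partial>\<sigma>) \<le> ennreal B1 * (\<integral>\<^sup>+x. ennreal (\<bar>f x\<bar> powr p) \<partial>\<sigma>)"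
    by (rule P0_comp_Lp_bound[OF p]) blast
  obtain B2 where B2: "0 \<le> B2"
    and en: "\<And>f. f \<in> borel_measurable \<sigma> \<Longrightarrow>
      sob_energy s p \<Gamma> (\<lambda>y. \<integral>x. fund_sol (eta r m x) y * f x \<partial>\<sigma>) \<le> ennreal B2 * (\<integral>\<^sup>+y. ennreal (\<bar>f y\<bar> powr p) \<partial>\<sigma>)"
    and ms: "\<And>f. f \<in> borel_measurable \<sigma> \<Longrightarrow> (\<lambda>y. \<integral>x. fund_sol (eta r m x) y * f x \<partial>\<sigma>) \<in> borel_measurable \<sigma>"
    and ae: "\<And>f. f \<in> borel_measurable \<sigma> \<Longrightarrow> (\<integral>\<^sup>+y. ennreal (\<bar>f y\<bar> powr p) \<partial>\<sigma>) < \<infinity> \<Longrightarrow>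
      AE y in \<sigma>. integrable \<sigma> (\<lambda>x. fund_sol (eta r m x) y * f x)"
    by (rule scaled_potential_transpose_W_fun[OF s p, of m]) blast
  have Pm: "P0_comp \<Gamma> w \<in> borel_measurable \<sigma>" if "w \<in> W_fun s p \<Gamma>" for w
    using P0_comp_W_fun[OF p that] by (simp add: W0_fun_def W_fun_def)
  have Pfin: "(\<integral>\<^sup>+y. ennreal (\<bar>P0_comp \<Gamma> w y\<bar> powr p) \<partial>\<sigma>) < \<infinity>" if "w \<in> W_fun s p \<Gamma>" for w
    using P0_comp_W_fun[OF p that] le_less_trans[OF Lp_le_sob_energy[of "P0_comp \<Gamma> w" p s]]
    by (simp add: W0_fun_def W_fun_def)
  have E: "sob_energy s p \<Gamma> (transposed_block m w) \<le> ennreal (B2 * B1) * sob_energy s p \<Gamma> w" if w: "w \<in> W_fun s p \<Gamma>" for w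
  proof -
    have wm: "w \<in> borel_measurable \<sigma>" using w by (simp add: W_fun_def)
    have "sob_energy s p \<Gamma> (transposed_block m w) \<le> ennreal B2 * (\<integral>\<^sup>+y. ennreal (\<bar>P0_comp \<Gamma> w y\<bar> powr p) \<partial>\<sigma>)"
      unfolding transposed_block_def[abs_def] by (rule en[OF Pm[OF w]])
    also have "\<dots> \<le> ennreal B2 * (ennreal B1 * sob_energy s p \<Gamma> w)"
      by (intro mult_left_mono order_trans[OF proj[OF wm]] Lp_le_sob_energy) auto
    finally show ?thesis using B1 B2 by (simp add: ennreal_mult mult.assoc)
  qed
  show ?thesis
  proof (rule that[of "(B2 * B1) powr (1 / p)"])
    show "0 \<le> (B2 * B1) powr (1 / p)" by simp
  next
    fix w assume w: "w \<in> W_fun s p \<Gamma>"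
    have fin: "sob_energy s p \<Gamma> w < \<infinity>" using w by (simp add: W_fun_def)
    then have fin': "ennreal (B2 * B1) * sob_energy s p \<Gamma> w < \<infinity>" by (simp add: ennreal_mult_less_top)
    show "transposed_block m w \<in> W_fun s p \<Gamma>"
      using le_less_trans[OF E[OF w] fin'] ms[OF Pm[OF w]] by (simp add: W_fun_def transposed_block_def[abs_def])
    have "enn2real (sob_energy s p \<Gamma> (transposed_block m w)) \<le> enn2real (ennreal (B2 * B1) * sob_energy s p \<Gamma> w)"
      using E[OF w] fin' by (intro enn2real_mono) auto
    also have "\<dots> = B2 * B1 * enn2real (sob_energy s p \<Gamma> w)" using B1 B2 by (simp add: enn2real_mult)
    finally show "sob_norm s p \<Gamma> (transposed_block m w) \<le> (B2 * B1) powr (1 / p) * sob_norm s p \<Gamma> w"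
      unfolding sob_norm_def using p B1 B2
      by (subst powr_mult[symmetric]) (auto intro!: powr_mono2)
  next
    fix v w assume v: "v \<in> W_fun s p \<Gamma>" and w: "w \<in> W_fun s p \<Gamma>"
    have P: "P0_comp \<Gamma> (\<lambda>x. v x + w x) = (\<lambda>x. P0_comp \<Gamma> v x + P0_comp \<Gamma> w x)"
      using W_fun_integrable[OF p v] W_fun_integrable[OF p w] by (auto simp: P0_comp_def add_divide_distrib)
    show "AE y in \<sigma>. transposed_block m (\<lambda>x. v x + w x) y = transposed_block m v y + transposed_block m w y"
      using ae[OF Pm[OF v] Pfin[OF v]] ae[OF Pm[OF w] Pfin[OF w]]
      by eventually_elim (simp add: transposed_block_def P distrib_left)
  qed
qed

lemma transposed_block_cmult: "transposed_block m (\<lambda>x. c * w x) = (\<lambda>y. c * transposed_block m w y)"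
  by (simp add: transposed_block_def[abs_def] P0_comp_cmult mult.left_commute)

text \<open>The projection kills constants. In transposed form this says that
  \<open>S_tilde_dual\<close> produces functionals of mean zero.\<close>

lemma transposed_block_indicator: "transposed_block m (indicator \<Gamma>) = (\<lambda>_. 0)"
proof
  fix y
  show "transposed_block m (indicator \<Gamma>) y = 0"
  proof (cases "measure \<sigma> \<Gamma> = 0")
    case True
    then have "emeasure \<sigma> (space \<sigma>) = 0" by (simp add: emeasure_eq_measure)
    then have "AE x in \<sigma>. False" by (intro AE_I[where N="space \<sigma>"] sets.top) auto
    then have "AE x in \<sigma>. fund_sol (eta r m x) y * P0_comp \<Gamma> (indicator \<Gamma>) x = 0" by eventually_elim simp
    then show ?thesis unfolding transposed_block_def by (rule integral_eq_zero_AE)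
  next
    case False
    have "(\<integral>x. indicator \<Gamma> x \<partial>\<sigma>) = (\<integral>x. 1 \<partial>\<sigma> :: real)"
      by (intro Bochner_Integration.integral_cong) auto
    then have "P0_comp \<Gamma> (indicator \<Gamma>) x = 0" if "x \<in> \<Gamma>" for x
      using that False by (simp add: P0_comp_def)
    then have "transposed_block m (indicator \<Gamma>) y = (\<integral>x. 0 \<partial>\<sigma>)"
      unfolding transposed_block_def by (intro Bochner_Integration.integral_cong) auto
    then show ?thesis by simp
  qed
qed

context
  fixes s p q :: real
  assumes s: "- 1 < s" "s < 0" and p: "1 < p" and q_def: "q = p / (p - 1)"
begin

lemma q: "1 < q" "0 < q"
  using p by (auto simp: q_def field_simps)

text \<open>\<open>indicator \<Gamma>\<close> and the constant \<open>1\<close> differ away from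
  \<open>\<Gamma>\<close> and are thus different arguments of a functional;
  \<open>W_dual_cong_AE\<close> identifies them.\<close>

lemma W0_dualD:
  assumes "\<psi> \<in> W0_dual s p \<Gamma>"
  shows "\<psi> \<in> W_dual s p \<Gamma>" "\<psi> (\<lambda>_. c) = 0"
proof -
  show D: "\<psi> \<in> W_dual s p \<Gamma>" using assms by (simp add: W0_dual_def)
  have 1: "(\<lambda>_. 1) \<in> W_fun (- s) q \<Gamma>" by (rule W_fun_const[OF q(2)])
  have ind: "indicator \<Gamma> \<in> W_fun (- s) q \<Gamma>"
    using W_fun_cong[of "\<lambda>_. 1" "indicator \<Gamma>" "- s" q] 1 by simp
  have "AE x in \<sigma>. indicator \<Gamma> x = (1 :: real)" by (rule AE_I2) simp
  then have "\<psi> (indicator \<Gamma>) = \<psi> (\<lambda>_. 1)"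
    by (rule W_dual_cong_AE[OF p D ind[unfolded q_def] 1[unfolded q_def]])
  then have "\<psi> (\<lambda>_. 1) = 0" using assms by (simp add: W0_dual_def)
  then show "\<psi> (\<lambda>_. c) = 0"
    using W_dual_cmult[OF D 1[unfolded q_def], of c] by simp
qed

lemma W_dual_scale:
  assumes F: "F \<in> W_dual s p \<Gamma>"
  shows "(\<lambda>v. c * F v) \<in> W_dual s p \<Gamma>"
proof -
  obtain K where "\<And>v. v \<in> W_fun (- s) (p / (p - 1)) \<Gamma> \<Longrightarrow> \<bar>F v\<bar> \<le> K * sob_norm (- s) (p / (p - 1)) \<Gamma> v"
    using W_dual_bounded[OF F] by blast
  then have "\<bar>c * F v\<bar> \<le> \<bar>c\<bar> * K * sob_norm (- s) (p / (p - 1)) \<Gamma> v" if "v \<in> W_fun (- s) (p / (p - 1)) \<Gamma>" for v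
    using that by (simp add: abs_mult mult.assoc mult_left_mono)
  then show ?thesis
    using W_dual_add[OF F] W_dual_cmult[OF F]
    unfolding W_dual_def Let_def by (auto simp: distrib_left mult.left_commute)
qed

lemma S_tilde_dual_eq: "\<psi> \<in> W0_dual s p \<Gamma> \<Longrightarrow> S_tilde_dual s p r \<Omega> m \<psi> = (\<lambda>w. \<psi> (transposed_block m w))"
  by (auto simp: S_tilde_dual_def W0_dual_def transposed_block_def[abs_def])

lemma S_tilde_dual_W0_dual:
  assumes \<psi>: "\<psi> \<in> W0_dual s p \<Gamma>"
  shows "S_tilde_dual s p r \<Omega> m \<psi> \<in> W0_dual s p \<Gamma>"
proof -
  let ?V = "W_fun (- s) q \<Gamma>"
  have D: "\<psi> \<in> W_dual s p \<Gamma>" by (rule W0_dualD[OF \<psi>])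
  have s': "0 \<le> - s" "- s < 1" using s by auto
  obtain B where B: "0 \<le> B" and V: "\<And>w. w \<in> ?V \<Longrightarrow> transposed_block m w \<in> ?V"
    and norm: "\<And>w. w \<in> ?V \<Longrightarrow> sob_norm (- s) q \<Gamma> (transposed_block m w) \<le> B * sob_norm (- s) q \<Gamma> w"
    and add: "\<And>v w. v \<in> ?V \<Longrightarrow> w \<in> ?V \<Longrightarrow>
      AE y in \<sigma>. transposed_block m (\<lambda>x. v x + w x) y = transposed_block m v y + transposed_block m w y"
    by (rule transposed_block_bounds[OF s' q(1), of m]) blast
  obtain K where K: "0 \<le> K" "\<And>v. v \<in> ?V \<Longrightarrow> \<bar>\<psi> v\<bar> \<le> K * sob_norm (- s) q \<Gamma> v"
    unfolding q_def by (rule W_dual_bounded[OF D]) blast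
  have 1: "\<psi> (transposed_block m (\<lambda>x. v x + w x)) = \<psi> (transposed_block m v) + \<psi> (transposed_block m w)"
    if v: "v \<in> ?V" and w: "w \<in> ?V" for v w
  proof -
    have "\<psi> (transposed_block m (\<lambda>x. v x + w x)) = \<psi> (\<lambda>y. transposed_block m v y + transposed_block m w y)"
      using add[OF v w] V[OF W_fun_add[OF q(2) v w]] W_fun_add[OF q(2) V[OF v] V[OF w]]
      by (intro W_dual_cong_AE[OF p D]) (auto simp: q_def)
    also have "\<dots> = \<psi> (transposed_block m v) + \<psi> (transposed_block m w)"
      using V[OF v] V[OF w] by (intro W_dual_add[OF D]) (auto simp: q_def)
    finally show ?thesis .
  qed
  have 2: "\<psi> (transposed_block m (\<lambda>x. c * v x)) = c * \<psi> (transposed_block m v)" if "v \<in> ?V" for c v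
    unfolding transposed_block_cmult using V[OF that] by (intro W_dual_cmult[OF D]) (auto simp: q_def)
  have 3: "\<bar>\<psi> (transposed_block m v)\<bar> \<le> K * B * sob_norm (- s) q \<Gamma> v" if "v \<in> ?V" for v
    using order_trans[OF K(2)[OF V[OF that]] mult_left_mono[OF norm[OF that] K(1)]] by (simp add: mult.assoc)
  have "S_tilde_dual s p r \<Omega> m \<psi> \<in> W_dual s p \<Gamma>"
    unfolding S_tilde_dual_eq[OF \<psi>] W_dual_def Let_def q_def[symmetric] using 1 2 3 by blast
  moreover have "S_tilde_dual s p r \<Omega> m \<psi> (indicator \<Gamma>) = 0"
    unfolding S_tilde_dual_eq[OF \<psi>] transposed_block_indicator by (rule W0_dualD(2)[OF \<psi>])
  ultimately show ?thesis by (simp add: W0_dual_def)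
qed

lemma zero_W0_dual: "(\<lambda>_. 0) \<in> W0_dual s p \<Gamma>"
proof -
  have "\<exists>C. \<forall>v\<in>W_fun (- s) (p / (p - 1)) \<Gamma>. \<bar>0\<bar> \<le> C * sob_norm (- s) (p / (p - 1)) \<Gamma> v"
    by (intro exI[of _ 0]) simp
  then show ?thesis by (simp add: W0_dual_def W_dual_def Let_def)
qed

text \<open>Restriction to one component does not increase the energy, and the dilation changes it
  by at most a constant factor.\<close>

lemma eta_pullback_W_fun:
  obtains B where "0 \<le> B"
    "\<And>v. v \<in> W_fun (- s) q (Gam_all r \<Omega>) \<Longrightarrow> (\<lambda>x. v (eta r (int k) x)) \<in> W_fun (- s) q \<Gamma>"
    "\<And>v. v \<in> W_fun (- s) q (Gam_all r \<Omega>) \<Longrightarrow>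
      sob_norm (- s) q \<Gamma> (\<lambda>x. v (eta r (int k) x)) \<le> B * sob_norm (- s) q (Gam_all r \<Omega>) v"
proof -
  obtain a b where ab: "0 < a" "0 < b"
    "\<And>f. sob_energy (- s) q (Gam r \<Omega> k) f \<le> ennreal a * sob_energy (- s) q \<Gamma> (\<lambda>x. f (eta r (int k) x))"
    "\<And>f. sob_energy (- s) q \<Gamma> (\<lambda>x. f (eta r (int k) x)) \<le> ennreal b * sob_energy (- s) q (Gam r \<Omega> k) f"
    unfolding Gam_def by (rule sob_energy_transport[OF r(1) closed, where k=k and s="- s" and p=q]) blast
  have E: "sob_energy (- s) q \<Gamma> (\<lambda>x. v (eta r (int k) x)) \<le> ennreal b * sob_energy (- s) q (Gam_all r \<Omega>) v" for v
    by (rule order_trans[OF ab(4)], intro mult_left_mono sob_energy_mono Gam_borel Gam_all_borel Gam_subset_all) simp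
  have m: "eta r (int k) \<in> \<sigma> \<rightarrow>\<^sub>M surface (Gam_all r \<Omega>)"
    by (rule measurable_into_surface[OF eta_surface_measurable]) (auto simp: Gam_all_def Gam_def)
  show ?thesis
  proof (rule that[of "b powr (1 / q)"])
    fix v assume v: "v \<in> W_fun (- s) q (Gam_all r \<Omega>)"
    then have fin: "ennreal b * sob_energy (- s) q (Gam_all r \<Omega>) v < \<infinity>"
      by (simp add: W_fun_def ennreal_mult_less_top)
    show "(\<lambda>x. v (eta r (int k) x)) \<in> W_fun (- s) q \<Gamma>"
      using v le_less_trans[OF E fin] measurable_compose[OF m, of v borel] by (simp add: W_fun_def)
    have "enn2real (sob_energy (- s) q \<Gamma> (\<lambda>x. v (eta r (int k) x))) \<le> enn2real (ennreal b * sob_energy (- s) q (Gam_all r \<Omega>) v)"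
      using E fin by (intro enn2real_mono) auto
    also have "\<dots> = b * enn2real (sob_energy (- s) q (Gam_all r \<Omega>) v)" using ab by (simp add: enn2real_mult)
    finally show "sob_norm (- s) q \<Gamma> (\<lambda>x. v (eta r (int k) x)) \<le> b powr (1 / q) * sob_norm (- s) q (Gam_all r \<Omega>) v"
      unfolding sob_norm_def using q ab by (subst powr_mult[symmetric]) (auto intro!: powr_mono2)
  qed simp
qed

text \<open>The dual counterpart of lifting: a functional is moved to component \<open>k\<close> by
  composing it with the pullback of test functions. The pullback only restricts and dilates, so no
  interaction between components has to be estimated.\<close>

lemma pushforward_W0_dual_all:
  assumes \<psi>: "\<psi> \<in> W0_dual s p \<Gamma>"
  shows "(\<lambda>v. c * \<psi> (\<lambda>x. v (eta r (int k) x))) \<in> W0_dual_all s p r \<Omega>"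
proof -
  let ?V = "W_fun (- s) q (Gam_all r \<Omega>)" and ?F = "\<lambda>v. c * \<psi> (\<lambda>x. v (eta r (int k) x))"
  have D: "\<psi> \<in> W_dual s p \<Gamma>" by (rule W0_dualD[OF \<psi>])
  obtain B where B: "0 \<le> B" and V: "\<And>v. v \<in> ?V \<Longrightarrow> (\<lambda>x. v (eta r (int k) x)) \<in> W_fun (- s) q \<Gamma>"
    and norm: "\<And>v. v \<in> ?V \<Longrightarrow> sob_norm (- s) q \<Gamma> (\<lambda>x. v (eta r (int k) x)) \<le> B * sob_norm (- s) q (Gam_all r \<Omega>) v"
    by (rule eta_pullback_W_fun[of k]) blast
  obtain K where K: "0 \<le> K" "\<And>v. v \<in> W_fun (- s) q \<Gamma> \<Longrightarrow> \<bar>\<psi> v\<bar> \<le> K * sob_norm (- s) q \<Gamma> v"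
    unfolding q_def by (rule W_dual_bounded[OF D]) blast
  have 1: "?F (\<lambda>x. v x + w x) = ?F v + ?F w" if "v \<in> ?V" "w \<in> ?V" for v w
    using W_dual_add[OF D V[OF that(1), unfolded q_def] V[OF that(2), unfolded q_def]] by (simp add: distrib_left)
  have 2: "?F (\<lambda>x. a * v x) = a * ?F v" if "v \<in> ?V" for a v
    using W_dual_cmult[OF D V[OF that, unfolded q_def], of a] by simp
  have 3: "\<bar>?F v\<bar> \<le> \<bar>c\<bar> * (K * B) * sob_norm (- s) q (Gam_all r \<Omega>) v" if "v \<in> ?V" for v
    using order_trans[OF K(2)[OF V[OF that]] mult_left_mono[OF norm[OF that] K(1)]]
    by (simp add: abs_mult mult.assoc mult_left_mono)
  have "?F \<in> W_dual s p (Gam_all r \<Omega>)"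
    unfolding W_dual_def Let_def q_def[symmetric] using 1 2 3 by blast
  moreover have "\<psi> (\<lambda>x. indicator (Gam r \<Omega> j) (eta r (int k) x)) = 0" for j
  proof -
    let ?c = "if j = k then 1 else 0 :: real"
    have c: "(\<lambda>_. ?c) \<in> W_fun (- s) q \<Gamma>" by (rule W_fun_const[OF q(2)])
    have eq: "indicator (Gam r \<Omega> j) (eta r (int k) x) = ?c" if "x \<in> \<Gamma>" for x
      using eta_Gam_iff[OF that, of k j] by (auto simp: indicator_def)
    have i: "(\<lambda>x. indicator (Gam r \<Omega> j) (eta r (int k) x)) \<in> W_fun (- s) q \<Gamma>"
      using W_fun_cong[of "\<lambda>x. indicator (Gam r \<Omega> j) (eta r (int k) x)" "\<lambda>_. ?c" "- s" q] eq c by blast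
    have "\<psi> (\<lambda>x. indicator (Gam r \<Omega> j) (eta r (int k) x)) = \<psi> (\<lambda>_. ?c)"
      by (rule W_dual_cong_AE[OF p D i[unfolded q_def] c[unfolded q_def]]) (rule AE_I2, simp add: eq)
    then show ?thesis using W0_dualD(2)[OF \<psi>] by simp
  qed
  ultimately show ?thesis by (simp add: W0_dual_all_def)
qed

text \<open>By duality the layer operator acts on the test function lifted to component
  \<open>j\<close>, and the functional sees the result only on component \<open>k\<close>.
  Integration thus runs over the row index and the free point belongs to the column, the situation
  of the second identity in \<open>fund_sol_eta_integral\<close>.\<close>

lemma scaled_SL_dual_block:
  assumes \<psi>: "\<psi> \<in> W0_dual s p \<Gamma>" and w: "w \<in> W_fun (- s) q \<Gamma>"
  shows "block (scaled_SL_dual s p r \<Omega> \<alpha>) j k \<psi> w =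
    block (diag_op r \<alpha> \<circ> toeplitz_op (S_tilde_dual s p r \<Omega>) \<circ> diag_op r (1 - \<alpha>)) j k \<psi> w"
proof -
  let ?n = "real DIM('a) - 1"
  have D: "\<psi> \<in> W_dual s p \<Gamma>" by (rule W0_dualD[OF \<psi>])
  define c where "c = r powr (- (real k * \<alpha>)) * r powr (real k * ?n)"
  define a where "a = r powr (real j * ?n) * (1 / (r ^ k) ^ (DIM('a) - 2))"
  define w0 where "w0 = P0_comp \<Gamma> w"
  have w0: "w0 \<in> W0_fun (- s) q \<Gamma>" unfolding w0_def by (rule P0_comp_W_fun[OF q(1) w])
  have w0int: "integrable \<sigma> w0" "(\<integral>y. w0 y \<partial>\<sigma>) = 0"
    using w0 W_fun_integrable[OF q(1)] by (auto simp: W0_fun_def)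
  let ?T = "transposed_block (int j - int k) w"
  have s': "0 \<le> - s" "- s < 1" using s by auto
  have TV: "?T \<in> W_fun (- s) q \<Gamma>"
    by (rule transposed_block_bounds[OF s' q(1), of "int j - int k"]) (use w in blast)
  define G where "G v = c * \<psi> (\<lambda>x. v (eta r (int k) x))" for v
  have push: "resc_inv_dual r \<alpha> (single_seq k \<psi>) = G"
  proof
    fix v
    show "resc_inv_dual r \<alpha> (single_seq k \<psi>) v = G v"
      unfolding resc_inv_dual_def by (subst suminf_one[of k]) (auto simp: single_seq_def G_def c_def)
  qed
  have G: "G \<in> W0_dual_all s p r \<Omega>" unfolding G_def by (rule pushforward_W0_dual_all[OF \<psi>])
  have "block (scaled_SL_dual s p r \<Omega> \<alpha>) j k \<psi> w =
      r powr (real j * \<alpha>) * (r powr (- (real j * ?n)) * G (P0 r \<Omega> (SL r \<Omega> (P0 r \<Omega> (lift j w)))))"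
    using G by (simp add: block_def scaled_SL_dual_def push resc_dual_def SL_proj_dual_def by_duality_def lift_def[abs_def])
  also have "G (P0 r \<Omega> (SL r \<Omega> (P0 r \<Omega> (lift j w)))) = c * (a * \<psi> ?T)"
  proof -
    let ?u = "SL r \<Omega> (lift j w0)"
    have u: "(\<lambda>y. ?u (eta r (int k) y)) = (\<lambda>y. a * ?T y)"
      unfolding SL_lift fund_sol_eta_integral(2)[OF w0int]
      by (simp only: powr_scale a_def transposed_block_def w0_def mult.assoc)
    \<comment> \<open>The projection applied after \<open>SL\<close> adds this constant, which
      \<open>\<psi>\<close> annihilates.\<close>
    define b where "b = - (\<integral>y. a * ?T y \<partial>\<sigma>) / measure \<sigma> \<Gamma>"
    have b: "P0_comp \<Gamma> (\<lambda>x. a * ?T x) = (\<lambda>x. a * ?T x + b)"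
      by (auto simp: P0_comp_def b_def)
    have aT: "(\<lambda>x. a * ?T x) \<in> W_fun (- s) q \<Gamma>" by (rule W_fun_cmult[OF q(2) TV])
    have bV: "(\<lambda>_. b) \<in> W_fun (- s) q \<Gamma>" by (rule W_fun_const[OF q(2)])
    have abV: "(\<lambda>x. a * ?T x + b) \<in> W_fun (- s) q \<Gamma>" by (rule W_fun_add[OF q(2) aT bV])
    have eq: "P0 r \<Omega> ?u (eta r (int k) x) = a * ?T x + b" if "x \<in> \<Gamma>" for x
      by (simp add: P0_eta[OF that] u b)
    have V: "(\<lambda>x. P0 r \<Omega> ?u (eta r (int k) x)) \<in> W_fun (- s) q \<Gamma>"
      using W_fun_cong[of "\<lambda>x. P0 r \<Omega> ?u (eta r (int k) x)" "\<lambda>x. a * ?T x + b" "- s" q] eq abV by blast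
    have "\<psi> (\<lambda>x. P0 r \<Omega> ?u (eta r (int k) x)) = \<psi> (\<lambda>x. a * ?T x + b)"
      by (rule W_dual_cong_AE[OF p D V[unfolded q_def] abV[unfolded q_def]]) (rule AE_I2, simp add: eq)
    also have "\<dots> = \<psi> (\<lambda>x. a * ?T x) + \<psi> (\<lambda>_. b)"
      by (rule W_dual_add[OF D aT[unfolded q_def] bV[unfolded q_def]])
    also have "\<dots> = a * \<psi> ?T"
      using W_dual_cmult[OF D TV[unfolded q_def], of a] W0_dualD(2)[OF \<psi>] by simp
    finally show ?thesis by (simp add: G_def P0_lift w0_def)
  qed
  \<comment> \<open>The Jacobian of component \<open>j\<close>, from \<open>SL_lift\<close>, cancels
    against the one in \<open>resc_dual\<close>; that of component \<open>k\<close>, from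
    \<open>resc_inv_dual\<close>, combines with homogeneity to \<open>r powr real k\<close>.\<close>
  also have "r powr (real j * \<alpha>) * (r powr (- (real j * ?n)) * (c * (a * \<psi> ?T))) =
      r powr (real j * \<alpha>) * (r powr (real k * (1 - \<alpha>)) * \<psi> ?T)"
  proof -
    have "r powr (- (real j * ?n)) * r powr (real j * ?n) = 1" using r by (simp flip: powr_add)
    moreover have "r powr (real k * ?n) * (1 / (r ^ k) ^ (DIM('a) - 2)) = r powr real k"
      unfolding powr_scale[symmetric] by (rule powr_scale')
    moreover have "r powr (- (real k * \<alpha>)) * r powr real k = r powr (real k * (1 - \<alpha>))"
      by (simp add: algebra_simps flip: powr_add)
    moreover have "r powr (- (real j * ?n)) * (c * (a * z)) =
        (r powr (- (real j * ?n)) * r powr (real j * ?n)) *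
        (r powr (- (real k * \<alpha>)) * (r powr (real k * ?n) * (1 / (r ^ k) ^ (DIM('a) - 2)))) * z" for z
      unfolding c_def a_def by (simp only: mult_ac)
    ultimately show ?thesis by simp
  qed
  also have "r powr (real k * (1 - \<alpha>)) * \<psi> ?T =
      S_tilde_dual s p r \<Omega> (int j - int k) (\<lambda>v. r powr (real k * (1 - \<alpha>)) * \<psi> v) w"
  proof -
    have "(\<lambda>v. r powr (real k * (1 - \<alpha>)) * \<psi> v) \<in> W0_dual s p \<Gamma>"
      using W_dual_scale[OF D] \<psi> by (simp add: W0_dual_def)
    then show ?thesis by (simp add: S_tilde_dual_eq)
  qed
  finally show ?thesis
    by (subst block_diag_toeplitz_diag) (auto simp: S_tilde_dual_eq zero_W0_dual)
qed

end

end

theorem lemma8: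
  fixes \<Omega> :: "'a::euclidean_space set" and r p s \<alpha> :: real
  assumes "DIM('a) = 2 \<or> DIM('a) = 3"
    and "0 < r" and "r < 1"
    and "open \<Omega>" and "connected \<Omega>" and "\<Omega> \<noteq> {}" and "bounded \<Omega>"
    and "smooth_boundary \<Omega>"
    and "0 \<notin> closure \<Omega>"
    and "\<And>j k :: nat. j \<noteq> k \<Longrightarrow>
           closure (eta r (int j) ` \<Omega>) \<inter> closure (eta r (int k) ` \<Omega>) = {}"
    and "1 < p" and "-1 < s" and "s < 1"
    and "\<alpha> = (real DIM('a) - 1) / p - s"
  shows
    "(0 \<le> s \<longrightarrow>
        (\<forall>m. S_tilde_fun s p r \<Omega> m \<in> W0_fun s p (frontier \<Omega>) \<rightarrow> W0_fun s p (frontier \<Omega>)) \<and>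
        (\<forall>j k. \<forall>\<psi> \<in> W0_fun s p (frontier \<Omega>).
           AE x in surface (frontier \<Omega>).
             block (scaled_SL_fun s p r \<Omega> \<alpha>) j k \<psi> x =
             block (diag_op r \<alpha> \<circ> toeplitz_op (S_tilde_fun s p r \<Omega>) \<circ> diag_op r (1 - \<alpha>)) j k \<psi> x)) \<and>
     (s < 0 \<longrightarrow>
        (\<forall>m. S_tilde_dual s p r \<Omega> m \<in> W0_dual s p (frontier \<Omega>) \<rightarrow> W0_dual s p (frontier \<Omega>)) \<and>
        (\<forall>j k. \<forall>\<psi> \<in> W0_dual s p (frontier \<Omega>).
           \<forall>w \<in> W_fun (-s) (p / (p - 1)) (frontier \<Omega>).
             block (scaled_SL_dual s p r \<Omega> \<alpha>) j k \<psi> w =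
             block (diag_op r \<alpha> \<circ> toeplitz_op (S_tilde_dual s p r \<Omega>) \<circ> diag_op r (1 - \<alpha>)) j k \<psi> w))"
proof -
  have dim: "2 \<le> DIM('a)" using assms(1) by auto
  obtain C where C: "0 \<le> C" "\<And>y t. 0 < t \<Longrightarrow>
    emeasure (hausdorff_measure (DIM('a) - 1)) (frontier \<Omega> \<inter> cball y t) \<le> ennreal (C * t ^ (DIM('a) - 1))"
    by (rule frontier_regularity[OF dim assms(4,7,8)]) blast
  \<comment> \<open>Disjointness is assumed for the closures of the scaled domains; it passes to the
    scaled boundaries contained in them.\<close>
  have sub: "Gam r \<Omega> j \<subseteq> closure (eta r (int j) ` \<Omega>)" for j
  proof -
    have "Gam r \<Omega> j \<subseteq> (*\<^sub>R) (r powi int j) ` closure \<Omega>"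
      by (auto simp: Gam_def eta_def frontier_def)
    also have "\<dots> = closure (eta r (int j) ` \<Omega>)"
      unfolding eta_def[abs_def] by (rule closure_scaleR)
    finally show ?thesis .
  qed
  interpret scaled_surfaces \<Omega> C r
  proof
    show "bounded (frontier \<Omega>)" by (rule compact_imp_bounded[OF compact_frontier_bounded[OF assms(7)]])
    show "0 \<notin> frontier \<Omega>" using assms(9) by (simp add: frontier_def)
    show "Gam r \<Omega> j \<inter> Gam r \<Omega> k = {}" if "j \<noteq> k" for j k
      using assms(10)[OF that] sub[of j] sub[of k] by blast
  qed (use assms C dim in auto)
  show ?thesis
    using S_tilde_fun_W0_fun[OF _ assms(13,11)] scaled_SL_fun_block[OF _ assms(13,11)]
      S_tilde_dual_W0_dual[OF assms(12) _ assms(11) refl] scaled_SL_dual_block[OF assms(12) _ assms(11) refl]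
    by (auto intro!: AE_I2)
qed

end
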